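(* Let $G$ be a locally compact, $\sigma$-compact abelian group, let $(X,G,m)$ be a dynamical system and let $f\in L^2(X,m)$. Then the Fourier transform of the autocorrelation $\gamma^f$ is the spectral measure $\varrho^f$ of $f$, i.e. $\widehat{\gamma^f}=\varrho^f$.
   Context: $G$ is written additively, with Haar measure $m_G$ and dual group $\widehat{G}$ (continuous homomorphisms $G\to\mathbb{T}$). A dynamical system $(X,G,m)$ consists of a compact (Hausdorff) space $X$ with a continuous action $G\times X\to X$, $(t,x)\mapsto\alpha_t(x)$, and a $G$-invariant (Radon) probability measure $m$ on $X$. $\langle f,g\rangle=\int_X f\overline{g}\,dm$, and $T_tf=f\circ\alpha_{-t}$ for $t\in G$, $f\in L^2(X,m)$. The spectral measure of $f\in L^2(X,m)$ is the unique finite measure $\varrho^f$ on $\widehat{G}$ with $\langle T_tf,f\rangle=\int_{\widehat{G}}\eta(t)\,d\varrho^f(\eta)$ for all $t\in G$. For $\varphi,\psi\in C_c(G)$: $(\varphi\ast\psi)(t)=\int_G\varphi(t-s)\psi(s)\,dm_G(s)$, $\widetilde\varphi(t)=\overline{\varphi(-t)}$, and $\check\varphi(\eta)=\int_G\eta(t)\varphi(t)\,dm_G(t)$ for $\eta\in\widehat{G}$. For a measure $\gamma$ on $G$ write $\gamma(\varphi)=\int\varphi\,d\gamma$. For $f\in L^2(X,m)$ let $\mathcal{N}^f:C_c(G)\to L^2(X,m)$, $\mathcal{N}^f(\varphi)=\int_G\varphi(t)\,T_tf\,dm_G(t)$. The autocorrelation $\gamma^f$ of $f$ is the unique measure on $G$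 with $\gamma^f(\varphi\ast\widetilde\psi)=\langle\mathcal{N}^f(\varphi),\mathcal{N}^f(\psi)\rangle$ for all $\varphi,\psi\in C_c(G)$. It is positive definite. The Fourier transform of a positive definite measure $\gamma$ on $G$ is the unique positive measure $\widehat\gamma$ on $\widehat{G}$ with $\gamma(\varphi\ast\widetilde\varphi)=\int_{\widehat{G}}|\check\varphi|^2\,d\widehat\gamma$ for all $\varphi\in C_c(G)$. *)

theory Defs
  imports "HOL-Probability.Probability_Measure"
begin

section \<open>Locally compact, sigma-compact abelian groups and Haar measure\<close>

definition sigma_compact :: "'a::topological_space set \<Rightarrow> bool" where
  "sigma_compact S \<longleftrightarrow> (\<exists>K :: nat \<Rightarrow> 'a set. (\<forall>n. compact (K n)) \<and> (\<Union>n. K n) = S)"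

text \<open>Positive Radon measures: Borel measures, finite on compact sets, outer regular on Borel
  sets and inner regular on open sets. On a locally compact Hausdorff space these are exactly the
  measures representing the positive linear functionals on the continuous functions with compact
  support. A finite Radon measure is automatically inner regular on all Borel sets.\<close>

definition radon_measure :: "'a::topological_space measure \<Rightarrow> bool" where
  "radon_measure M \<longleftrightarrow>
     sets M = sets borel \<and>
     (\<forall>K. compact K \<longrightarrow> emeasure M K < \<infinity>) \<and>
     (\<forall>B \<in> sets borel. emeasure M B = (INF U\<in>{U. open U \<and> B \<subseteq> U}. emeasure M U)) \<and>
     (\<forall>U. open U \<longrightarrow> emeasure M U = (SUP K\<in>{K. compact K \<and> K \<subseteq> U}. emeasure M K))"

definition haar_measure :: "'g::topological_ab_group_add measure \<Rightarrow> bool" where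
  "haar_measure \<mu> \<longleftrightarrow>
     radon_measure \<mu> \<and> emeasure \<mu> UNIV \<noteq> 0 \<and> (\<forall>t. distr \<mu> borel (\<lambda>s. t + s) = \<mu>)"

section \<open>The dual group\<close>

text \<open>Only the underlying topological space of the dual group is needed, so its group
  structure (pointwise multiplication of characters) is not introduced.\<close>

typedef (overloaded) ('g::topological_ab_group_add) dual =
  "{c :: 'g \<Rightarrow> complex. continuous_on UNIV c \<and> (\<forall>t. cmod (c t) = 1) \<and>
      (\<forall>s t. c (s + t) = c s * c t)}"
  morphisms char_apply Abs_dual
  by (rule exI[of _ "\<lambda>_. 1"]) simp

text \<open>The compact-open topology.\<close>

instantiation dual :: (topological_ab_group_add) topological_space
begin

definition open_dual :: "'a dual set \<Rightarrow> bool" where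
  "open_dual = generate_topology
     {{\<eta>. char_apply \<eta> ` K \<subseteq> V} | K V. compact K \<and> open V}"

instance
proof
  show "open (UNIV :: 'a dual set)"
    unfolding open_dual_def by (rule generate_topology.UNIV)
  show "open (S \<inter> T)" if "open S" "open T" for S T :: "'a dual set"
    using that unfolding open_dual_def by (rule generate_topology.Int)
  show "open (\<Union>A)" if "\<forall>S\<in>A. open S" for A :: "'a dual set set"
    using that unfolding open_dual_def by (intro generate_topology.UN) blast
qed

end

section \<open>Continuous functions with compact support, measures as functionals\<close>

definition Cc :: "('g::topological_space \<Rightarrow> complex) set" where
  "Cc = {\<phi>. continuous_on UNIV \<phi> \<and> compact (closure {t. \<phi> t \<noteq> 0})}"

definition group_convolution :: "'g::topological_ab_group_add measure \<Rightarrow>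
    ('g \<Rightarrow> complex) \<Rightarrow> ('g \<Rightarrow> complex) \<Rightarrow> 'g \<Rightarrow> complex" where
  "group_convolution mG \<phi> \<psi> t = (LINT s|mG. \<phi> (t - s) * \<psi> s)"

definition tilde :: "('g::group_add \<Rightarrow> complex) \<Rightarrow> 'g \<Rightarrow> complex" where
  "tilde \<phi> t = cnj (\<phi> (- t))"

definition check_transform :: "'g::topological_ab_group_add measure \<Rightarrow>
    ('g \<Rightarrow> complex) \<Rightarrow> 'g dual \<Rightarrow> complex" where
  "check_transform mG \<phi> \<eta> = (LINT t|mG. char_apply \<eta> t * \<phi> t)"

text \<open>A (complex, in general unbounded) measure on the group is a linear functional on
  \<^term>\<open>Cc\<close> that is continuous in the inductive limit topology; its value at \<open>\<phi>\<close> is the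
  integral of \<open>\<phi>\<close>. Extensionality outside \<^term>\<open>Cc\<close> makes equality of
  HOL functions coincide with equality of measures.\<close>

definition complex_measure :: "(('g::topological_space \<Rightarrow> complex) \<Rightarrow> complex) \<Rightarrow> bool" where
  "complex_measure \<gamma> \<longleftrightarrow>
     \<gamma> \<in> extensional Cc \<and>
     (\<forall>\<phi>\<in>Cc. \<forall>\<psi>\<in>Cc. \<gamma> (\<lambda>t. \<phi> t + \<psi> t) = \<gamma> \<phi> + \<gamma> \<psi>) \<and>
     (\<forall>c. \<forall>\<phi>\<in>Cc. \<gamma> (\<lambda>t. c * \<phi> t) = c * \<gamma> \<phi>) \<and>
     (\<forall>K. compact K \<longrightarrow> (\<exists>C. \<forall>\<phi>\<in>Cc. {t. \<phi> t \<noteq> 0} \<subseteq> K \<longrightarrow>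
        cmod (\<gamma> \<phi>) \<le> C * (SUP t. cmod (\<phi> t))))"

section \<open>Dynamical systems\<close>

definition dynamical_system ::
    "('g::topological_ab_group_add \<Rightarrow> 'x::t2_space \<Rightarrow> 'x) \<Rightarrow> 'x measure \<Rightarrow> bool" where
  "dynamical_system \<alpha> m \<longleftrightarrow>
     compact (UNIV :: 'x set) \<and>
     continuous_on UNIV (\<lambda>(t, x). \<alpha> t x) \<and>
     (\<forall>x. \<alpha> 0 x = x) \<and> (\<forall>s t x. \<alpha> (s + t) x = \<alpha> s (\<alpha> t x)) \<and>
     radon_measure m \<and> prob_space m \<and> (\<forall>t. distr m borel (\<alpha> t) = m)"

text \<open>Elements of the Hilbert space are represented by square integrable functions; everything
  below depends only on their classes modulo equality almost everywhere.\<close>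

definition L2 :: "'x measure \<Rightarrow> ('x \<Rightarrow> complex) set" where
  "L2 m = {f \<in> borel_measurable m. integrable m (\<lambda>x. (cmod (f x))\<^sup>2)}"

definition l2_inner :: "'x measure \<Rightarrow> ('x \<Rightarrow> complex) \<Rightarrow> ('x \<Rightarrow> complex) \<Rightarrow> complex" where
  "l2_inner m f g = (LINT x|m. f x * cnj (g x))"

definition translate ::
    "('g::group_add \<Rightarrow> 'x \<Rightarrow> 'x) \<Rightarrow> 'g \<Rightarrow> ('x \<Rightarrow> complex) \<Rightarrow> 'x \<Rightarrow> complex" where
  "translate \<alpha> t f = f \<circ> \<alpha> (- t)"

text \<open>The Hilbert space valued integral of the norm continuous, compactly supported function
  mapping \<open>t\<close> to \<open>\<phi> t\<close> times the translate of \<open>f\<close> by \<open>t\<close>, i.e. the element (unique almost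
  everywhere) whose inner products are obtained by integrating inner products.
  The Bochner integral of the library is not applicable, since the Hilbert space depends on
  \<open>m\<close> and need not be separable.\<close>

definition orbit_integral :: "'g::topological_ab_group_add measure \<Rightarrow> ('g \<Rightarrow> 'x \<Rightarrow> 'x) \<Rightarrow>
    'x measure \<Rightarrow> ('x \<Rightarrow> complex) \<Rightarrow> ('g \<Rightarrow> complex) \<Rightarrow> 'x \<Rightarrow> complex" where
  "orbit_integral mG \<alpha> m f \<phi> =
     (SOME h. h \<in> L2 m \<and>
        (\<forall>g\<in>L2 m. l2_inner m h g = (LINT t|mG. \<phi> t * l2_inner m (translate \<alpha> t f) g)))"

section \<open>Spectral measure, autocorrelation, Fourier transform\<close>

definition spectral_measure :: "('g::topological_ab_group_add \<Rightarrow> 'x \<Rightarrow> 'x) \<Rightarrow>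
    'x measure \<Rightarrow> ('x \<Rightarrow> complex) \<Rightarrow> 'g dual measure" where
  "spectral_measure \<alpha> m f =
     (THE \<rho>. radon_measure \<rho> \<and> finite_measure \<rho> \<and>
        (\<forall>t. l2_inner m (translate \<alpha> t f) f = (LINT \<eta>|\<rho>. char_apply \<eta> t)))"

definition autocorrelation :: "'g::topological_ab_group_add measure \<Rightarrow> ('g \<Rightarrow> 'x \<Rightarrow> 'x) \<Rightarrow>
    'x measure \<Rightarrow> ('x \<Rightarrow> complex) \<Rightarrow> ('g \<Rightarrow> complex) \<Rightarrow> complex" where
  "autocorrelation mG \<alpha> m f =
     (THE \<gamma>. complex_measure \<gamma> \<and>
        (\<forall>\<phi>\<in>Cc. \<forall>\<psi>\<in>Cc. \<gamma> (group_convolution mG \<phi> (tilde \<psi>)) =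
           l2_inner m (orbit_integral mG \<alpha> m f \<phi>) (orbit_integral mG \<alpha> m f \<psi>)))"

text \<open>Meaningful for positive definite \<open>\<gamma>\<close>. The transform may be an infinite measure, so
  integrability is required explicitly.\<close>

definition fourier_transform :: "'g::topological_ab_group_add measure \<Rightarrow>
    (('g \<Rightarrow> complex) \<Rightarrow> complex) \<Rightarrow> 'g dual measure" where
  "fourier_transform mG \<gamma> =
     (THE \<mu>. radon_measure \<mu> \<and>
        (\<forall>\<phi>\<in>Cc. integrable \<mu> (\<lambda>\<eta>. (cmod (check_transform mG \<phi> \<eta>))\<^sup>2) \<and>
           \<gamma> (group_convolution mG \<phi> (tilde \<phi>)) =
             complex_of_real (LINT \<eta>|\<mu>. (cmod (check_transform mG \<phi> \<eta>))\<^sup>2)))"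

end

theory Submission
  imports Defs
begin

text \<open>Put \<open>c t = \<langle>T\<^sub>t f, f\<rangle>\<close>, a bounded continuous function on the group. By Fubini, the functional
  with density \<open>c\<close> satisfies the equation defining the autocorrelation, and an approximate identity
  shows that a measure is determined by its values on convolutions. Hence the condition defining the
  Fourier transform \<open>\<mu>\<close> of the autocorrelation says that, for all \<open>\<phi>\<close>, the double integral of
  \<open>\<phi> t * cnj (\<phi> s) * c (t - s)\<close> is the \<open>\<mu>\<close>-integral of the squared modulus of the transform of \<open>\<phi>\<close>.
  For a Radon measure \<open>\<mu>\<close> this is equivalent to the condition defining the spectral measure: if \<open>\<mu>\<close> is
  finite with inverse transform \<open>c\<close>, it holds by Fubini; conversely, testing with an approximate identity
  bounds \<open>\<mu>\<close> on compact sets by a multiple of \<open>sup \<bar>c\<bar>\<close>, so that \<open>\<mu>\<close> is finite, and polarization and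
  localization at a point identify \<open>c\<close> with the inverse transform of \<open>\<mu>\<close>. The two descriptions thus
  select the same measure, and neither Bochner's theorem nor uniqueness of the transform is needed.\<close>

section \<open>Compactly supported functions and Radon measures\<close>

text \<open>The obstacle is the size of the spaces. Neither the group nor its dual nor
  \<open>X\<close> is second countable, and L2 need not be separable. Fubini therefore passes
  through compact rectangles, where joint continuity gives uniform approximation by
  product-measurable functions; on the dual side a finite Radon measure is first confined to a
  countable union of compact sets. Neighbourhoods replace sequences, so continuity of integrals
  rests on uniform estimates instead of dominated convergence. The vector integral
  \<open>orbit_integral\<close> is chosen by \<open>SOME\<close>, so its existence must be proved:
  strong continuity of the translations gives finite combinations of translates that form a Cauchy
  sequence in L2. Strong continuity itself comes from regularity of \<open>m\<close> and compactness
  of \<open>X\<close>. Local compactness of the group supplies small compact neighbourhoods, which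
  carry bump functions and make evaluation of characters jointly continuous. Sigma-compactness
  supplies sigma-finiteness of Haar measure and its positivity on neighbourhoods of 0.\<close>

text \<open>A compact subset of a Hausdorff space is closed, so it contains the closure of any set
  inside it. Membership in \<open>Cc\<close> can thus be checked with any compact set off which the
  function vanishes, and later proofs avoid the closure.\<close>

lemma Cc_iff:
  fixes \<phi> :: "'a::t2_space \<Rightarrow> complex"
  shows "\<phi> \<in> Cc \<longleftrightarrow> continuous_on UNIV \<phi> \<and> (\<exists>K. compact K \<and> (\<forall>t. t \<notin> K \<longrightarrow> \<phi> t = 0))"
proof
  assume "\<phi> \<in> Cc"
  then show "continuous_on UNIV \<phi> \<and> (\<exists>K. compact K \<and> (\<forall>t. t \<notin> K \<longrightarrow> \<phi> t = 0))"
    unfolding Cc_def using closure_subset[of "{t. \<phi> t \<noteq> 0}"]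
    by (auto intro!: exI[of _ "closure {t. \<phi> t \<noteq> 0}"])
next
  assume *: "continuous_on UNIV \<phi> \<and> (\<exists>K. compact K \<and> (\<forall>t. t \<notin> K \<longrightarrow> \<phi> t = 0))"
  then obtain K where K: "compact K" "\<And>t. t \<notin> K \<Longrightarrow> \<phi> t = 0" by blast
  have sub: "closure {t. \<phi> t \<noteq> 0} \<subseteq> K"
    using K by (intro closure_minimal compact_imp_closed) auto
  have "closure {t. \<phi> t \<noteq> 0} = closure {t. \<phi> t \<noteq> 0} \<inter> K" using sub by blast
  then have "compact (closure {t. \<phi> t \<noteq> 0})"
    using compact_Int_closed[OF K(1) closed_closure] by (metis inf_commute)
  with * show "\<phi> \<in> Cc" by (simp add: Cc_def)
qed

lemma CcI:
  fixes \<phi> :: "'a::t2_space \<Rightarrow> complex"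
  assumes "continuous_on UNIV \<phi>" "compact K" "\<And>t. t \<notin> K \<Longrightarrow> \<phi> t = 0"
  shows "\<phi> \<in> Cc"
  using assms Cc_iff by blast

lemma CcE:
  fixes \<phi> :: "'a::t2_space \<Rightarrow> complex"
  assumes "\<phi> \<in> Cc"
  obtains K where "continuous_on UNIV \<phi>" "compact K" "\<And>t. t \<notin> K \<Longrightarrow> \<phi> t = 0"
  using assms Cc_iff by blast

lemma Cc_bounded:
  fixes \<phi> :: "'a::t2_space \<Rightarrow> complex"
  assumes "\<phi> \<in> Cc"
  obtains B where "B \<ge> 0" "\<And>t. cmod (\<phi> t) \<le> B"
proof -
  from assms obtain K where K: "continuous_on UNIV \<phi>" "compact K" "\<And>t. t \<notin> K \<Longrightarrow> \<phi> t = 0"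
    by (rule CcE) blast
  have "bounded (\<phi> ` K)"
    using K by (intro compact_imp_bounded compact_continuous_image) (auto intro: continuous_on_subset)
  then obtain B where B: "\<And>t. t \<in> K \<Longrightarrow> cmod (\<phi> t) \<le> B" unfolding bounded_iff by blast
  show thesis
  proof (rule that[of "max 0 B"])
    show "cmod (\<phi> t) \<le> max 0 B" for t
      using B[of t] K(3)[of t] by (cases "t \<in> K") auto
  qed simp
qed

lemma Cc_mult:
  fixes \<phi> :: "'a::t2_space \<Rightarrow> complex"
  assumes "\<phi> \<in> Cc" "continuous_on UNIV c"
  shows "(\<lambda>t. \<phi> t * c t) \<in> Cc"
proof -
  from assms(1) obtain K where K: "continuous_on UNIV \<phi>" "compact K" "\<And>t. t \<notin> K \<Longrightarrow> \<phi> t = 0"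
    by (rule CcE) blast
  show ?thesis by (rule CcI[OF _ K(2)]) (use K assms in \<open>auto intro!: continuous_intros\<close>)
qed

lemma Cc_add:
  fixes \<phi> :: "'a::t2_space \<Rightarrow> complex"
  assumes "\<phi> \<in> Cc" "\<psi> \<in> Cc"
  shows "(\<lambda>t. \<phi> t + \<psi> t) \<in> Cc"
proof -
  from assms(1) obtain K where K: "continuous_on UNIV \<phi>" "compact K" "\<And>t. t \<notin> K \<Longrightarrow> \<phi> t = 0"
    by (rule CcE) blast
  from assms(2) obtain L where L: "continuous_on UNIV \<psi>" "compact L" "\<And>t. t \<notin> L \<Longrightarrow> \<psi> t = 0"
    by (rule CcE) blast
  show ?thesis
    by (rule CcI[of _ "K \<union> L"]) (use K L in \<open>auto intro!: continuous_intros\<close>)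
qed

lemma Cc_cmult:
  fixes \<phi> :: "'a::t2_space \<Rightarrow> complex"
  assumes "\<phi> \<in> Cc"
  shows "(\<lambda>t. c * \<phi> t) \<in> Cc"
  using Cc_mult[OF assms, of "\<lambda>_. c"] by (simp add: mult.commute)

section \<open>Radon measures on Hausdorff spaces\<close>

lemma radon_sets: "radon_measure M \<Longrightarrow> sets M = sets borel"
  by (simp add: radon_measure_def)

lemma radon_space: "radon_measure M \<Longrightarrow> space M = UNIV"
  using sets_eq_imp_space_eq[OF radon_sets] by simp

lemma radon_finite: "radon_measure M \<Longrightarrow> compact K \<Longrightarrow> emeasure M K < \<infinity>"
  by (simp add: radon_measure_def)

lemma radon_measurable:
  fixes M :: "'a::topological_space measure"
  assumes "radon_measure M"
  shows "borel_measurable M = borel_measurable borel"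
  using measurable_cong_sets[OF radon_sets[OF assms] refl] by blast

text \<open>Inner regularity speaks of a supremum; finiteness of \<open>emeasure M U\<close> turns
  it into a remainder \<open>U - K\<close> of small measure.\<close>

lemma radon_compact_approx:
  fixes M :: "'a::t2_space measure"
  assumes "radon_measure M" "open U" "emeasure M U < \<infinity>" "e > (0::real)"
  obtains K where "compact K" "K \<subseteq> U" "emeasure M (U - K) < e"
\<comment> \<open>The supremum argument needs \<open>emeasure M U - e\<close> strictly below
  \<open>emeasure M U\<close>, which fails for measure zero; there the empty set serves as
  \<open>K\<close>.\<close>
proof (cases "emeasure M U = 0")
  case True
  then show thesis using assms that[of "{}"] by auto
next
  case False
  have eq: "emeasure M U = (SUP K\<in>{K. compact K \<and> K \<subseteq> U}. emeasure M K)"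
  proof -
    have "\<forall>U. open U \<longrightarrow> emeasure M U = (SUP K\<in>{K. compact K \<and> K \<subseteq> U}. emeasure M K)"
      using assms(1) unfolding radon_measure_def by (elim conjE) assumption
    with assms(2) show ?thesis by blast
  qed
  have "emeasure M U - ennreal e < emeasure M U"
    using False assms(3,4) by (intro ennreal_between) (auto simp: zero_less_iff_neq_zero)
  then obtain K where K: "compact K" "K \<subseteq> U" "emeasure M U - e < emeasure M K"
    unfolding eq less_SUP_iff by auto
  have sets: "U \<in> sets M" "K \<in> sets M"
    using assms K by (auto simp: radon_sets compact_imp_closed)
  have *: "emeasure M U = emeasure M K + emeasure M (U - K)"
    using plus_emeasure[of K M "U - K"] sets K by (simp add: Un_absorb1)
  have "emeasure M K < \<infinity>" using K assms radon_finite by blast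
  have "emeasure M (U - K) < e"
  proof -
    obtain a where a: "emeasure M K = ennreal a" "a \<ge> 0"
      using \<open>emeasure M K < \<infinity>\<close> by (cases "emeasure M K") auto
    have "emeasure M (U - K) \<le> emeasure M U" using sets by (intro emeasure_mono) auto
    then obtain b where b: "emeasure M (U - K) = ennreal b" "b \<ge> 0"
      using assms(3) by (cases "emeasure M (U - K)") (auto simp: top_unique)
    have "emeasure M U = ennreal (a + b)" using * a b by simp
    then have "ennreal (a + b - e) < ennreal a"
      using K(3) a assms(4) by (simp add: ennreal_minus del: ennreal_plus)
    then have "a + b - e < a" using a by (meson ennreal_leI linorder_not_le)
    then show ?thesis using b by (simp add: ennreal_lessI assms(4))
  qed
  with K that show thesis by blast
qed

section \<open>Joint continuity on compact sets: measurability and integrals\<close>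

text \<open>Compactness of \<open>L\<close> makes continuity in the first variable uniform in the
  second. This substitute for uniform continuity drives product measurability, parametric integrals,
  uniform continuity on the group and all estimates on compact sets of characters.\<close>

lemma equicontinuous_on_compact:
  fixes F :: "'a::topological_space \<times> 'b::topological_space \<Rightarrow> 'c::metric_space"
  assumes cont: "continuous_on UNIV F" and L: "compact L" and e: "e > 0"
  shows "\<exists>U. open U \<and> t \<in> U \<and> (\<forall>x\<in>U. \<forall>y\<in>L. dist (F (x, y)) (F (t, y)) \<le> e)"
proof -
  have "continuous_on (UNIV \<times> L) F" using cont continuous_on_subset by blast
  from continuous_on_prod_compactE[OF this L UNIV_I e, of t] obtain U where
    "t \<in> U" "open U" "\<forall>x\<in>U \<inter> UNIV. \<forall>y\<in>L. dist (F (x, y)) (F (t, y)) \<le> e" .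
  then show ?thesis by (intro exI[of _ U]) simp
qed

text \<open>On \<open>U t\<close> the approximant is \<open>F (t, y)\<close>, a function of
  \<open>y\<close> alone and hence measurable for the product sigma-algebra. The sets overlap, so
  the induction pastes: the inserted index takes precedence on its own set, and the earlier
  approximant is kept elsewhere.\<close>

lemma finite_cover_measurable_approx:
  fixes F :: "'a::topological_space \<times> 'b::topological_space \<Rightarrow> complex"
  assumes cont: "continuous_on UNIV F" and fin: "finite T"
    and U: "\<And>t. t \<in> T \<Longrightarrow> open (U t)"
    and near: "\<And>t x y. t \<in> T \<Longrightarrow> x \<in> U t \<Longrightarrow> y \<in> L \<Longrightarrow> dist (F (x, y)) (F (t, y)) \<le> e"
  shows "\<exists>G\<in>borel_measurable (borel \<Otimes>\<^sub>M borel).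
    \<forall>x\<in>(\<Union>t\<in>T. U t). \<forall>y\<in>L. dist (F (x, y)) (G (x, y)) \<le> e"
  using fin U near
proof (induction T)
  case empty
  show ?case by (intro bexI[of _ "\<lambda>_. 0"]) auto
next
  case (insert t T)
  then obtain G where G: "G \<in> borel_measurable (borel \<Otimes>\<^sub>M borel)"
    "\<And>x y. x\<in>(\<Union>t\<in>T. U t) \<Longrightarrow> y \<in> L \<Longrightarrow> dist (F (x, y)) (G (x, y)) \<le> e"
    by (metis insert_iff)
  have "continuous_on UNIV (\<lambda>y. F (t, y))"
    by (intro continuous_on_compose2[OF cont] continuous_intros) auto
  then have [measurable]: "(\<lambda>y. F (t, y)) \<in> borel_measurable borel"
    by (rule borel_measurable_continuous_onI)
  have [measurable]: "U t \<in> sets borel" using insert by auto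
  note G(1)[measurable]
  define H where "H = (\<lambda>p. if fst p \<in> U t then F (t, snd p) else G p)"
  have "H \<in> borel_measurable (borel \<Otimes>\<^sub>M borel)"
    unfolding H_def by measurable
  moreover have "\<forall>x\<in>(\<Union>t\<in>insert t T. U t). \<forall>y\<in>L.
      dist (F (x, y)) (H (x, y)) \<le> e"
  proof (intro ballI)
    fix x y assume x: "x \<in> (\<Union>t\<in>insert t T. U t)" and y: "y \<in> L"
    show "dist (F (x, y)) (H (x, y)) \<le> e"
    proof (cases "x \<in> U t")
      case True
      then show ?thesis using insert.prems(2)[of t x y] y by (simp add: H_def)
    next
      case False
      then have "x \<in> (\<Union>t\<in>T. U t)" using x by blast
      then show ?thesis using G(2) y False by (simp add: H_def)
    qed
  qed
  ultimately show ?case by (intro bexI[of _ H])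
qed

text \<open>Neither factor need be second countable, so the product \<open>\<sigma>\<close>-algebra may be smaller than
  the Borel \<open>\<sigma>\<close>-algebra of the product; continuity on a compact rectangle is what makes up for it.\<close>

lemma rectangle_measurable:
  fixes F :: "'a::t2_space \<times> 'b::t2_space \<Rightarrow> complex"
  assumes cont: "continuous_on UNIV F" and K: "compact K" and L: "compact L"
  shows "(\<lambda>p. indicator (K \<times> L) p * F p) \<in> borel_measurable (borel \<Otimes>\<^sub>M borel)"
proof -
  have "\<exists>G\<in>borel_measurable (borel \<Otimes>\<^sub>M borel). \<forall>x\<in>K. \<forall>y\<in>L. dist (F (x, y)) (G (x, y)) \<le> inverse (real (Suc n))" for n
  proof -
    have "inverse (real (Suc n)) > 0" by simp
    then have "\<forall>t. \<exists>U. open U \<and> t \<in> U \<and> (\<forall>x\<in>U. \<forall>y\<in>L. dist (F (x, y)) (F (t, y)) \<le> inverse (real (Suc n)))"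
      using equicontinuous_on_compact[OF cont L] by blast
    from choice[OF this] obtain U where "\<forall>t. open (U t) \<and> t \<in> U t \<and>
        (\<forall>x\<in>U t. \<forall>y\<in>L. dist (F (x, y)) (F (t, y)) \<le> inverse (real (Suc n)))"
      by blast
    then have U: "\<And>t. t \<in> U t" "\<And>t. open (U t)"
      "\<And>t x y. x \<in> U t \<Longrightarrow> y \<in> L \<Longrightarrow> dist (F (x, y)) (F (t, y)) \<le> inverse (real (Suc n))"
      by auto
    obtain T where T: "finite T" "K \<subseteq> (\<Union>t\<in>T. U t)"
    proof (rule compactE_image[OF K, of K U])
      show "K \<subseteq> (\<Union>t\<in>K. U t)" using U(1) by blast
    qed (rule U(2))
    have "\<exists>G\<in>borel_measurable (borel \<Otimes>\<^sub>M borel). \<forall>x\<in>(\<Union>t\<in>T. U t). \<forall>y\<in>L.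
        dist (F (x, y)) (G (x, y)) \<le> inverse (real (Suc n))"
      by (rule finite_cover_measurable_approx[OF cont T(1) U(2) U(3)])
    then obtain G where "G \<in> borel_measurable (borel \<Otimes>\<^sub>M borel)"
      "\<And>x y. x\<in>(\<Union>t\<in>T. U t) \<Longrightarrow> y\<in>L \<Longrightarrow> dist (F (x, y)) (G (x, y)) \<le> inverse (real (Suc n))" by blast
    then show ?thesis using T(2) by (intro bexI[of _ G] ballI) blast+
  qed
  then have "\<forall>n. \<exists>G. G \<in> borel_measurable (borel \<Otimes>\<^sub>M borel) \<and>
      (\<forall>x\<in>K. \<forall>y\<in>L. dist (F (x, y)) (G (x, y)) \<le> inverse (real (Suc n)))"
    unfolding Bex_def by (rule allI)
  from choice[OF this] obtain G where "\<forall>n. G n \<in> borel_measurable (borel \<Otimes>\<^sub>M borel) \<and>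
      (\<forall>x\<in>K. \<forall>y\<in>L. dist (F (x, y)) (G n (x, y)) \<le> inverse (real (Suc n)))"
    by blast
  then have G: "\<And>n. G n \<in> borel_measurable (borel \<Otimes>\<^sub>M borel)"
    "\<And>n x y. x \<in> K \<Longrightarrow> y \<in> L \<Longrightarrow> dist (F (x, y)) (G n (x, y)) \<le> inverse (real (Suc n))"
    by auto
  have KL: "K \<in> sets borel" "L \<in> sets borel"
    using K L by (auto simp: compact_imp_closed)
  have meas: "(\<lambda>p. indicator (K \<times> L) p * G n p) \<in> borel_measurable (borel \<Otimes>\<^sub>M borel)" for n
    by (rule borel_measurable_times[OF borel_measurable_indicator[OF pair_measureI[OF KL]] G(1)])
  have lim: "(\<lambda>n. indicator (K \<times> L) p * G n p) \<longlonglongrightarrow> indicator (K \<times> L) p * F p" for p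
    proof (cases "p \<in> K \<times> L")
      case True
      then obtain x y where p: "p = (x, y)" "x \<in> K" "y \<in> L" by auto
      have "(\<lambda>n. G n p) \<longlonglongrightarrow> F p"
      proof (rule metric_LIMSEQ_I)
        fix r :: real assume "r > 0"
        then obtain N where N: "inverse (real (Suc N)) < r" using reals_Archimedean by blast
        have "dist (G n p) (F p) < r" if "n \<ge> N" for n
        proof -
          have "dist (G n p) (F p) \<le> inverse (real (Suc n))"
            unfolding p(1) using G(2)[OF p(2,3), of n] by (subst dist_commute)
          also have "\<dots> \<le> inverse (real (Suc N))" using that by (intro le_imp_inverse_le) auto
          also note N
          finally show ?thesis .
        qed
        then show "\<exists>no. \<forall>n\<ge>no. dist (G n p) (F p) < r" by (intro exI[of _ N] allI impI)
      qed
      then show ?thesis by (rule tendsto_mult[OF tendsto_const])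
    next
      case False
      then have "indicator (K \<times> L) p = (0::complex)" by (rule indicator_eq_0_iff[THEN iffD2])
      then show ?thesis by (simp only: mult_zero_left tendsto_const)
    qed
  from meas lim show ?thesis by (rule borel_measurable_LIMSEQ_metric)
qed

lemma integrable_compact_support:
  fixes F :: "'a::t2_space \<Rightarrow> complex"
  assumes M: "radon_measure M" and cont: "continuous_on UNIV F" and K: "compact K"
    and zero: "\<And>x. x \<notin> K \<Longrightarrow> F x = 0"
  shows "integrable M F"
proof -
  have "F \<in> Cc" using assms by (intro CcI)
  then obtain B where "\<And>t. cmod (F t) \<le> B" by (rule Cc_bounded) blast
  then show ?thesis
    using radon_finite[OF M K] zero borel_measurable_continuous_onI[OF cont] K
    by (intro integrableI_bounded_set[of K M F B])
      (auto simp: radon_sets[OF M] radon_measurable[OF M] compact_imp_closed)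
qed

lemma Cc_integrable:
  fixes F :: "'a::t2_space \<Rightarrow> complex"
  assumes M: "radon_measure M" and "F \<in> Cc"
  shows "integrable M F"
  using assms by (elim CcE) (rule integrable_compact_support)

text \<open>Continuity of \<open>F\<close> alone does not give measurability for the product
  sigma-algebra; inserting the indicator of \<open>K \<times> L\<close> changes nothing and brings
  in \<open>rectangle_measurable\<close>. The bound on \<open>F\<close> comes from regarding it as
  an element of \<open>Cc\<close> on the product space.\<close>

lemma integrable_pair_compact_support:
  fixes F :: "'a::t2_space \<times> 'b::t2_space \<Rightarrow> complex"
  assumes M: "radon_measure M" and N: "radon_measure N" and sf: "sigma_finite_measure N"
    and cont: "continuous_on UNIV F" and K: "compact K" and L: "compact L"
    and zero: "\<And>p. p \<notin> K \<times> L \<Longrightarrow> F p = 0"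
  shows "integrable (M \<Otimes>\<^sub>M N) F"
proof -
  interpret N: sigma_finite_measure N by fact
  have "F \<in> Cc" using assms by (intro CcI[of F "K \<times> L"] compact_Times) 
  then obtain B where B: "\<And>t. cmod (F t) \<le> B" by (rule Cc_bounded) blast
  have sets: "sets (M \<Otimes>\<^sub>M N) = sets (borel \<Otimes>\<^sub>M borel)"
    by (intro sets_pair_measure_cong radon_sets M N)
  have "(\<lambda>p. indicator (K \<times> L) p * F p) = F"
    using zero by (auto simp: fun_eq_iff indicator_def)
  then have meas: "F \<in> borel_measurable (M \<Otimes>\<^sub>M N)"
    using rectangle_measurable[OF cont K L] measurable_cong_sets[OF sets refl] by auto
  have KL: "K \<in> sets M" "L \<in> sets N"
    using K L by (auto simp: radon_sets M N compact_imp_closed)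
  show ?thesis
  proof (rule integrableI_bounded_set[of "K \<times> L" _ F B])
    show "emeasure (M \<Otimes>\<^sub>M N) (K \<times> L) < \<infinity>"
      using KL radon_finite[OF M K] radon_finite[OF N L]
      by (simp add: N.emeasure_pair_measure_Times ennreal_mult_less_top)
  qed (use B meas KL zero in auto)
qed

text \<open>Sequences need not detect continuity on the parameter space, so the estimate is made
  uniform on \<open>K\<close>: there the integrands differ by at most \<open>d\<close>, and off
  \<open>K\<close> both vanish.\<close>

lemma continuous_parametric_integral:
  fixes F :: "'b::topological_space \<times> 'a::t2_space \<Rightarrow> complex"
  assumes M: "radon_measure M" and cont: "continuous_on UNIV F" and K: "compact K"
    and zero: "\<And>y x. x \<notin> K \<Longrightarrow> F (y, x) = 0"
  shows "continuous_on UNIV (\<lambda>y. LINT x|M. F (y, x))"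
  unfolding continuous_on_def
proof (intro ballI tendstoI)
  fix y0 :: 'b and e :: real assume e: "e > 0"
  \<comment> \<open>The summand 1 keeps the denominator positive when \<open>K\<close> is null and
    makes \<open>d * measure M K\<close> strictly smaller than \<open>e\<close>.\<close>
  define d where "d = e / (measure M K + 1)"
  have pos: "measure M K + 1 > 0" by (simp add: add_nonneg_pos)
  then have "d > 0" using e by (simp add: d_def)
  obtain U where U: "y0 \<in> U" "open U" "\<And>y x. y \<in> U \<Longrightarrow> x \<in> K \<Longrightarrow> dist (F (y, x)) (F (y0, x)) \<le> d"
      using equicontinuous_on_compact[OF cont K \<open>d > 0\<close>, of y0] by blast
  have int: "integrable M (\<lambda>x. F (y, x))" for y
    by (rule integrable_compact_support[OF M _ K])
      (auto intro!: continuous_on_compose2[OF cont] continuous_intros simp: zero)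
  have KM: "K \<in> sets M" using K by (auto simp: radon_sets M compact_imp_closed)
  have "dist (LINT x|M. F (y, x)) (LINT x|M. F (y0, x)) < e" if y: "y \<in> U" for y
  proof -
    have "dist (LINT x|M. F (y, x)) (LINT x|M. F (y0, x)) = cmod (LINT x|M. F (y, x) - F (y0, x))"
      using int by (simp add: dist_norm)
    also have "\<dots> \<le> (LINT x|M. cmod (F (y, x) - F (y0, x)))"
      by (rule integral_norm_bound)
    also have "\<dots> \<le> (LINT x|M. d * indicator K x)"
    proof (rule integral_mono)
      show "integrable M (\<lambda>x. cmod (F (y, x) - F (y0, x)))" using int by auto
      show "integrable M (\<lambda>x. d * indicator K x)"
        using KM radon_finite[OF M K] by (auto simp: emeasure_eq_ennreal_measure)
      show "cmod (F (y, x) - F (y0, x)) \<le> d * indicator K x" for x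
      proof (cases "x \<in> K")
        case True
        then show ?thesis using U(3)[OF y True] by (simp add: dist_norm)
      next
        case False
        then show ?thesis by (simp add: zero)
      qed
    qed
    also have "\<dots> = d * measure M K" using KM radon_finite[OF M K] by simp
    also have "\<dots> < e" using e pos by (simp add: d_def field_simps)
    finally show ?thesis .
  qed
  then show "\<forall>\<^sub>F y in at y0 within UNIV. dist (LINT x|M. F (y, x)) (LINT x|M. F (y0, x)) < e"
    unfolding eventually_at_topological using U by auto
qed

section \<open>Locally compact abelian groups\<close>

lemma compact_diffs:
  fixes K L :: "'g::topological_ab_group_add set"
  assumes "compact K" "compact L"
  shows "compact ((\<lambda>(x, y). x - y) ` (K \<times> L))"
proof -
  have "continuous_on (K \<times> L) (\<lambda>(x, y). x - y)"
    unfolding case_prod_unfold by (intro continuous_intros)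
  then show ?thesis by (rule compact_continuous_image) (intro compact_Times assms)
qed

lemma compact_sums:
  fixes K L :: "'g::topological_ab_group_add set"
  assumes "compact K" "compact L"
  shows "compact ((\<lambda>(x, y). x + y) ` (K \<times> L))"
proof -
  have "continuous_on (K \<times> L) (\<lambda>(x, y). x + y)"
    unfolding case_prod_unfold by (intro continuous_intros)
  then show ?thesis by (rule compact_continuous_image) (intro compact_Times assms)
qed

lemma open_translation:
  fixes U :: "'g::topological_ab_group_add set"
  assumes "open U"
  shows "open {s. t + s \<in> U}"
proof -
  have "continuous_on UNIV (\<lambda>s. t + s)" by (intro continuous_intros)
  from open_vimage[OF assms this] show ?thesis by (simp add: vimage_def)
qed

lemma open_reflection:
  fixes U :: "'g::topological_ab_group_add set"
  assumes "open U"
  shows "open {s. - s \<in> U}"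
proof -
  have "continuous_on UNIV (\<lambda>s::'g. - s)" by (intro continuous_intros)
  from open_vimage[OF assms this] show ?thesis by (simp add: vimage_def)
qed

lemma Cc_uniformly_continuous:
  fixes \<phi> :: "'g::{topological_ab_group_add, t2_space} \<Rightarrow> complex"
  assumes "\<phi> \<in> Cc" "e > 0"
  shows "\<exists>U. open U \<and> 0 \<in> U \<and> (\<forall>u\<in>U. \<forall>t. cmod (\<phi> (t - u) - \<phi> t) \<le> e)"
proof -
  from assms(1) obtain K where K: "continuous_on UNIV \<phi>" "compact K" "\<And>t. t \<notin> K \<Longrightarrow> \<phi> t = 0"
    by (rule CcE) blast
  have cont: "continuous_on UNIV (\<lambda>p. \<phi> (snd p - fst p))"
    by (intro continuous_on_compose2[OF K(1)] continuous_intros) auto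
  have "\<exists>V. open V \<and> 0 \<in> V \<and> (\<forall>x\<in>V. \<forall>y\<in>K. dist (\<phi> (y - x)) (\<phi> (y - 0)) \<le> e)"
    using equicontinuous_on_compact[OF cont K(2) assms(2), of 0] by (simp only: fst_conv snd_conv)
  then obtain V where V: "0 \<in> V" "open V"
    and V3: "\<And>x y. x \<in> V \<Longrightarrow> y \<in> K \<Longrightarrow> cmod (\<phi> (y - x) - \<phi> y) \<le> e"
    by (auto simp: dist_norm)
  show ?thesis
  \<comment> \<open>Equicontinuity is available only at base points in \<open>K\<close>. If
    \<open>t\<close> lies outside but \<open>t - u\<close> inside, the estimate is used at
    \<open>t - u\<close> with the shift \<open>- u\<close>; hence the symmetric
    neighbourhood.\<close>
  proof (intro exI[of _ "V \<inter> {s. - s \<in> V}"] conjI ballI allI)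
    show "open (V \<inter> {s. - s \<in> V})" using V open_reflection by (intro open_Int) auto
    show "0 \<in> V \<inter> {s. - s \<in> V}" using V by simp
    fix u t assume u: "u \<in> V \<inter> {s. - s \<in> V}"
    show "cmod (\<phi> (t - u) - \<phi> t) \<le> e"
    proof (cases "t \<in> K")
      case True
      then show ?thesis using V3 u by blast
    next
      case False
      show ?thesis
      proof (cases "t - u \<in> K")
        case True
        have "cmod (\<phi> ((t - u) - (- u)) - \<phi> (t - u)) \<le> e"
          using V3[of "- u" "t - u"] u True by blast
        then show ?thesis by (simp add: norm_minus_commute)
      next
        case False
        then show ?thesis using K(3)[OF \<open>t \<notin> K\<close>] K(3)[OF False] assms(2) by simp
      qed
    qed
  qed
qed

section \<open>Haar measure on a locally compact, sigma-compact group\<close>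

locale lca_group =
  fixes mG :: "'g::{topological_ab_group_add, t2_space} measure"
  assumes loc: "locally_compact_space (euclidean :: 'g topology)"
    and sigma: "sigma_compact (UNIV :: 'g set)"
    and haar: "haar_measure mG"
begin

lemma radon: "radon_measure mG"
  using haar by (simp add: haar_measure_def)

lemma space_mG [simp]: "space mG = UNIV"
  by (rule radon_space[OF radon])

lemma sets_mG: "sets mG = sets borel"
  by (rule radon_sets[OF radon])

lemma translation_invariant_integral:
  fixes F :: "'g \<Rightarrow> complex"
  assumes "F \<in> borel_measurable borel"
  shows "(LINT s|mG. F (t + s)) = (LINT s|mG. F s)"
proof -
  have "continuous_on UNIV (\<lambda>s. t + s)" by (intro continuous_intros)
  then have m: "(\<lambda>s. t + s) \<in> measurable mG borel"
    using measurable_cong_sets[OF sets_mG refl] borel_measurable_continuous_onI by blast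
  have eq: "distr mG borel (\<lambda>s. t + s) = mG" using haar by (simp add: haar_measure_def)
  have "(LINT s|mG. F s) = integral\<^sup>L (distr mG borel (\<lambda>s. t + s)) F" by (simp only: eq)
  also have "\<dots> = (LINT s|mG. F (t + s))"
    by (rule integral_distr[OF m assms])
  finally show ?thesis ..
qed

lemma sigma_finite: "sigma_finite_measure mG"
proof
  from sigma obtain K :: "nat \<Rightarrow> 'g set" where K: "\<And>n. compact (K n)" "(\<Union>n. K n) = UNIV"
    unfolding sigma_compact_def by blast
  have "K n \<in> sets mG" "emeasure mG (K n) \<noteq> \<infinity>" for n
    using K(1)[of n] radon_finite[OF radon K(1)[of n]] by (auto simp: sets_mG compact_imp_closed)
  with K(2) show "\<exists>A. countable A \<and> A \<subseteq> sets mG \<and> \<Union> A = space mG \<and> (\<forall>a\<in>A. emeasure mG a \<noteq> \<infinity>)"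
    by (intro exI[of _ "range K"]) auto
qed

text \<open>Local compactness provides one compact neighbourhood of each point; the Hausdorff
  property makes the space regular and so upgrades this to arbitrarily small ones.\<close>

lemma compact_nhd:
  assumes "open U" "(t::'g) \<in> U"
  obtains V K where "open V" "compact K" "t \<in> V" "V \<subseteq> K" "K \<subseteq> U"
proof -
  have "Hausdorff_space (euclidean :: 'g topology)"
    unfolding Hausdorff_space_def disjnt_def using hausdorff by (auto; metis)
  then have "neighbourhood_base_of (compactin euclidean) (euclidean :: 'g topology)"
    by (intro locally_compact_imp_neighbourhood_base loc locally_compact_Hausdorff_imp_regular_space)
  then have "\<exists>V K. openin euclidean V \<and> compactin euclidean K \<and> t \<in> V \<and> V \<subseteq> K \<and> K \<subseteq> U"
    unfolding neighbourhood_base_of using assms by simp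
  with that show thesis by (auto simp: compactin_euclidean_iff)
qed

text \<open>If a neighbourhood of 0 were null, so would be its translates. Finitely many of them
  cover each compact set, and countably many compact sets cover the group, so Haar measure would
  vanish.\<close>

lemma open_nhd_pos:
  assumes "open U" "0 \<in> U"
  shows "emeasure mG U > 0"
proof (rule ccontr)
  assume "\<not> emeasure mG U > 0"
  then have zero: "emeasure mG U = 0" by (simp add: zero_less_iff_neq_zero)
  have Us: "U \<in> sets borel" using assms by simp
  \<comment> \<open>The translate of \<open>U\<close> by \<open>t\<close>, written as a preimage so
    that invariance under the shift by \<open>- t\<close> applies directly.\<close>
  define W where "W t = {s. - t + s \<in> U}" for t
  have W: "open (W t)" "t \<in> W t" for t
    unfolding W_def using assms open_translation[of U "- t"] by auto
  have W0: "W t \<in> null_sets mG" for t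
  proof -
    have "continuous_on UNIV (\<lambda>s. - t + s)" by (intro continuous_intros)
    then have m: "(\<lambda>s. - t + s) \<in> measurable mG borel"
      using measurable_cong_sets[OF sets_mG refl] borel_measurable_continuous_onI by blast
    have eq: "distr mG borel (\<lambda>s. - t + s) = mG" using haar unfolding haar_measure_def by blast
    have "emeasure mG (W t) = emeasure (distr mG borel (\<lambda>s. - t + s)) U"
      unfolding emeasure_distr[OF m Us] W_def vimage_def by simp
    then have "emeasure mG (W t) = 0" unfolding eq zero .
    moreover have "W t \<in> sets mG" using W(1) by (simp add: sets_mG)
    ultimately show ?thesis by (rule null_setsI)
  qed
  from sigma obtain K :: "nat \<Rightarrow> 'g set" where K: "\<And>n. compact (K n)" "(\<Union>n. K n) = UNIV"
    unfolding sigma_compact_def by blast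
  have "K n \<in> null_sets mG" for n
  proof -
    have "K n \<subseteq> (\<Union>t\<in>K n. W t)" using W(2) by blast
    from compactE_image[OF K(1) W(1) this] obtain T where T: "finite T" "K n \<subseteq> (\<Union>t\<in>T. W t)" by metis
    have "(\<Union>t\<in>T. W t) \<in> null_sets mG"
      using T(1) W0 by (intro null_sets_UN') (auto intro: countable_finite)
    moreover have "K n \<in> sets mG" using K(1) by (simp add: sets_mG compact_imp_closed)
    ultimately show ?thesis using T(2) null_sets_subset by blast
  qed
  then have "(\<Union>n. K n) \<in> null_sets mG" by (intro null_sets_UN)
  then show False using K(2) haar by (simp add: haar_measure_def null_sets_def)
qed

end

section \<open>Approximate identities and convolution\<close>

lemma tilde_Cc:
  fixes \<phi> :: "'g::{topological_ab_group_add, t2_space} \<Rightarrow> complex"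
  assumes "\<phi> \<in> Cc"
  shows "tilde \<phi> \<in> Cc"
proof -
  from assms obtain K where K: "continuous_on UNIV \<phi>" "compact K" "\<And>t. t \<notin> K \<Longrightarrow> \<phi> t = 0"
    by (rule CcE) blast
  have "compact (uminus ` K)"
    by (intro compact_continuous_image K continuous_intros)
  moreover have "tilde \<phi> t = 0" if "t \<notin> uminus ` K" for t
    using K(3)[of "- t"] that by (force simp: tilde_def)
  moreover have "continuous_on UNIV (tilde \<phi>)"
    unfolding tilde_def by (intro continuous_intros continuous_on_compose2[OF K(1)]) auto
  ultimately show ?thesis by (intro CcI)
qed

context lca_group
begin

text \<open>These are the members of the approximate identities. A locally compact Hausdorff space
  is completely regular, which supplies a continuous \<open>f\<close> with value 0 at 0 and value 1
  off \<open>V\<close>; the bump is \<open>1 - f\<close> divided by its integral.\<close>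

lemma bump_function:
  assumes "open U" "0 \<in> U"
  shows "\<exists>r :: 'g \<Rightarrow> real. (\<lambda>t. complex_of_real (r t)) \<in> Cc \<and> (\<forall>t. r t \<ge> 0) \<and>
    (\<forall>t. t \<notin> U \<longrightarrow> r t = 0) \<and> integrable mG r \<and> (LINT t|mG. r t) = 1"
proof -
  obtain V K where VK: "open V" "compact K" "0 \<in> V" "V \<subseteq> K" "K \<subseteq> U"
    using compact_nhd[OF assms] by blast
  have "Hausdorff_space (euclidean :: 'g topology)"
    unfolding Hausdorff_space_def disjnt_def using hausdorff by (auto; metis)
  then have "completely_regular_space (euclidean :: 'g topology)"
    by (intro completely_regular_eq_regular_space[THEN iffD2] loc locally_compact_Hausdorff_imp_regular_space)
  moreover have "closedin (euclidean :: 'g topology) (- V)" using VK(1) by auto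
  ultimately obtain f :: "'g \<Rightarrow> real" where f: "continuous_map euclidean (top_of_set {0..1}) f"
    "f 0 = 0" "f ` (- V) \<subseteq> {1}"
    unfolding completely_regular_space_def using VK(3) by (metis Compl_iff DiffI UNIV_I topspace_euclidean)
  define r0 where "r0 t = 1 - f t" for t
  have fc: "continuous_on UNIV f" and f01: "\<And>t. f t \<in> {0..1}"
    using f(1) by (auto simp: continuous_map_in_subtopology)
  have r0c: "continuous_on UNIV r0" unfolding r0_def by (intro continuous_intros fc)
  have r0: "r0 t \<ge> 0" "r0 0 = 1" for t using f01[of t] f(2) by (auto simp: r0_def)
  have r0z: "r0 t = 0" if "t \<notin> V" for t using f(3) that by (auto simp: r0_def)
  have r0Cc: "(\<lambda>t. complex_of_real (r0 t)) \<in> Cc"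
    using VK(2,4) r0z by (intro CcI[of _ K] continuous_intros r0c) auto
  have "integrable mG (\<lambda>t. Re (complex_of_real (r0 t)))"
    by (intro integrable_Re Cc_integrable radon r0Cc)
  then have r0i: "integrable mG r0" by simp
  \<comment> \<open>For positivity of the integral, \<open>r0\<close> is compared with half the
    indicator of \<open>W\<close>, an open neighbourhood of 0 inside \<open>K\<close> and therefore
    of positive finite measure.\<close>
  define W where "W = {t. r0 t > 1/2}"
  have W: "open W" "0 \<in> W"
    unfolding W_def using r0(2) by (auto intro!: open_Collect_less continuous_intros r0c)
  have WK: "W \<subseteq> K" using r0z VK(4) by (force simp: W_def)
  have Ws: "W \<in> sets mG" using W by (simp add: sets_mG)
  have "emeasure mG W \<le> emeasure mG K"
    using WK VK(2) by (intro emeasure_mono) (auto simp: sets_mG compact_imp_closed)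
  also have "\<dots> < \<infinity>" by (rule radon_finite[OF radon VK(2)])
  finally have Wf: "emeasure mG W < \<infinity>" .
  have "0 < measure mG W"
    using open_nhd_pos[OF W] Wf by (simp add: measure_def enn2real_positive_iff)
  then have "0 < (LINT t|mG. indicator W t * (1/2::real))" using Ws Wf by simp
  also have "\<dots> \<le> (LINT t|mG. r0 t)"
  proof (rule integral_mono)
    show "integrable mG (\<lambda>t. indicator W t * (1/2::real))" using Ws Wf by simp
    show "indicator W t * (1/2) \<le> r0 t" for t
      using r0(1)[of t] by (auto simp: W_def indicator_def)
  qed (rule r0i)
  finally have pos: "(LINT t|mG. r0 t) > 0" .
  show ?thesis
  proof (intro exI[of _ "\<lambda>t. inverse (LINT t|mG. r0 t) * r0 t"] conjI allI impI)
    show "(\<lambda>t. complex_of_real (inverse (LINT t|mG. r0 t) * r0 t)) \<in> Cc"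
      using Cc_cmult[OF r0Cc, of "complex_of_real (inverse (LINT t|mG. r0 t))"] by simp
    show "inverse (LINT t|mG. r0 t) * r0 t \<ge> 0" for t using r0(1)[of t] pos by simp
    show "inverse (LINT t|mG. r0 t) * r0 t = 0" if "t \<notin> U" for t
      using r0z[of t] that VK by auto
    show "integrable mG (\<lambda>t. inverse (LINT t|mG. r0 t) * r0 t)" using r0i by simp
    show "(LINT t|mG. inverse (LINT t|mG. r0 t) * r0 t) = 1" using pos by simp
  qed
qed

lemma integrable_pair:
  fixes F :: "'g \<times> 'g \<Rightarrow> complex"
  assumes "continuous_on UNIV F" "compact K" "compact L" "\<And>p. p \<notin> K \<times> L \<Longrightarrow> F p = 0"
  shows "integrable (mG \<Otimes>\<^sub>M mG) F"
  by (rule integrable_pair_compact_support[OF radon radon sigma_finite assms])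

lemma pair_sigma_finite_mG: "pair_sigma_finite mG mG"
  by (intro pair_sigma_finite.intro sigma_finite)

lemma Cc_Fubini:
  fixes F :: "'g \<times> 'g \<Rightarrow> complex"
  assumes "continuous_on UNIV F" "compact K" "compact L" "\<And>p. p \<notin> K \<times> L \<Longrightarrow> F p = 0"
  shows "(LINT x|mG. LINT y|mG. F (x, y)) = (LINT y|mG. LINT x|mG. F (x, y))"
  using pair_sigma_finite.Fubini_integral[OF pair_sigma_finite_mG, of "\<lambda>x y. F (x, y)"]
    integrable_pair[OF assms] by simp

lemma Cc_measurable: "\<phi> \<in> Cc \<Longrightarrow> \<phi> \<in> borel_measurable borel" for \<phi> :: "'g \<Rightarrow> complex"
  by (auto simp: Cc_def intro: borel_measurable_continuous_onI)

text \<open>Integrate \<open>\<psi> s * \<phi> (s - t)\<close> in both orders, for any \<open>\<psi>\<close> of integral \<open>1\<close>.\<close>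

lemma reflection_invariant_integral:
  fixes \<phi> :: "'g \<Rightarrow> complex"
  assumes "\<phi> \<in> Cc"
  shows "(LINT t|mG. \<phi> (- t)) = (LINT t|mG. \<phi> t)"
proof -
  from assms obtain L where L: "continuous_on UNIV \<phi>" "compact L" "\<And>t. t \<notin> L \<Longrightarrow> \<phi> t = 0"
    by (rule CcE) blast
  obtain r :: "'g \<Rightarrow> real" where r: "(\<lambda>t. complex_of_real (r t)) \<in> Cc" "integrable mG r" "(LINT t|mG. r t) = 1"
    using bump_function[OF open_UNIV UNIV_I] by auto
  define \<psi> where "\<psi> t = complex_of_real (r t)" for t
  have \<psi>: "\<psi> \<in> Cc" "(LINT t|mG. \<psi> t) = 1" using r by (simp_all add: \<psi>_def[abs_def])
  from \<psi>(1) obtain K where K: "continuous_on UNIV \<psi>" "compact K" "\<And>t. t \<notin> K \<Longrightarrow> \<psi> t = 0"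
    by (rule CcE) blast
  have inner1: "(LINT t|mG. \<psi> s * \<phi> (s - t)) = \<psi> s * (LINT t|mG. \<phi> (- t))" for s
  proof -
    have "continuous_on UNIV (\<lambda>t. \<phi> (- t))"
      by (intro continuous_on_compose2[OF L(1)] continuous_intros) auto
    then have "(\<lambda>t. \<phi> (- t)) \<in> borel_measurable borel" by (rule borel_measurable_continuous_onI)
    from translation_invariant_integral[OF this, of "- s"] show ?thesis by simp
  qed
  have inner2: "(LINT s|mG. \<psi> s * \<phi> (s - t)) = (LINT s|mG. \<psi> (t + s) * \<phi> s)" for t
  proof -
    have "continuous_on UNIV (\<lambda>s. \<psi> s * \<phi> (s - t))"
      by (intro continuous_intros continuous_on_compose2[OF L(1)] K(1)) auto
    then have "(\<lambda>s. \<psi> s * \<phi> (s - t)) \<in> borel_measurable borel" by (rule borel_measurable_continuous_onI)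
    from translation_invariant_integral[OF this, of t] show ?thesis by simp
  qed
  have inner3: "(LINT t|mG. \<psi> (t + s) * \<phi> s) = \<phi> s" for s
    using translation_invariant_integral[OF Cc_measurable[OF \<psi>(1)], of s] \<psi>(2) by (simp add: add.commute)
  let ?KL = "(\<lambda>(x, y). x - y) ` (K \<times> L)"
  have "(LINT t|mG. \<phi> (- t)) = (LINT s|mG. LINT t|mG. \<psi> s * \<phi> (s - t))"
    unfolding inner1 using \<psi> by simp
  also have "\<dots> = (LINT t|mG. LINT s|mG. \<psi> s * \<phi> (s - t))"
  proof -
    have "continuous_on UNIV (\<lambda>p. \<psi> (fst p) * \<phi> (fst p - snd p))"
      by (intro continuous_intros continuous_on_compose2[OF L(1)] continuous_on_compose2[OF K(1)]) auto
    moreover have "\<psi> (fst p) * \<phi> (fst p - snd p) = 0" if "p \<notin> K \<times> ?KL" for p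
    proof (rule ccontr)
      assume "\<psi> (fst p) * \<phi> (fst p - snd p) \<noteq> 0"
      then have "fst p \<in> K" "fst p - snd p \<in> L" using K(3) L(3) by force+
      moreover have "snd p = fst p - (fst p - snd p)" by simp
      ultimately have "snd p \<in> ?KL" by (metis (mono_tags, lifting) SigmaI case_prod_conv rev_image_eqI)
      with \<open>fst p \<in> K\<close> that show False by (simp add: mem_Times_iff)
    qed
    ultimately show ?thesis
      using Cc_Fubini[of "\<lambda>p. \<psi> (fst p) * \<phi> (fst p - snd p)" K ?KL] K(2) compact_diffs[OF K(2) L(2)] by simp
  qed
  also have "\<dots> = (LINT t|mG. LINT s|mG. \<psi> (t + s) * \<phi> s)" unfolding inner2 ..
  also have "\<dots> = (LINT s|mG. LINT t|mG. \<psi> (t + s) * \<phi> s)"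
  proof -
    have "continuous_on UNIV (\<lambda>p. \<psi> (fst p + snd p) * \<phi> (snd p))"
      by (intro continuous_intros continuous_on_compose2[OF L(1)] continuous_on_compose2[OF K(1)]) auto
    moreover have "\<psi> (fst p + snd p) * \<phi> (snd p) = 0" if "p \<notin> ?KL \<times> L" for p
    proof (rule ccontr)
      assume "\<psi> (fst p + snd p) * \<phi> (snd p) \<noteq> 0"
      then have "fst p + snd p \<in> K" "snd p \<in> L" using K(3) L(3) by force+
      moreover have "fst p = (fst p + snd p) - snd p" by simp
      ultimately have "fst p \<in> ?KL" by (metis (mono_tags, lifting) SigmaI case_prod_conv rev_image_eqI)
      with \<open>snd p \<in> L\<close> that show False by (simp add: mem_Times_iff)
    qed
    ultimately show ?thesis
      using Cc_Fubini[of "\<lambda>p. \<psi> (fst p + snd p) * \<phi> (snd p)" ?KL L] L(2) compact_diffs[OF K(2) L(2)] by simp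
  qed
  also have "\<dots> = (LINT s|mG. \<phi> s)" unfolding inner3 ..
  finally show ?thesis .
qed

lemma group_convolution_support:
  assumes "\<And>t. t \<notin> K \<Longrightarrow> \<phi> t = 0" "\<And>t. t \<notin> L \<Longrightarrow> \<psi> t = 0"
    and "t \<notin> (\<lambda>(x, y). x + y) ` (K \<times> L)"
  shows "group_convolution mG \<phi> \<psi> t = 0"
proof -
  have "\<phi> (t - s) * \<psi> s = 0" for s
  proof (rule ccontr)
    assume "\<phi> (t - s) * \<psi> s \<noteq> 0"
    then have "t - s \<in> K" "s \<in> L" using assms(1,2) by force+
    moreover have "t = (t - s) + s" by simp
    ultimately have "t \<in> (\<lambda>(x, y). x + y) ` (K \<times> L)"
      by (metis (mono_tags, lifting) SigmaI case_prod_conv rev_image_eqI)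
    with assms(3) show False by simp
  qed
  then show ?thesis unfolding group_convolution_def by (simp only: integral_zero)
qed

lemma group_convolution_Cc:
  assumes "\<phi> \<in> Cc" "\<psi> \<in> Cc"
  shows "group_convolution mG \<phi> \<psi> \<in> Cc"
proof -
  from assms(1) obtain K where K: "continuous_on UNIV \<phi>" "compact K" "\<And>t. t \<notin> K \<Longrightarrow> \<phi> t = 0"
    by (rule CcE) blast
  from assms(2) obtain L where L: "continuous_on UNIV \<psi>" "compact L" "\<And>t. t \<notin> L \<Longrightarrow> \<psi> t = 0"
    by (rule CcE) blast
  have cont: "continuous_on UNIV (\<lambda>p. \<phi> (fst p - snd p) * \<psi> (snd p))"
    by (intro continuous_intros continuous_on_compose2[OF L(1)] continuous_on_compose2[OF K(1)]) auto
  have "continuous_on UNIV (\<lambda>t. LINT s|mG. \<phi> (t - s) * \<psi> s)"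
    using continuous_parametric_integral[OF radon cont L(2)] L(3) by simp
  then have "continuous_on UNIV (group_convolution mG \<phi> \<psi>)"
    by (simp add: group_convolution_def[abs_def])
  then show ?thesis
    by (rule CcI[OF _ compact_sums[OF K(2) L(2)]]) (rule group_convolution_support[OF K(3) L(3)])
qed

text \<open>One compact set has to serve for every \<open>e\<close>: a functional in
  \<open>complex_measure\<close> is controlled by the sup norm only on functions supported in a
  fixed compact set.\<close>

lemma group_convolution_approx:
  assumes \<phi>: "\<phi> \<in> Cc"
  obtains K where "compact K" "\<And>e. e > 0 \<Longrightarrow> \<exists>\<psi>\<in>Cc.
     (\<forall>t. t \<notin> K \<longrightarrow> \<phi> t = 0 \<and> group_convolution mG \<phi> (tilde \<psi>) t = 0) \<and>
     (\<forall>t. cmod (group_convolution mG \<phi> (tilde \<psi>) t - \<phi> t) \<le> e)"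
proof -
  from \<phi> obtain K where K: "continuous_on UNIV \<phi>" "compact K" "\<And>t. t \<notin> K \<Longrightarrow> \<phi> t = 0"
    by (rule CcE) blast
  \<comment> \<open>Fixed before \<open>e\<close> is given: all approximants will be supported in
    \<open>L\<close>, which confines every convolution to \<open>K + L\<close>.\<close>
  obtain W L where L: "open W" "compact L" "(0::'g) \<in> W" "W \<subseteq> L"
    using compact_nhd[of UNIV "0::'g"] by auto
  define KL where "KL = (\<lambda>(x, y). x + y) ` (K \<times> L)"
  show thesis
  proof (rule that[of KL])
    show "compact KL" unfolding KL_def by (rule compact_sums[OF K(2) L(2)])
    fix e :: real assume "e > 0"
    from Cc_uniformly_continuous[OF \<phi> this] obtain U where U: "open U" "0 \<in> U"
      "\<And>u t. u \<in> U \<Longrightarrow> cmod (\<phi> (t - u) - \<phi> t) \<le> e" by auto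
    \<comment> \<open>\<open>tilde\<close> reflects the argument, so the bump is built in the
      reflected neighbourhood; then \<open>tilde \<psi>\<close> is supported in
      \<open>U \<inter> W\<close>.\<close>
    have W0: "0 \<in> {s. - s \<in> U \<inter> W}" using U L by simp
    obtain r where r: "(\<lambda>t. complex_of_real (r t)) \<in> Cc" "\<And>t. r t \<ge> 0"
      "\<And>t. t \<notin> {s. - s \<in> U \<inter> W} \<Longrightarrow> r t = 0" "integrable mG r" "(LINT t|mG. r t) = 1"
      using bump_function[OF open_reflection[OF open_Int[OF U(1) L(1)]] W0] by auto
    define \<psi> where "\<psi> t = complex_of_real (r t)" for t
    have \<psi>: "\<psi> \<in> Cc" using r by (simp add: \<psi>_def[abs_def])
    have til: "tilde \<psi> s = complex_of_real (r (- s))" for s by (simp add: tilde_def \<psi>_def)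
    have tilz: "s \<in> U \<inter> W" if "r (- s) \<noteq> 0" for s using r(3)[of "- s"] that by auto
    have tilCc: "tilde \<psi> \<in> Cc" by (rule tilde_Cc[OF \<psi>])
    have tili: "integrable mG (tilde \<psi>)" by (rule Cc_integrable[OF radon tilCc])
    \<comment> \<open>Reflection keeps the total mass 1, so the convolution is a weighted mean of
      the values \<open>\<phi> (t - s)\<close> with \<open>s\<close> in \<open>U\<close>.\<close>
    have one: "(LINT s|mG. complex_of_real (r (- s))) = 1"
      using reflection_invariant_integral[OF r(1)] r(5) by simp
    have "integrable mG (\<lambda>s. Re (tilde \<psi> s))" using tili by simp
    then have ri: "integrable mG (\<lambda>s. r (- s))" by (simp add: til)
    then have one': "(LINT s|mG. r (- s)) = 1"
      using one by (simp only: integral_complex_of_real of_real_eq_1_iff)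
    have "cmod (group_convolution mG \<phi> (tilde \<psi>) t - \<phi> t) \<le> e" for t
    proof -
      have "continuous_on UNIV (\<lambda>s. \<phi> (t - s))"
        by (intro continuous_on_compose2[OF K(1)] continuous_intros) auto
      then have "integrable mG (\<lambda>s. tilde \<psi> s * \<phi> (t - s))"
        by (intro Cc_integrable radon Cc_mult tilCc)
      then have i1: "integrable mG (\<lambda>s. \<phi> (t - s) * tilde \<psi> s)" by (simp add: mult.commute)
      have i2: "integrable mG (\<lambda>s. \<phi> t * tilde \<psi> s)" using tili by simp
      have "group_convolution mG \<phi> (tilde \<psi>) t - \<phi> t = (LINT s|mG. \<phi> (t - s) * tilde \<psi> s) - (LINT s|mG. \<phi> t * tilde \<psi> s)"
        using one by (simp add: group_convolution_def til)
      also have "\<dots> = (LINT s|mG. \<phi> (t - s) * tilde \<psi> s - \<phi> t * tilde \<psi> s)"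
        using i1 i2 by simp
      also have "cmod \<dots> \<le> (LINT s|mG. cmod (\<phi> (t - s) * tilde \<psi> s - \<phi> t * tilde \<psi> s))"
        by (rule integral_norm_bound)
      also have "\<dots> \<le> (LINT s|mG. e * r (- s))"
      proof (rule integral_mono)
        show "integrable mG (\<lambda>s. cmod (\<phi> (t - s) * tilde \<psi> s - \<phi> t * tilde \<psi> s))"
          using i1 i2 by auto
        show "integrable mG (\<lambda>s. e * r (- s))" using ri by simp
        fix s
        have "cmod (\<phi> (t - s) * tilde \<psi> s - \<phi> t * tilde \<psi> s) = cmod (\<phi> (t - s) - \<phi> t) * r (- s)"
          by (simp only: til left_diff_distrib[symmetric] norm_mult norm_of_real abs_of_nonneg[OF r(2)])
        also have "\<dots> \<le> e * r (- s)"
        proof (cases "r (- s) = 0")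
          case False
          then have "s \<in> U" using tilz by blast
          then show ?thesis by (intro mult_right_mono U r)
        qed simp
        finally show "cmod (\<phi> (t - s) * tilde \<psi> s - \<phi> t * tilde \<psi> s) \<le> e * r (- s)" .
      qed
      also have "\<dots> = e" using one' by simp
      finally show ?thesis .
    qed
    moreover have "\<phi> t = 0 \<and> group_convolution mG \<phi> (tilde \<psi>) t = 0" if t: "t \<notin> KL" for t
    proof
      have "t \<notin> K"
      proof
        assume "t \<in> K"
        then have "(\<lambda>(x, y). x + y) (t, 0) \<in> KL" unfolding KL_def using L by (intro imageI) auto
        with t show False by simp
      qed
      then show "\<phi> t = 0" by (rule K(3))
      show "group_convolution mG \<phi> (tilde \<psi>) t = 0"
      proof (rule group_convolution_support[OF K(3)])
        show "tilde \<psi> s = 0" if "s \<notin> L" for s using tilz[of s] that L(4) by (auto simp: til)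
        show "t \<notin> (\<lambda>(x, y). x + y) ` (K \<times> L)" using t unfolding KL_def .
      qed auto
    qed
    ultimately show "\<exists>\<psi>\<in>Cc. (\<forall>t. t \<notin> KL \<longrightarrow> \<phi> t = 0 \<and> group_convolution mG \<phi> (tilde \<psi>) t = 0) \<and>
     (\<forall>t. cmod (group_convolution mG \<phi> (tilde \<psi>) t - \<phi> t) \<le> e)"
      using \<psi> by (intro bexI[of _ \<psi>]) auto
  qed
qed

section \<open>Uniqueness of functionals given their values on convolutions\<close>

lemma complex_measureD:
  assumes "complex_measure \<gamma>"
  shows "\<gamma> \<in> extensional Cc"
    and "\<phi> \<in> Cc \<Longrightarrow> \<psi> \<in> Cc \<Longrightarrow> \<gamma> (\<lambda>t. \<phi> t + \<psi> t) = \<gamma> \<phi> + \<gamma> \<psi>"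
    and "\<phi> \<in> Cc \<Longrightarrow> \<gamma> (\<lambda>t. c * \<phi> t) = c * \<gamma> \<phi>"
    and "compact K \<Longrightarrow> \<exists>C. \<forall>\<phi>\<in>Cc. {t. \<phi> t \<noteq> 0} \<subseteq> K \<longrightarrow> cmod (\<gamma> \<phi>) \<le> C * (SUP t. cmod (\<phi> t))"
proof -
  note D = assms[unfolded complex_measure_def]
  show "\<gamma> \<in> extensional Cc" using D by (rule conjunct1)
  show "\<phi> \<in> Cc \<Longrightarrow> \<psi> \<in> Cc \<Longrightarrow> \<gamma> (\<lambda>t. \<phi> t + \<psi> t) = \<gamma> \<phi> + \<gamma> \<psi>"
    using D[THEN conjunct2, THEN conjunct1] by simp
  show "\<phi> \<in> Cc \<Longrightarrow> \<gamma> (\<lambda>t. c * \<phi> t) = c * \<gamma> \<phi>"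
    using D[THEN conjunct2, THEN conjunct2, THEN conjunct1] by simp
  show "compact K \<Longrightarrow> \<exists>C. \<forall>\<phi>\<in>Cc. {t. \<phi> t \<noteq> 0} \<subseteq> K \<longrightarrow> cmod (\<gamma> \<phi>) \<le> C * (SUP t. cmod (\<phi> t))"
    using D[THEN conjunct2, THEN conjunct2, THEN conjunct2] by simp
qed

text \<open>The bound of \<open>complex_measure\<close> is applied to the difference of the two
  functions, whose sup norm is at most \<open>e\<close>. Both must vanish off the same
  \<open>K\<close>, on which the constant depends.\<close>

lemma complex_measure_limit:
  assumes \<gamma>: "complex_measure \<gamma>" and K: "compact K" and \<phi>: "\<phi> \<in> Cc"
  shows "\<exists>C\<ge>0. \<forall>\<psi>\<in>Cc. \<forall>e. (\<forall>t::'g. t \<notin> K \<longrightarrow> \<phi> t = 0 \<and> \<psi> t = 0) \<longrightarrow>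
    (\<forall>t. cmod (\<psi> t - \<phi> t) \<le> e) \<longrightarrow> cmod (\<gamma> \<psi> - \<gamma> \<phi>) \<le> C * e"
proof -
  obtain C where C: "\<forall>\<phi>\<in>Cc. {t. \<phi> t \<noteq> 0} \<subseteq> K \<longrightarrow> cmod (\<gamma> \<phi>) \<le> C * (SUP t. cmod (\<phi> t))"
    using complex_measureD(4)[OF \<gamma> K] by (rule exE)
  note add = complex_measureD(2)[OF \<gamma>] and cm = complex_measureD(3)[OF \<gamma>]
  show ?thesis
  \<comment> \<open>The constant in \<open>complex_measure\<close> has no sign condition; its
    absolute value makes the bound monotone in the supremum.\<close>
  proof (intro exI[of _ "\<bar>C\<bar>"] conjI ballI allI impI)
    fix \<psi> e assume \<psi>: "\<psi> \<in> Cc" and z: "\<forall>t. t \<notin> K \<longrightarrow> \<phi> t = 0 \<and> \<psi> t = 0"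
      and e: "\<forall>t. cmod (\<psi> t - \<phi> t) \<le> e"
    define d where "d t = \<psi> t + (-1) * \<phi> t" for t
    have dCc: "d \<in> Cc" unfolding d_def by (intro Cc_add Cc_cmult \<phi> \<psi>)
    have d: "\<gamma> d = \<gamma> \<psi> - \<gamma> \<phi>"
      unfolding d_def using add[OF \<psi> Cc_cmult[OF \<phi>, of "-1"]] cm[OF \<phi>, of "-1"] by simp
    have de: "cmod (d t) \<le> e" for t using e by (simp add: d_def)
    have le: "(SUP t. cmod (d t)) \<le> e" by (rule cSUP_least) (use de in auto)
    have "0 \<le> cmod (d 0)" by simp
    also have "\<dots> \<le> (SUP t. cmod (d t))"
      by (rule cSUP_upper) (use de bdd_aboveI2[of UNIV "\<lambda>t. cmod (d t)" e] in auto)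
    finally have ge: "0 \<le> (SUP t. cmod (d t))" .
    have "{t. d t \<noteq> 0} \<subseteq> K"
    proof
      fix t assume "t \<in> {t. d t \<noteq> 0}"
      then show "t \<in> K" using z[rule_format, of t] by (cases "t \<in> K") (simp_all add: d_def)
    qed
    then have "cmod (\<gamma> d) \<le> C * (SUP t. cmod (d t))"
      using C[rule_format, OF dCc] by simp
    also have "\<dots> \<le> \<bar>C\<bar> * e" using le ge by (intro mult_mono) auto
    finally show "cmod (\<gamma> \<psi> - \<gamma> \<phi>) \<le> \<bar>C\<bar> * e" unfolding d .
  qed simp
qed

lemma complex_measure_eqI:
  fixes \<gamma> \<gamma>' :: "('g \<Rightarrow> complex) \<Rightarrow> complex"
  assumes "complex_measure \<gamma>" "complex_measure \<gamma>'"
    and eq: "\<And>\<phi> \<psi>. \<phi> \<in> Cc \<Longrightarrow> \<psi> \<in> Cc \<Longrightarrow>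
      \<gamma> (group_convolution mG \<phi> (tilde \<psi>)) = \<gamma>' (group_convolution mG \<phi> (tilde \<psi>))"
  shows "\<gamma> = \<gamma>'"
proof (rule extensionalityI)
  show "\<gamma> \<in> extensional Cc" "\<gamma>' \<in> extensional Cc"
    using assms by (auto simp: complex_measure_def)
  fix \<phi> :: "'g \<Rightarrow> complex" assume \<phi>: "\<phi> \<in> Cc"
  from group_convolution_approx[OF \<phi>] obtain K where K: "compact K"
    and ap: "\<And>e. e > 0 \<Longrightarrow> \<exists>\<psi>\<in>Cc.
     (\<forall>t. t \<notin> K \<longrightarrow> \<phi> t = 0 \<and> group_convolution mG \<phi> (tilde \<psi>) t = 0) \<and>
     (\<forall>t. cmod (group_convolution mG \<phi> (tilde \<psi>) t - \<phi> t) \<le> e)" by metis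
  obtain C where C0: "C \<ge> 0" and C: "\<forall>\<psi>\<in>Cc. \<forall>e. (\<forall>t. t \<notin> K \<longrightarrow> \<phi> t = 0 \<and> \<psi> t = 0) \<longrightarrow>
      (\<forall>t. cmod (\<psi> t - \<phi> t) \<le> e) \<longrightarrow> cmod (\<gamma> \<psi> - \<gamma> \<phi>) \<le> C * e"
    using complex_measure_limit[OF assms(1) K \<phi>] by (elim exE conjE)
  obtain C' where C'0: "C' \<ge> 0" and C': "\<forall>\<psi>\<in>Cc. \<forall>e. (\<forall>t. t \<notin> K \<longrightarrow> \<phi> t = 0 \<and> \<psi> t = 0) \<longrightarrow>
      (\<forall>t. cmod (\<psi> t - \<phi> t) \<le> e) \<longrightarrow> cmod (\<gamma>' \<psi> - \<gamma>' \<phi>) \<le> C' * e"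
    using complex_measure_limit[OF assms(2) K \<phi>] by (elim exE conjE)
  have "cmod (\<gamma> \<phi> - \<gamma>' \<phi>) \<le> e" if e: "e > 0" for e
  proof -
    \<comment> \<open>The two functionals contribute \<open>C\<close> and \<open>C'\<close> times
      the tolerance, so this denominator makes the sum at most \<open>e\<close>; the 1 excludes
      division by zero.\<close>
    have "C + C' + 1 > 0" using C0 C'0 by linarith
    then have "e / (C + C' + 1) > 0" using e by simp
    from ap[OF this] obtain \<psi> where \<psi>: "\<psi> \<in> Cc"
      "\<And>t. t \<notin> K \<Longrightarrow> \<phi> t = 0 \<and> group_convolution mG \<phi> (tilde \<psi>) t = 0"
      "\<And>t. cmod (group_convolution mG \<phi> (tilde \<psi>) t - \<phi> t) \<le> e / (C + C' + 1)" by blast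
    let ?c = "group_convolution mG \<phi> (tilde \<psi>)"
    have cc: "?c \<in> Cc" by (intro group_convolution_Cc tilde_Cc \<phi> \<psi>)
    have "\<gamma> \<phi> - \<gamma>' \<phi> = (\<gamma>' ?c - \<gamma>' \<phi>) - (\<gamma> ?c - \<gamma> \<phi>)" using eq[OF \<phi> \<psi>(1)] by simp
    also have "cmod \<dots> \<le> cmod (\<gamma>' ?c - \<gamma>' \<phi>) + cmod (\<gamma> ?c - \<gamma> \<phi>)" by (rule norm_triangle_ineq4)
    also have "\<dots> \<le> C' * (e / (C + C' + 1)) + C * (e / (C + C' + 1))"
    proof (rule add_mono)
      show "cmod (\<gamma>' ?c - \<gamma>' \<phi>) \<le> C' * (e / (C + C' + 1))"
        using C'[THEN bspec, OF cc, THEN spec, of "e / (C + C' + 1)"] \<psi>(2,3) by blast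
      show "cmod (\<gamma> ?c - \<gamma> \<phi>) \<le> C * (e / (C + C' + 1))"
        using C[THEN bspec, OF cc, THEN spec, of "e / (C + C' + 1)"] \<psi>(2,3) by blast
    qed
    also have "\<dots> = e * ((C + C') / (C + C' + 1))" by (simp add: algebra_simps add_divide_distrib)
    also have "\<dots> \<le> e * 1" using e C0 C'0 by (intro mult_left_mono) auto
    finally show ?thesis by simp
  qed
  then have "cmod (\<gamma> \<phi> - \<gamma>' \<phi>) \<le> 0" by (rule field_le_epsilon[of _ 0, simplified])
  then show "\<gamma> \<phi> = \<gamma>' \<phi>" by simp
qed

end

section \<open>Square integrable functions\<close>

definition l2_norm :: "'x measure \<Rightarrow> ('x \<Rightarrow> complex) \<Rightarrow> real" where
  "l2_norm M f = sqrt (LINT x|M. (cmod (f x))\<^sup>2)"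

lemma L2_measurable: "f \<in> L2 M \<Longrightarrow> f \<in> borel_measurable M"
  and L2_square_integrable: "f \<in> L2 M \<Longrightarrow> integrable M (\<lambda>x. (cmod (f x))\<^sup>2)"
  by (auto simp: L2_def)

lemma L2_product_integrable:
  assumes "f \<in> L2 M" "g \<in> L2 M"
  shows "integrable M (\<lambda>x. cmod (f x) * cmod (g x))"
proof (rule Bochner_Integration.integrable_bound)
  show "integrable M (\<lambda>x. (cmod (f x))\<^sup>2 + (cmod (g x))\<^sup>2)"
    using assms by (auto simp: L2_def)
  show "(\<lambda>x. cmod (f x) * cmod (g x)) \<in> borel_measurable M"
    using assms by (auto simp: L2_def)
  have "a * b \<le> a\<^sup>2 + b\<^sup>2" if "a \<ge> 0" "b \<ge> 0" for a b :: real
    using sum_squares_bound[of a b] that mult_nonneg_nonneg[OF that] by linarith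
  then show "AE x in M. norm (cmod (f x) * cmod (g x)) \<le> norm ((cmod (f x))\<^sup>2 + (cmod (g x))\<^sup>2)"
    by simp
qed

lemma l2_inner_integrable:
  assumes "f \<in> L2 M" "g \<in> L2 M"
  shows "integrable M (\<lambda>x. f x * cnj (g x))"
proof (rule Bochner_Integration.integrable_bound[OF L2_product_integrable[OF assms]])
  have "cnj \<in> borel_measurable borel"
    by (intro borel_measurable_continuous_onI continuous_on_cnj continuous_on_id)
  from measurable_compose[OF L2_measurable[OF assms(2)] this]
  show "(\<lambda>x. f x * cnj (g x)) \<in> borel_measurable M"
    by (intro borel_measurable_times L2_measurable[OF assms(1)])
qed (simp add: norm_mult)

lemma L2_add:
  assumes "f \<in> L2 M" "g \<in> L2 M"
  shows "(\<lambda>x. f x + g x) \<in> L2 M"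
proof -
  have "integrable M (\<lambda>x. (cmod (f x + g x))\<^sup>2)"
  proof (rule Bochner_Integration.integrable_bound)
    show "integrable M (\<lambda>x. 2 * (cmod (f x))\<^sup>2 + 2 * (cmod (g x))\<^sup>2)"
      using assms by (auto simp: L2_def)
    show "(\<lambda>x. (cmod (f x + g x))\<^sup>2) \<in> borel_measurable M"
      using assms by (auto simp: L2_def)
    have "(cmod (a + b))\<^sup>2 \<le> 2 * (cmod a)\<^sup>2 + 2 * (cmod b)\<^sup>2" for a b
    proof -
      have "(cmod (a + b))\<^sup>2 \<le> (cmod a + cmod b)\<^sup>2" by (intro power_mono norm_triangle_ineq) simp
      also have "\<dots> \<le> 2 * (cmod a)\<^sup>2 + 2 * (cmod b)\<^sup>2"
        using sum_squares_bound[of "cmod a" "cmod b"] by (simp add: power2_sum)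
      finally show ?thesis .
    qed
    then show "AE x in M. norm ((cmod (f x + g x))\<^sup>2) \<le> norm (2 * (cmod (f x))\<^sup>2 + 2 * (cmod (g x))\<^sup>2)"
      by simp
  qed
  then show ?thesis using assms by (auto simp: L2_def)
qed

lemma L2_cmult:
  assumes "f \<in> L2 M"
  shows "(\<lambda>x. c * f x) \<in> L2 M"
  using assms by (auto simp: L2_def norm_mult power_mult_distrib)

lemma L2_diff:
  assumes "f \<in> L2 M" "g \<in> L2 M"
  shows "(\<lambda>x. f x - g x) \<in> L2 M"
  using L2_add[OF assms(1) L2_cmult[OF assms(2), of "-1"]] by simp

lemma L2_zero: "(\<lambda>x. 0) \<in> L2 M"
  by (simp add: L2_def)

lemma l2_norm_nonneg [simp]: "l2_norm M f \<ge> 0"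
  by (simp add: l2_norm_def)

lemma l2_norm_square: "(l2_norm M f)\<^sup>2 = (LINT x|M. (cmod (f x))\<^sup>2)"
  by (simp add: l2_norm_def)

lemma l2_inner_add_left:
  assumes "f \<in> L2 M" "g \<in> L2 M" "h \<in> L2 M"
  shows "l2_inner M (\<lambda>x. f x + g x) h = l2_inner M f h + l2_inner M g h"
  using l2_inner_integrable[OF assms(1,3)] l2_inner_integrable[OF assms(2,3)]
  by (simp add: l2_inner_def distrib_right)

lemma l2_inner_diff_left:
  assumes "f \<in> L2 M" "g \<in> L2 M" "h \<in> L2 M"
  shows "l2_inner M (\<lambda>x. f x - g x) h = l2_inner M f h - l2_inner M g h"
  using l2_inner_integrable[OF assms(1,3)] l2_inner_integrable[OF assms(2,3)]
  by (simp add: l2_inner_def left_diff_distrib)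

lemma l2_inner_cmult_left: "l2_inner M (\<lambda>x. c * f x) h = c * l2_inner M f h"
  by (simp add: l2_inner_def mult.assoc)

lemma l2_inner_commute: "l2_inner M f g = cnj (l2_inner M g f)"
proof -
  have "cnj (l2_inner M g f) = (LINT x|M. cnj (g x * cnj (f x)))"
    unfolding l2_inner_def by (rule Bochner_Integration.integral_cnj[symmetric])
  also have "\<dots> = l2_inner M f g"
    unfolding l2_inner_def by (intro Bochner_Integration.integral_cong) simp_all
  finally show ?thesis ..
qed

lemma l2_inner_self: "l2_inner M f f = complex_of_real ((l2_norm M f)\<^sup>2)"
proof -
  have "l2_inner M f f = (LINT x|M. complex_of_real ((cmod (f x))\<^sup>2))"
    by (simp only: l2_inner_def complex_norm_square)
  also have "\<dots> = complex_of_real ((l2_norm M f)\<^sup>2)"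
    by (simp only: integral_complex_of_real l2_norm_square)
  finally show ?thesis .
qed

text \<open>Formulated for moduli because it serves twice: it bounds \<open>l2_inner\<close>, and
  with \<open>g\<close> constantly 1 it compares L1 and L2 norms in
  \<open>l2_complete\<close>.\<close>

lemma l2_Cauchy_Schwarz_abs:
  assumes "f \<in> L2 M" "g \<in> L2 M"
  shows "(LINT x|M. cmod (f x) * cmod (g x)) \<le> l2_norm M f * l2_norm M g"
proof -
  have [measurable]: "f \<in> borel_measurable M" "g \<in> borel_measurable M"
    using assms by (auto simp: L2_def)
  let ?I = "LINT x|M. cmod (f x) * cmod (g x)"
  have I0: "?I \<ge> 0" by (intro integral_nonneg_AE) simp
  have "ennreal (?I\<^sup>2) = (ennreal ?I)\<^sup>2" using I0 by (simp add: ennreal_power)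
  also have "ennreal ?I = (\<integral>\<^sup>+x. ennreal (cmod (f x)) * ennreal (cmod (g x)) \<partial>M)"
    using nn_integral_eq_integral[OF L2_product_integrable[OF assms]] by (simp add: ennreal_mult)
  also have "\<dots>\<^sup>2 \<le> (\<integral>\<^sup>+x. (ennreal (cmod (f x)))\<^sup>2 \<partial>M) * (\<integral>\<^sup>+x. (ennreal (cmod (g x)))\<^sup>2 \<partial>M)"
    by (rule Cauchy_Schwarz_nn_integral) measurable
  also have "\<dots> = ennreal ((l2_norm M f)\<^sup>2) * ennreal ((l2_norm M g)\<^sup>2)"
    using nn_integral_eq_integral[OF L2_square_integrable[OF assms(1)]]
      nn_integral_eq_integral[OF L2_square_integrable[OF assms(2)]]
    by (simp add: ennreal_power l2_norm_square)
  also have "\<dots> = ennreal ((l2_norm M f * l2_norm M g)\<^sup>2)"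
    by (simp add: ennreal_mult power_mult_distrib)
  finally have "?I\<^sup>2 \<le> (l2_norm M f * l2_norm M g)\<^sup>2" by simp
  then show ?thesis by (rule power2_le_imp_le) simp
qed

lemma l2_Cauchy_Schwarz:
  assumes "f \<in> L2 M" "g \<in> L2 M"
  shows "cmod (l2_inner M f g) \<le> l2_norm M f * l2_norm M g"
proof -
  have "cmod (l2_inner M f g) \<le> (LINT x|M. cmod (f x * cnj (g x)))"
    unfolding l2_inner_def by (rule integral_norm_bound)
  also have "\<dots> = (LINT x|M. cmod (f x) * cmod (g x))" by (simp add: norm_mult)
  also have "\<dots> \<le> l2_norm M f * l2_norm M g" by (rule l2_Cauchy_Schwarz_abs[OF assms])
  finally show ?thesis .
qed

section \<open>Completeness of L2 and limits of inner products\<close>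

text \<open>The measure is finite, so pairing with the constant 1 bounds the L1 norms of the
  increments by a geometric series. Their pointwise sum is then finite almost everywhere, the
  sequence converges almost everywhere, and Fatou's lemma transfers the rate to the limit. The rate
  is the one that \<open>l2_representation\<close> produces.\<close>

lemma l2_complete:
  assumes fin: "finite_measure M" and h: "\<And>n. h n \<in> L2 M"
    and cauchy: "\<And>n k. n \<le> k \<Longrightarrow> l2_norm M (\<lambda>x. h k x - h n x) \<le> 2 * (1/2)^n"
  obtains g where "g \<in> L2 M" "\<And>n. l2_norm M (\<lambda>x. g x - h n x) \<le> 2 * (1/2)^n"
proof -
  interpret finite_measure M by fact
  have [measurable]: "h n \<in> borel_measurable M" for n using h by (simp add: L2_def)
  have one: "(\<lambda>x. 1) \<in> L2 M" by (simp add: L2_def)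
  define d where "d n x = h (Suc n) x - h n x" for n x
  have dL2: "d n \<in> L2 M" for n unfolding d_def by (intro L2_diff h)
  have di: "integrable M (\<lambda>x. cmod (d n x))" for n
    using L2_product_integrable[OF dL2 one] by simp
  have dn: "(LINT x|M. cmod (d n x)) \<le> 2 * (1/2)^n * l2_norm M (\<lambda>x. 1)" for n
  proof -
    have "(LINT x|M. cmod (d n x)) \<le> l2_norm M (d n) * l2_norm M (\<lambda>x. 1)"
      using l2_Cauchy_Schwarz_abs[OF dL2 one, of n] by simp
    also have "\<dots> \<le> 2 * (1/2)^n * l2_norm M (\<lambda>x. 1)"
      using cauchy[of n "Suc n"] by (intro mult_right_mono) (auto simp: d_def[abs_def])
    finally show ?thesis .
  qed
  have summ: "summable (\<lambda>n. 2 * (1/2)^n * l2_norm M (\<lambda>x. 1))"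
    by (intro summable_mult2 summable_mult summable_geometric) simp
  have "(\<integral>\<^sup>+x. (\<Sum>n. ennreal (cmod (d n x))) \<partial>M) = (\<Sum>n. \<integral>\<^sup>+x. ennreal (cmod (d n x)) \<partial>M)"
    unfolding d_def by (rule nn_integral_suminf) measurable
  also have "\<dots> = (\<Sum>n. ennreal (LINT x|M. cmod (d n x)))"
    using nn_integral_eq_integral[OF di] by simp
  also have "\<dots> \<le> (\<Sum>n. ennreal (2 * (1/2)^n * l2_norm M (\<lambda>x. 1)))"
    by (intro suminf_le ennreal_leI dn) auto
  also have "\<dots> < \<infinity>"
    using summ by (simp add: suminf_ennreal2)
  finally have "AE x in M. (\<Sum>n. ennreal (cmod (d n x))) \<noteq> \<infinity>"
    unfolding d_def by (intro nn_integral_noteq_infinite) auto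
  then have conv: "AE x in M. convergent (\<lambda>n. h n x)"
  proof eventually_elim
    case (elim x)
    then have "summable (\<lambda>n. cmod (d n x))" by (intro summable_suminf_not_top) auto
    then have "summable (\<lambda>n. d n x)" by (rule summable_norm_cancel)
    then have "(\<lambda>n. \<Sum>i<n. d i x) \<longlonglongrightarrow> (\<Sum>i. d i x)" by (rule summable_LIMSEQ)
    moreover have "(\<Sum>i<n. d i x) = h n x - h 0 x" for n
      by (induction n) (auto simp: d_def)
    ultimately have "(\<lambda>n. (h n x - h 0 x) + h 0 x) \<longlonglongrightarrow> (\<Sum>i. d i x) + h 0 x"
      by (intro tendsto_add tendsto_const) simp
    then show ?case by (auto simp: convergent_def)
  qed
  define g where "g x = lim (\<lambda>n. h n x)" for x
  have g[measurable]: "g \<in> borel_measurable M"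
    unfolding g_def by (rule borel_measurable_lim_metric) measurable
  from conv have glim: "AE x in M. (\<lambda>n. h n x) \<longlonglongrightarrow> g x"
    by eventually_elim (simp add: g_def convergent_LIMSEQ_iff)
  have bound: "(\<integral>\<^sup>+x. ennreal ((cmod (g x - h n x))\<^sup>2) \<partial>M) \<le> ennreal ((2 * (1/2)^n)\<^sup>2)" for n
  proof -
    \<comment> \<open>Writing the integrand as a lower limit in \<open>k\<close> prepares Fatou's
      lemma; the Cauchy bound then applies for all \<open>k \<ge> n\<close>.\<close>
    have "AE x in M. ennreal ((cmod (g x - h n x))\<^sup>2) = liminf (\<lambda>k. ennreal ((cmod (h k x - h n x))\<^sup>2))"
      using glim
    proof eventually_elim
      case (elim x)
      then have "(\<lambda>k. ennreal ((cmod (h k x - h n x))\<^sup>2)) \<longlonglongrightarrow> ennreal ((cmod (g x - h n x))\<^sup>2)"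
        by (intro tendsto_ennrealI tendsto_power tendsto_norm tendsto_diff tendsto_const)
      then show ?case by (intro lim_imp_Liminf[symmetric]) auto
    qed
    then have "(\<integral>\<^sup>+x. ennreal ((cmod (g x - h n x))\<^sup>2) \<partial>M)
        = (\<integral>\<^sup>+x. liminf (\<lambda>k. ennreal ((cmod (h k x - h n x))\<^sup>2)) \<partial>M)"
      by (rule nn_integral_cong_AE)
    also have "\<dots> \<le> liminf (\<lambda>k. \<integral>\<^sup>+x. ennreal ((cmod (h k x - h n x))\<^sup>2) \<partial>M)"
      by (rule nn_integral_liminf) measurable
    also have "\<dots> \<le> limsup (\<lambda>k. \<integral>\<^sup>+x. ennreal ((cmod (h k x - h n x))\<^sup>2) \<partial>M)"
      by (rule Liminf_le_Limsup) simp
    also have "\<dots> \<le> ennreal ((2 * (1/2)^n)\<^sup>2)"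
    proof (rule Limsup_bounded)
      have "(\<integral>\<^sup>+x. ennreal ((cmod (h k x - h n x))\<^sup>2) \<partial>M) \<le> ennreal ((2 * (1/2)^n)\<^sup>2)" if "k \<ge> n" for k
      proof -
        have "(\<integral>\<^sup>+x. ennreal ((cmod (h k x - h n x))\<^sup>2) \<partial>M) = ennreal ((l2_norm M (\<lambda>x. h k x - h n x))\<^sup>2)"
          using nn_integral_eq_integral[OF L2_square_integrable[OF L2_diff[OF h h]], of k n]
          by (simp add: l2_norm_square)
        also have "\<dots> \<le> ennreal ((2 * (1/2)^n)\<^sup>2)"
          by (intro ennreal_leI power_mono cauchy that) simp
        finally show ?thesis .
      qed
      then show "\<forall>\<^sub>F k in sequentially. (\<integral>\<^sup>+x. ennreal ((cmod (h k x - h n x))\<^sup>2) \<partial>M) \<le> ennreal ((2 * (1/2)^n)\<^sup>2)"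
        unfolding eventually_sequentially by blast
    qed
    finally show ?thesis .
  qed
  have sqi: "integrable M (\<lambda>x. (cmod (g x - h n x))\<^sup>2)" for n
    using bound[of n] by (intro integrableI_nonneg) (auto simp: le_less_trans)
  then have diffL2: "(\<lambda>x. g x - h n x) \<in> L2 M" for n by (simp add: L2_def)
  show thesis
  proof (rule that[of g])
    show "g \<in> L2 M" using L2_add[OF diffL2[of 0] h[of 0]] by simp
    fix n
    have "ennreal (LINT x|M. (cmod (g x - h n x))\<^sup>2) \<le> ennreal ((2 * (1/2)^n)\<^sup>2)"
      using bound[of n] nn_integral_eq_integral[OF sqi, of n] by simp
    then have "(l2_norm M (\<lambda>x. g x - h n x))\<^sup>2 \<le> (2 * (1/2)^n)\<^sup>2"
      by (simp add: l2_norm_square)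
    then show "l2_norm M (\<lambda>x. g x - h n x) \<le> 2 * (1/2)^n" by (rule power2_le_imp_le) simp
  qed
qed

text \<open>Takes the place of Riesz representation: \<open>\<Lambda>\<close> is given as a limit,
  in the norm of functionals, of inner products with elements \<open>h n\<close>, and these form a
  Cauchy sequence whose limit represents \<open>\<Lambda>\<close>.\<close>

lemma l2_representation:
  assumes fin: "finite_measure M"
    and approx: "\<And>e. e > 0 \<Longrightarrow> \<exists>h\<in>L2 M. \<forall>g\<in>L2 M. cmod (l2_inner M h g - \<Lambda> g) \<le> e * l2_norm M g"
  obtains h where "h \<in> L2 M" "\<And>g. g \<in> L2 M \<Longrightarrow> l2_inner M h g = \<Lambda> g"
proof -
  have "\<forall>n. \<exists>h. h \<in> L2 M \<and> (\<forall>g\<in>L2 M. cmod (l2_inner M h g - \<Lambda> g) \<le> (1/2)^n * l2_norm M g)"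
    using approx[of "(1/2)^n" for n] by (auto simp: Bex_def)
  from choice[OF this] obtain h where h: "\<And>n. h n \<in> L2 M"
    and ha: "\<And>n g. g \<in> L2 M \<Longrightarrow> cmod (l2_inner M (h n) g - \<Lambda> g) \<le> (1/2)^n * l2_norm M g" by blast
  have cauchy: "l2_norm M (\<lambda>x. h k x - h n x) \<le> 2 * (1/2)^n" if "n \<le> k" for n k
  proof -
    \<comment> \<open>The difference is tested against itself: its squared norm is at most
      \<open>2 * (1/2)^n\<close> times its norm, and one factor cancels.\<close>
    define g where "g = (\<lambda>x. h k x - h n x)"
    have g: "g \<in> L2 M" unfolding g_def by (intro L2_diff h)
    have "(l2_norm M g)\<^sup>2 = cmod (l2_inner M g g)" by (simp add: l2_inner_self norm_power)
    also have "l2_inner M g g = (l2_inner M (h k) g - \<Lambda> g) - (l2_inner M (h n) g - \<Lambda> g)"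
      using l2_inner_diff_left[OF h h g, of k n] by (simp add: g_def)
    also have "cmod \<dots> \<le> cmod (l2_inner M (h k) g - \<Lambda> g) + cmod (l2_inner M (h n) g - \<Lambda> g)"
      by (rule norm_triangle_ineq4)
    also have "\<dots> \<le> (1/2)^k * l2_norm M g + (1/2)^n * l2_norm M g"
      by (intro add_mono ha g)
    also have "\<dots> \<le> (1/2)^n * l2_norm M g + (1/2)^n * l2_norm M g"
      using that by (intro add_mono mult_right_mono power_decreasing) auto
    also have "\<dots> = (2 * (1/2)^n) * l2_norm M g" by simp
    finally have "l2_norm M g * l2_norm M g \<le> (2 * (1/2)^n) * l2_norm M g"
      unfolding power2_eq_square .
    then have "l2_norm M g \<le> 2 * (1/2)^n"
    proof (cases "l2_norm M g = 0")
      case False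
      then have "l2_norm M g > 0" using l2_norm_nonneg[of M g] by linarith
      then show ?thesis using \<open>l2_norm M g * l2_norm M g \<le> _\<close> by (rule mult_right_le_imp_le[rotated])
    qed simp
    then show ?thesis by (simp add: g_def)
  qed
  obtain u where u: "u \<in> L2 M" "\<And>n. l2_norm M (\<lambda>x. u x - h n x) \<le> 2 * (1/2)^n"
    using l2_complete[OF fin h cauchy] by blast
  show thesis
  proof (rule that[OF u(1)])
    fix g assume g: "g \<in> L2 M"
    \<comment> \<open>The 3 is 2 from the distance between \<open>u\<close> and \<open>h n\<close>,
      plus 1 from the error of \<open>h n\<close> against \<open>\<Lambda>\<close>.\<close>
    have bound: "cmod (l2_inner M u g - \<Lambda> g) \<le> 3 * l2_norm M g * (1/2)^n" for n
    proof -
      have "l2_inner M u g - \<Lambda> g = l2_inner M (\<lambda>x. u x - h n x) g + (l2_inner M (h n) g - \<Lambda> g)"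
        using l2_inner_diff_left[OF u(1) h g, of n] by simp
      also have "cmod \<dots> \<le> cmod (l2_inner M (\<lambda>x. u x - h n x) g) + cmod (l2_inner M (h n) g - \<Lambda> g)"
        by (rule norm_triangle_ineq)
      also have "\<dots> \<le> 2 * (1/2)^n * l2_norm M g + (1/2)^n * l2_norm M g"
      proof (rule add_mono)
        have "cmod (l2_inner M (\<lambda>x. u x - h n x) g) \<le> l2_norm M (\<lambda>x. u x - h n x) * l2_norm M g"
          by (intro l2_Cauchy_Schwarz L2_diff u h g)
        also have "\<dots> \<le> 2 * (1/2)^n * l2_norm M g" by (intro mult_right_mono u) simp
        finally show "cmod (l2_inner M (\<lambda>x. u x - h n x) g) \<le> 2 * (1/2)^n * l2_norm M g" .
      qed (rule ha[OF g])
      also have "\<dots> = 3 * l2_norm M g * (1/2)^n" by (simp add: algebra_simps)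
      finally show ?thesis .
    qed
    have "(\<lambda>n. 3 * l2_norm M g * (1/2)^n) \<longlonglongrightarrow> 3 * l2_norm M g * 0"
      by (intro tendsto_mult tendsto_const LIMSEQ_realpow_zero) auto
    then have "cmod (l2_inner M u g - \<Lambda> g) \<le> 0"
      using bound by (intro LIMSEQ_le_const) auto
    then show "l2_inner M u g = \<Lambda> g" by simp
  qed
qed

lemma l2_norm_cmult: "l2_norm M (\<lambda>x. c * f x) = cmod c * l2_norm M f"
  by (simp add: l2_norm_def norm_mult power_mult_distrib real_sqrt_mult)

lemma l2_norm_triangle:
  assumes f: "f \<in> L2 M" and g: "g \<in> L2 M"
  shows "l2_norm M (\<lambda>x. f x + g x) \<le> l2_norm M f + l2_norm M g"
proof -
  let ?n = "l2_norm M (\<lambda>x. f x + g x)"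
  have fg: "(\<lambda>x. f x + g x) \<in> L2 M" by (rule L2_add[OF f g])
  have "?n * ?n = cmod (l2_inner M (\<lambda>x. f x + g x) (\<lambda>x. f x + g x))"
    by (simp add: l2_inner_self power2_eq_square norm_mult)
  also have "\<dots> = cmod (l2_inner M f (\<lambda>x. f x + g x) + l2_inner M g (\<lambda>x. f x + g x))"
    by (simp only: l2_inner_add_left[OF f g fg])
  also have "\<dots> \<le> cmod (l2_inner M f (\<lambda>x. f x + g x)) + cmod (l2_inner M g (\<lambda>x. f x + g x))"
    by (rule norm_triangle_ineq)
  also have "\<dots> \<le> l2_norm M f * ?n + l2_norm M g * ?n"
    by (intro add_mono l2_Cauchy_Schwarz f g fg)
  finally have le: "?n * ?n \<le> (l2_norm M f + l2_norm M g) * ?n" by (simp add: distrib_right)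
  show ?thesis
  proof (cases "?n = 0")
    case True
    then show ?thesis by (simp add: add_nonneg_nonneg)
  next
    case False
    then have "?n > 0" using l2_norm_nonneg[of M "\<lambda>x. f x + g x"] by linarith
    then show ?thesis using le by (rule mult_right_le_imp_le[rotated])
  qed
qed

lemma l2_norm_commute: "l2_norm M (\<lambda>x. f x - g x) = l2_norm M (\<lambda>x. g x - f x)"
  by (simp add: l2_norm_def norm_minus_commute)

lemma L2_simple_approx:
  assumes f: "f \<in> L2 M" and e: "e > 0"
  obtains s where "simple_function M s" "s \<in> L2 M" "l2_norm M (\<lambda>x. f x - s x) \<le> e"
proof -
  have fm: "f \<in> borel_measurable M" using f by (rule L2_measurable)
  from borel_measurable_implies_sequence_metric[OF L2_measurable[OF f], of 0] obtain s where
    s': "\<forall>i. simple_function M (s i)" and lim': "\<forall>x\<in>space M. (\<lambda>i. s i x) \<longlonglongrightarrow> f x"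
    and bnd': "\<forall>i. \<forall>x\<in>space M. dist (s i x) 0 \<le> 2 * dist (f x) 0"
    by (elim exE conjE)
  have s: "simple_function M (s i)" for i by (rule spec[OF s'])
  have lim: "(\<lambda>i. s i x) \<longlonglongrightarrow> f x" if "x \<in> space M" for x by (rule bspec[OF lim' that])
  \<comment> \<open>The simple approximants are dominated by twice \<open>f\<close>. This gives the
    factor 4 for their squares and, since \<open>f - s i\<close> is then at most three times
    \<open>f\<close> in modulus, the factor 9 in the dominating function.\<close>
  have bnd: "cmod (s i x) \<le> 2 * cmod (f x)" if "x \<in> space M" for i x
    using bnd'[rule_format, OF that, of i] by (simp only: dist_norm diff_zero)
  have sm: "s i \<in> borel_measurable M" for i by (rule borel_measurable_simple_function[OF s])
  have i4: "integrable M (\<lambda>x. 4 * (cmod (f x))\<^sup>2)" "integrable M (\<lambda>x. 9 * (cmod (f x))\<^sup>2)"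
    by (intro integrable_mult_right L2_square_integrable f)+
  have sL2: "s i \<in> L2 M" for i
  proof -
    have "integrable M (\<lambda>x. (cmod (s i x))\<^sup>2)"
    proof (rule Bochner_Integration.integrable_bound[OF i4(1)])
      show "AE x in M. norm ((cmod (s i x))\<^sup>2) \<le> norm (4 * (cmod (f x))\<^sup>2)"
      proof (rule AE_I2)
        fix x assume "x \<in> space M"
        from power_mono[OF bnd[OF this, of i] norm_ge_zero, of 2]
        show "norm ((cmod (s i x))\<^sup>2) \<le> norm (4 * (cmod (f x))\<^sup>2)" by (simp add: power_mult_distrib)
      qed
    qed (intro borel_measurable_power measurable_compose[OF sm borel_measurable_norm])
    then show ?thesis using sm[of i] by (simp add: L2_def)
  qed
  have "(\<lambda>i. LINT x|M. (cmod (f x - s i x))\<^sup>2) \<longlonglongrightarrow> (LINT x|M. 0)"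
  proof (rule integral_dominated_convergence[where w = "\<lambda>x. 9 * (cmod (f x))\<^sup>2" and f = "\<lambda>x. 0" and s = "\<lambda>i x. (cmod (f x - s i x))\<^sup>2"])
    show "AE x in M. (\<lambda>i. (cmod (f x - s i x))\<^sup>2) \<longlonglongrightarrow> 0"
    proof (rule AE_I2)
      fix x assume "x \<in> space M"
      then have "(\<lambda>i. (cmod (f x - s i x))\<^sup>2) \<longlonglongrightarrow> (cmod (f x - f x))\<^sup>2"
        by (intro tendsto_power tendsto_norm tendsto_diff tendsto_const lim)
      then show "(\<lambda>i. (cmod (f x - s i x))\<^sup>2) \<longlonglongrightarrow> 0" by simp
    qed
    show "AE x in M. norm ((cmod (f x - s i x))\<^sup>2) \<le> 9 * (cmod (f x))\<^sup>2" for i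
    proof (rule AE_I2)
      fix x assume "x \<in> space M"
      have "cmod (f x - s i x) \<le> 3 * cmod (f x)"
        using norm_triangle_ineq4[of "f x" "s i x"] bnd[OF \<open>x \<in> space M\<close>, of i] by linarith
      from power_mono[OF this norm_ge_zero, of 2]
      show "norm ((cmod (f x - s i x))\<^sup>2) \<le> 9 * (cmod (f x))\<^sup>2" by (simp add: power_mult_distrib)
    qed
    show "(\<lambda>x. (cmod (f x - s i x))\<^sup>2) \<in> borel_measurable M" for i
      by (intro borel_measurable_power measurable_compose[OF borel_measurable_diff[OF fm sm] borel_measurable_norm])
  qed (rule borel_measurable_const, rule i4(2))
  then have l0: "(\<lambda>i. LINT x|M. (cmod (f x - s i x))\<^sup>2) \<longlonglongrightarrow> 0"
    by (simp only: integral_zero)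
  have "0 < e\<^sup>2" using e by simp
  from eventually_happens'[OF sequentially_bot order_tendstoD(2)[OF l0 this]]
  obtain i where "(LINT x|M. (cmod (f x - s i x))\<^sup>2) < e\<^sup>2" by (rule exE)
  then have "(l2_norm M (\<lambda>x. f x - s i x))\<^sup>2 < e\<^sup>2" unfolding l2_norm_square .
  then have "l2_norm M (\<lambda>x. f x - s i x) \<le> e"
    by (rule power2_le_imp_le[OF less_imp_le less_imp_le[OF e]])
  then show thesis by (rule that[OF s[of i] sL2[of i]])
qed

section \<open>Transforms on the dual group\<close>

lemma char_continuous: "continuous_on UNIV (char_apply \<eta>)"
  and char_norm [simp]: "cmod (char_apply \<eta> t) = 1"
  and char_add: "char_apply \<eta> (s + t) = char_apply \<eta> s * char_apply \<eta> t"
  using char_apply[of \<eta>] by auto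

lemma char_zero [simp]: "char_apply \<eta> 0 = 1"
proof -
  have "char_apply \<eta> 0 * char_apply \<eta> 0 = char_apply \<eta> 0 * 1"
    using char_add[of \<eta> 0 0] by simp
  moreover have "char_apply \<eta> 0 \<noteq> 0" using char_norm[of \<eta> 0] by (metis norm_zero zero_neq_one)
  ultimately show ?thesis by (metis mult_left_cancel)
qed

lemma char_diff: "char_apply \<eta> (s - t) = char_apply \<eta> s * cnj (char_apply \<eta> t)"
proof -
  have "char_apply \<eta> s = char_apply \<eta> (s - t) * char_apply \<eta> t"
    using char_add[of \<eta> "s - t" t] by simp
  then have "char_apply \<eta> s * cnj (char_apply \<eta> t) = char_apply \<eta> (s - t) * (char_apply \<eta> t * cnj (char_apply \<eta> t))"
    by simp
  also have "char_apply \<eta> t * cnj (char_apply \<eta> t) = 1"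
    using complex_norm_square[of "char_apply \<eta> t"] by simp
  finally show ?thesis by simp
qed

lemma open_dual_subbasis:
  assumes "compact K" "open V"
  shows "open {\<eta>. char_apply \<eta> ` K \<subseteq> V}"
  unfolding open_dual_def using assms by (intro generate_topology.Basis) blast

text \<open>Distinct characters differ at some \<open>t\<close>, and the singleton
  \<open>{t}\<close> is an admissible compact set in the subbasis. The Hausdorff property makes
  compact sets of characters closed, hence Borel.\<close>

instance dual :: (topological_ab_group_add) t2_space
proof
  fix x y :: "'a dual" assume "x \<noteq> y"
  then obtain t where "char_apply x t \<noteq> char_apply y t"
    using char_apply_inject[of x y] by (auto simp: fun_eq_iff)
  from hausdorff[OF this] obtain U V where UV: "open U" "open V" "char_apply x t \<in> U"
    "char_apply y t \<in> V" "U \<inter> V = {}" by blast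
  show "\<exists>U V. open U \<and> open V \<and> x \<in> U \<and> y \<in> V \<and> U \<inter> V = {}"
    using UV open_dual_subbasis[of "{t}" U] open_dual_subbasis[of "{t}" V]
    by (intro exI[of _ "{\<eta>. char_apply \<eta> ` {t} \<subseteq> U}"] exI[of _ "{\<eta>. char_apply \<eta> ` {t} \<subseteq> V}"]) auto
qed

text \<open>The common estimate behind all uses of bumps: \<open>r\<close> is a probability density,
  and only values of \<open>F\<close> where \<open>r\<close> does not vanish matter. The centre
  \<open>z\<close> is a function value when localizing, 1 for characters near 0, and 0 for plain
  upper bounds.\<close>

lemma weighted_mean_bound:
  fixes F :: "'a \<Rightarrow> complex"
  assumes r: "integrable M r" "\<And>x. r x \<ge> 0" "(LINT x|M. r x) = 1"
    and F: "integrable M (\<lambda>x. complex_of_real (r x) * F x)"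
    and near: "\<And>x. r x \<noteq> 0 \<Longrightarrow> cmod (F x - z) \<le> e"
  shows "cmod ((LINT x|M. complex_of_real (r x) * F x) - z) \<le> e"
proof -
  have ri: "integrable M (\<lambda>x. complex_of_real (r x) * z)" using r(1) by simp
  have "(LINT x|M. complex_of_real (r x) * z) = z" using r by simp
  then have "(LINT x|M. complex_of_real (r x) * F x) - z
      = (LINT x|M. complex_of_real (r x) * F x - complex_of_real (r x) * z)"
    using F ri by simp
  also have "cmod \<dots> \<le> (LINT x|M. cmod (complex_of_real (r x) * F x - complex_of_real (r x) * z))"
    by (rule integral_norm_bound)
  also have "\<dots> \<le> (LINT x|M. r x * e)"
  proof (rule integral_mono)
    show "integrable M (\<lambda>x. cmod (complex_of_real (r x) * F x - complex_of_real (r x) * z))"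
      by (intro integrable_norm Bochner_Integration.integrable_diff F ri)
    show "integrable M (\<lambda>x. r x * e)" using r(1) by simp
    fix x
    have "cmod (complex_of_real (r x) * F x - complex_of_real (r x) * z) = r x * cmod (F x - z)"
      by (simp only: right_diff_distrib[symmetric] norm_mult norm_of_real abs_of_nonneg[OF r(2)])
    also have "\<dots> \<le> r x * e"
      using near[of x] r(2)[of x] by (cases "r x = 0") (auto intro: mult_left_mono)
    finally show "cmod (complex_of_real (r x) * F x - complex_of_real (r x) * z) \<le> r x * e" .
  qed
  also have "\<dots> = e" using r(3) by simp
  finally show ?thesis .
qed

lemma Cc_translate:
  fixes \<phi> :: "'g::{topological_ab_group_add, t2_space} \<Rightarrow> complex"
  assumes "\<phi> \<in> Cc"
  shows "(\<lambda>t. \<phi> (- s + t)) \<in> Cc"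
proof -
  from assms obtain K where K: "continuous_on UNIV \<phi>" "compact K" "\<And>t. t \<notin> K \<Longrightarrow> \<phi> t = 0"
    by (rule CcE) blast
  have "compact ((\<lambda>t. s + t) ` K)"
    by (intro compact_continuous_image K continuous_intros)
  moreover have "\<phi> (- s + t) = 0" if "t \<notin> (\<lambda>t. s + t) ` K" for t
  proof (rule K(3))
    show "- s + t \<notin> K"
    proof
      assume "- s + t \<in> K"
      then have "s + (- s + t) \<in> (\<lambda>t. s + t) ` K" by (rule imageI)
      with that show False by simp
    qed
  qed
  moreover have "continuous_on UNIV (\<lambda>t. \<phi> (- s + t))"
    by (intro continuous_on_compose2[OF K(1)] continuous_intros) auto
  ultimately show ?thesis by (intro CcI)
qed

section \<open>Joint continuity of characters and Fubini with the dual group\<close>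

context lca_group
begin

text \<open>Here local compactness meets the compact-open topology: on a compact neighbourhood
  \<open>K\<close> of \<open>t0\<close> the character \<open>\<eta>0\<close> stays in the ball, and
  the characters mapping \<open>K\<close> into that ball form an open set.\<close>

lemma evaluation_continuous:
  "continuous_on UNIV (\<lambda>p. char_apply (snd p) (fst p :: 'g))"
  unfolding continuous_on_def
proof (intro ballI tendstoI)
  fix p :: "'g \<times> 'g dual" and e :: real assume e: "e > 0"
  obtain t0 \<eta>0 where p: "p = (t0, \<eta>0)" by (cases p)
  let ?B = "ball (char_apply \<eta>0 t0) e"
  have "open (char_apply \<eta>0 -` ?B)" by (rule open_vimage[OF open_ball char_continuous])
  moreover have "t0 \<in> char_apply \<eta>0 -` ?B" using e by simp
  ultimately obtain V K where V: "open V" "compact K" "t0 \<in> V" "V \<subseteq> K" "K \<subseteq> char_apply \<eta>0 -` ?B"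
    using compact_nhd[of "char_apply \<eta>0 -` ?B" t0] by auto
  let ?N = "{\<eta>. char_apply \<eta> ` K \<subseteq> ?B}"
  have N: "open ?N" by (rule open_dual_subbasis[OF V(2) open_ball])
  have "open (V \<times> ?N)" by (rule open_Times[OF V(1) N])
  moreover have "p \<in> V \<times> ?N" using V p by auto
  moreover have "dist (char_apply (snd q) (fst q)) (char_apply (snd p) (fst p)) < e" if "q \<in> V \<times> ?N" for q
  proof -
    have "fst q \<in> K" "char_apply (snd q) ` K \<subseteq> ?B" using that V(4) by auto
    then have "char_apply (snd q) (fst q) \<in> ?B" by blast
    then show ?thesis by (simp add: p dist_commute)
  qed
  ultimately show "\<forall>\<^sub>F q in at p within UNIV. dist (char_apply (snd q) (fst q)) (char_apply (snd p) (fst p)) < e"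
    unfolding eventually_at_topological by (intro exI[of _ "V \<times> ?N"]) simp
qed

lemma evaluation_continuous2:
  fixes u :: "'b::topological_space \<Rightarrow> 'g"
  assumes "continuous_on A u" "continuous_on A v"
  shows "continuous_on A (\<lambda>p. char_apply (v p) (u p))"
proof -
  have "continuous_on A (\<lambda>p. char_apply (snd (u p, v p)) (fst (u p, v p)))"
    by (rule continuous_on_compose2[OF evaluation_continuous continuous_on_Pair[OF assms]]) simp
  then show ?thesis by simp
qed

lemma check_transform_continuous:
  assumes "\<phi> \<in> Cc"
  shows "continuous_on UNIV (check_transform mG \<phi>)"
proof -
  from assms obtain K where K: "continuous_on UNIV \<phi>" "compact K" "\<And>t. t \<notin> K \<Longrightarrow> \<phi> t = 0"
    by (rule CcE) blast
  have "continuous_on UNIV (\<lambda>p. char_apply (fst p) (snd p) * \<phi> (snd p))"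
    by (intro continuous_intros evaluation_continuous2 continuous_on_compose2[OF K(1)]) auto
  from continuous_parametric_integral[OF radon this K(2)] K(3)
  have "continuous_on UNIV (\<lambda>\<eta>. LINT t|mG. char_apply \<eta> t * \<phi> t)" by simp
  then show ?thesis by (simp add: check_transform_def[abs_def])
qed

lemma check_transform_bound: "cmod (check_transform mG \<phi> \<eta>) \<le> (LINT t|mG. cmod (\<phi> t))"
proof -
  have "cmod (check_transform mG \<phi> \<eta>) \<le> (LINT t|mG. cmod (char_apply \<eta> t * \<phi> t))"
    unfolding check_transform_def by (rule integral_norm_bound)
  then show ?thesis by (simp add: norm_mult)
qed

text \<open>The dual itself need not be sigma-compact, but a finite Radon measure leaves mass less
  than \<open>1/(n+1)\<close> outside some compact set for each \<open>n\<close>, so the union of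
  these sets carries it.\<close>

lemma dual_sigma_compact_support:
  fixes \<rho> :: "'g dual measure"
  assumes \<rho>: "radon_measure \<rho>" "finite_measure \<rho>"
  obtains L :: "nat \<Rightarrow> 'g dual set" where "\<And>n. compact (L n)" "incseq L" "AE \<eta> in \<rho>. \<eta> \<in> (\<Union>n. L n)"
proof -
  interpret finite_measure \<rho> by (rule \<rho>(2))
  have sp: "space \<rho> = UNIV" by (rule radon_space[OF \<rho>(1)])
  have fin: "emeasure \<rho> UNIV < \<infinity>" by (simp add: less_top[symmetric])
  have "\<forall>n. \<exists>K. compact K \<and> emeasure \<rho> (UNIV - K) < ennreal (inverse (real (Suc n)))"
  proof
    fix n
    have "inverse (real (Suc n)) > 0" by simp
    from radon_compact_approx[OF \<rho>(1) open_UNIV fin this] obtain K where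
      "compact K" "emeasure \<rho> (UNIV - K) < ennreal (inverse (real (Suc n)))" by metis
    then show "\<exists>K. compact K \<and> emeasure \<rho> (UNIV - K) < ennreal (inverse (real (Suc n)))" by blast
  qed
  from choice[OF this] obtain K where K: "\<And>n. compact (K n)"
    "\<And>n. emeasure \<rho> (UNIV - K n) < ennreal (inverse (real (Suc n)))" by blast
  have Ks: "K n \<in> sets \<rho>" for n using K(1) by (simp add: radon_sets[OF \<rho>(1)] compact_imp_closed)
  \<comment> \<open>Finite unions make the sequence increasing, which the convergence of indicators
    in \<open>check_transform_Fubini\<close> relies on.\<close>
  let ?L = "\<lambda>n. \<Union>i\<le>n. K i"
  have UL: "(\<Union>n. ?L n) = (\<Union>n. K n)" by blast
  have le: "emeasure \<rho> (UNIV - (\<Union>n. K n)) \<le> ennreal (inverse (real (Suc n)))" for n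
  proof -
    have "emeasure \<rho> (UNIV - (\<Union>n. K n)) \<le> emeasure \<rho> (UNIV - K n)"
      using Ks sp sets.compl_sets[OF Ks[of n]] by (intro emeasure_mono) auto
    then show ?thesis using K(2)[of n] by simp
  qed
  have "emeasure \<rho> (UNIV - (\<Union>n. K n)) = ennreal (measure \<rho> (UNIV - (\<Union>n. K n)))"
    by (rule emeasure_eq_measure)
  with le have "measure \<rho> (UNIV - (\<Union>n. K n)) \<le> inverse (real (Suc n))" for n by simp
  then have "measure \<rho> (UNIV - (\<Union>n. K n)) \<le> 0"
    by (intro LIMSEQ_le_const[OF LIMSEQ_inverse_real_of_nat]) auto
  then have "emeasure \<rho> (UNIV - (\<Union>n. K n)) = 0"
    by (simp add: emeasure_eq_measure measure_le_0_iff)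
  moreover have "UNIV - (\<Union>n. K n) \<in> sets \<rho>"
    using sets.compl_sets[of "\<Union>n. K n" \<rho>] Ks sp by auto
  ultimately have "AE \<eta> in \<rho>. \<eta> \<in> (\<Union>n. K n)"
    by (intro AE_I[of _ _ "UNIV - (\<Union>n. K n)"]) auto
  then have ae: "AE \<eta> in \<rho>. \<eta> \<in> (\<Union>n. ?L n)" unfolding UL .
  show thesis
  proof (rule that[of ?L])
    show "compact (?L n)" for n by (intro compact_UN K) simp
    show "incseq ?L" by (intro monoI UN_mono) auto
  qed (rule ae)
qed

text \<open>The bounded weight \<open>a\<close> allows two uses: once with the conjugate of a
  transform, once with the conjugate of a character. Together they express a squared transform as a
  double integral.\<close>

lemma check_transform_Fubini:
  fixes \<rho> :: "'g dual measure"
  assumes \<rho>: "radon_measure \<rho>" "finite_measure \<rho>" and \<phi>: "\<phi> \<in> Cc"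
    and a: "a \<in> borel_measurable borel" "\<And>\<eta>. cmod (a \<eta>) \<le> A"
  shows "(LINT \<eta>|\<rho>. check_transform mG \<phi> \<eta> * a \<eta>) = (LINT t|mG. \<phi> t * (LINT \<eta>|\<rho>. char_apply \<eta> t * a \<eta>))"
proof -
  interpret fin: finite_measure \<rho> by (rule \<rho>(2))
  interpret pair_sigma_finite mG \<rho>
    by (intro pair_sigma_finite.intro sigma_finite fin.sigma_finite_measure_axioms)
  have sp: "space \<rho> = UNIV" by (rule radon_space[OF \<rho>(1)])
  have sets: "sets (mG \<Otimes>\<^sub>M \<rho>) = sets (borel \<Otimes>\<^sub>M borel)"
    by (intro sets_pair_measure_cong radon_sets radon \<rho>)
  have meq: "borel_measurable (mG \<Otimes>\<^sub>M \<rho>) = (borel_measurable (borel \<Otimes>\<^sub>M borel) :: ('g \<times> 'g dual \<Rightarrow> complex) set)"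
    by (rule measurable_cong_sets[OF sets refl])
  from \<phi> obtain K where K: "continuous_on UNIV \<phi>" "compact K" "\<And>t. t \<notin> K \<Longrightarrow> \<phi> t = 0"
    by (rule CcE) blast
  obtain B where B: "B \<ge> 0" "\<And>t. cmod (\<phi> t) \<le> B" by (rule Cc_bounded[OF \<phi>]) blast
  \<comment> \<open>Any character would do; the bound is evaluated once only to learn the sign of
    \<open>A\<close>.\<close>
  have A: "A \<ge> 0" using a(2)[of undefined] norm_ge_zero[of "a undefined"] by linarith
  obtain L :: "nat \<Rightarrow> 'g dual set" where L: "\<And>n. compact (L n)" "incseq L"
    and ae: "AE \<eta> in \<rho>. \<eta> \<in> (\<Union>n. L n)"
    by (rule dual_sigma_compact_support[OF \<rho>]) blast
  let ?Z = "\<Union>n. L n"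
  have times_Z: "(\<Union>n. K \<times> L n) = K \<times> ?Z" by blast
  have Zs: "?Z \<in> sets borel" using L(1) by (auto simp: compact_imp_closed)
  define F where "F p = \<phi> (fst p) * char_apply (snd p) (fst p)" for p
  have Fc: "continuous_on UNIV F"
    unfolding F_def by (intro continuous_intros evaluation_continuous2 continuous_on_compose2[OF K(1)]) auto
  have Fm: "(\<lambda>p. indicator (K \<times> ?Z) p * F p) \<in> borel_measurable (borel \<Otimes>\<^sub>M borel)"
  proof (rule borel_measurable_LIMSEQ_metric)
    show "(\<lambda>p. indicator (K \<times> L n) p * F p) \<in> borel_measurable (borel \<Otimes>\<^sub>M borel)" for n
      by (rule rectangle_measurable[OF Fc K(2) L(1)])
    fix p :: "'g \<times> 'g dual"
    have "(\<lambda>n. indicator (K \<times> L n) p * F p) \<longlonglongrightarrow> indicator (\<Union>n. K \<times> L n) p * F p"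
      using L(2) by (intro tendsto_mult tendsto_const LIMSEQ_indicator_incseq) (auto simp: incseq_def)
    then show "(\<lambda>n. indicator (K \<times> L n) p * F p) \<longlonglongrightarrow> indicator (K \<times> ?Z) p * F p"
      unfolding times_Z .
  qed
  \<comment> \<open>The integrand cut down to \<open>K \<times> ?Z\<close>, where it is a limit of
    functions covered by \<open>rectangle_measurable\<close>. The cut in \<open>t\<close> is
    invisible since \<open>\<phi>\<close> vanishes off \<open>K\<close>, and the cut in
    \<open>\<eta>\<close> costs only a null set.\<close>
  define G where "G t \<eta> = indicator (K \<times> ?Z) (t, \<eta>) * F (t, \<eta>) * a \<eta>" for t \<eta>
  have Gm: "case_prod G \<in> borel_measurable (mG \<Otimes>\<^sub>M \<rho>)"
  proof -
    have "(\<lambda>p. a (snd p)) \<in> borel_measurable (borel \<Otimes>\<^sub>M borel)"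
      by (rule measurable_compose[OF measurable_snd a(1)])
    from borel_measurable_times[OF Fm this] show ?thesis
      unfolding meq by (simp add: G_def case_prod_unfold)
  qed
  have Ks: "K \<in> sets mG" using K(2) by (simp add: sets_mG compact_imp_closed)
  have Gi: "integrable (mG \<Otimes>\<^sub>M \<rho>) (case_prod G)"
  proof (rule integrableI_bounded_set[where A = "K \<times> UNIV" and B = "B * A"])
    have U: "UNIV \<in> sets \<rho>" using sets.top[of \<rho>] sp by simp
    then show "K \<times> UNIV \<in> sets (mG \<Otimes>\<^sub>M \<rho>)" using Ks by simp
    have "emeasure \<rho> UNIV < \<infinity>" by (simp add: less_top[symmetric])
    then show "emeasure (mG \<Otimes>\<^sub>M \<rho>) (K \<times> UNIV) < \<infinity>"
      using radon_finite[OF radon K(2)] Ks U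
      by (simp add: fin.emeasure_pair_measure_Times ennreal_mult_less_top)
    have "cmod (G t \<eta>) \<le> B * A" for t \<eta>
    proof -
      have "cmod (G t \<eta>) \<le> cmod (\<phi> t) * cmod (a \<eta>)"
        by (auto simp: G_def F_def norm_mult indicator_def)
      also have "\<dots> \<le> B * A" by (intro mult_mono B a) simp
      finally show ?thesis .
    qed
    then show "AE p in mG \<Otimes>\<^sub>M \<rho>. p \<in> K \<times> UNIV \<longrightarrow> cmod (case_prod G p) \<le> B * A" by auto
    show "AE p in mG \<Otimes>\<^sub>M \<rho>. p \<notin> K \<times> UNIV \<longrightarrow> case_prod G p = 0"
      by (auto simp: G_def indicator_def)
  qed (rule Gm)
  have G1: "G t \<eta> = \<phi> t * (indicator ?Z \<eta> * (char_apply \<eta> t * a \<eta>))" for t \<eta>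
    using K(3)[of t] by (cases "t \<in> K") (auto simp: G_def F_def indicator_def)
  have evm: "(\<lambda>\<eta>. char_apply \<eta> t) \<in> borel_measurable borel" for t :: 'g
    by (intro borel_measurable_continuous_onI evaluation_continuous2 continuous_intros)
  have rm: "borel_measurable \<rho> = (borel_measurable borel :: ('g dual \<Rightarrow> complex) set)"
    by (rule radon_measurable[OF \<rho>(1)])
  have zi: "(indicator ?Z :: 'g dual \<Rightarrow> complex) \<in> borel_measurable borel"
    using Zs by (rule borel_measurable_indicator)
  have "(LINT \<eta>|\<rho>. check_transform mG \<phi> \<eta> * a \<eta>) = (LINT \<eta>|\<rho>. LINT t|mG. G t \<eta>)"
  proof (rule integral_cong_AE)
    have cm: "check_transform mG \<phi> \<in> borel_measurable borel"
      by (rule borel_measurable_continuous_onI[OF check_transform_continuous[OF \<phi>]])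
    have inner: "(LINT t|mG. G t \<eta>) = indicator ?Z \<eta> * (check_transform mG \<phi> \<eta> * a \<eta>)" for \<eta>
    proof -
      have "(LINT t|mG. G t \<eta>) = (LINT t|mG. (char_apply \<eta> t * \<phi> t) * (indicator ?Z \<eta> * a \<eta>))"
        unfolding G1 by (intro Bochner_Integration.integral_cong refl) (simp only: mult_ac)
      also have "\<dots> = (LINT t|mG. char_apply \<eta> t * \<phi> t) * (indicator ?Z \<eta> * a \<eta>)"
        by (rule integral_mult_left_zero)
      finally show ?thesis by (simp add: check_transform_def mult_ac)
    qed
    show "(\<lambda>\<eta>. check_transform mG \<phi> \<eta> * a \<eta>) \<in> borel_measurable \<rho>"
      unfolding rm by (intro borel_measurable_times cm a)
    show "(\<lambda>\<eta>. LINT t|mG. G t \<eta>) \<in> borel_measurable \<rho>"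
      unfolding rm inner by (intro borel_measurable_times cm a zi)
    show "AE \<eta> in \<rho>. check_transform mG \<phi> \<eta> * a \<eta> = (LINT t|mG. G t \<eta>)"
      using ae unfolding inner by eventually_elim (simp add: indicator_def)
  qed
  also have "\<dots> = (LINT t|mG. LINT \<eta>|\<rho>. G t \<eta>)"
    by (rule Fubini_integral[OF Gi])
  also have "\<dots> = (LINT t|mG. \<phi> t * (LINT \<eta>|\<rho>. char_apply \<eta> t * a \<eta>))"
  proof (intro Bochner_Integration.integral_cong refl)
    fix t
    have "(LINT \<eta>|\<rho>. G t \<eta>) = \<phi> t * (LINT \<eta>|\<rho>. indicator ?Z \<eta> * (char_apply \<eta> t * a \<eta>))"
      unfolding G1 by (rule integral_mult_right_zero)
    also have "(LINT \<eta>|\<rho>. indicator ?Z \<eta> * (char_apply \<eta> t * a \<eta>)) = (LINT \<eta>|\<rho>. char_apply \<eta> t * a \<eta>)"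
    proof (rule integral_cong_AE)
      show "(\<lambda>\<eta>. indicator ?Z \<eta> * (char_apply \<eta> t * a \<eta>)) \<in> borel_measurable \<rho>"
        unfolding rm by (intro borel_measurable_times evm a zi)
      show "(\<lambda>\<eta>. char_apply \<eta> t * a \<eta>) \<in> borel_measurable \<rho>"
        unfolding rm by (intro borel_measurable_times evm a)
      show "AE \<eta> in \<rho>. indicator ?Z \<eta> * (char_apply \<eta> t * a \<eta>) = char_apply \<eta> t * a \<eta>"
        using ae by eventually_elim (simp add: indicator_def)
    qed
    finally show "(LINT \<eta>|\<rho>. G t \<eta>) = \<phi> t * (LINT \<eta>|\<rho>. char_apply \<eta> t * a \<eta>)" .
  qed
  finally show ?thesis .
qed

section \<open>The sesquilinear form of a continuous function\<close>

text \<open>The meeting point of three quantities: for \<open>c\<close> the function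
  \<open>t \<mapsto> l2_inner m (translate \<alpha> t f) f\<close> it is the inner product of two
  orbit integrals, for continuous \<open>c\<close> it is the integral of \<open>c\<close> against
  \<open>\<phi>\<close> convolved with \<open>tilde \<psi>\<close>, and for \<open>c\<close> an
  inverse transform its diagonal is the integral of a squared transform.\<close>

definition sesquilinear_form :: "('g \<Rightarrow> complex) \<Rightarrow> ('g \<Rightarrow> complex) \<Rightarrow> ('g \<Rightarrow> complex) \<Rightarrow> complex" where
  "sesquilinear_form c \<phi> \<psi> = (LINT t|mG. \<phi> t * (LINT s|mG. cnj (\<psi> s) * c (t - s)))"

text \<open>The squared modulus is the transform times its conjugate. Exchanging integrals for the
  first factor and then for the second leaves a product of characters at \<open>t\<close> and
  \<open>s\<close>, which \<open>char_diff\<close> merges into one at \<open>t - s\<close>.\<close>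

lemma check_transform_square_integral:
  fixes \<rho> :: "'g dual measure"
  assumes \<rho>: "radon_measure \<rho>" "finite_measure \<rho>" and \<phi>: "\<phi> \<in> Cc"
  shows "integrable \<rho> (\<lambda>\<eta>. (cmod (check_transform mG \<phi> \<eta>))\<^sup>2)"
    and "complex_of_real (LINT \<eta>|\<rho>. (cmod (check_transform mG \<phi> \<eta>))\<^sup>2)
      = sesquilinear_form (\<lambda>t. LINT \<eta>|\<rho>. char_apply \<eta> t) \<phi> \<phi>"
proof -
  interpret fin: finite_measure \<rho> by (rule \<rho>(2))
  let ?I = "LINT t|mG. cmod (\<phi> t)"
  let ?c = "check_transform mG \<phi>"
  have cc: "continuous_on UNIV ?c" by (rule check_transform_continuous[OF \<phi>])
  have cm: "?c \<in> borel_measurable borel" by (rule borel_measurable_continuous_onI[OF cc])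
  have ccm: "(\<lambda>\<eta>. cnj (?c \<eta>)) \<in> borel_measurable borel"
    by (rule borel_measurable_continuous_onI[OF continuous_on_cnj[OF cc]])
  have "(\<lambda>\<eta>. (cmod (?c \<eta>))\<^sup>2) \<in> borel_measurable borel"
    by (intro borel_measurable_power measurable_compose[OF cm borel_measurable_norm])
  then have sm: "(\<lambda>\<eta>. (cmod (?c \<eta>))\<^sup>2) \<in> borel_measurable \<rho>"
    using measurable_cong_sets[OF radon_sets[OF \<rho>(1)] refl] by blast
  show "integrable \<rho> (\<lambda>\<eta>. (cmod (?c \<eta>))\<^sup>2)"
  proof (rule fin.integrable_const_bound[where B = "?I\<^sup>2"])
    show "AE \<eta> in \<rho>. norm ((cmod (?c \<eta>))\<^sup>2) \<le> ?I\<^sup>2"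
      using power_mono[OF check_transform_bound[of \<phi>] norm_ge_zero, of _ 2] by simp
  qed (rule sm)
  have "complex_of_real (LINT \<eta>|\<rho>. (cmod (?c \<eta>))\<^sup>2) = (LINT \<eta>|\<rho>. complex_of_real ((cmod (?c \<eta>))\<^sup>2))"
    by (rule integral_complex_of_real[symmetric])
  also have "\<dots> = (LINT \<eta>|\<rho>. ?c \<eta> * cnj (?c \<eta>))" by (simp only: complex_norm_square)
  also have "\<dots> = (LINT t|mG. \<phi> t * (LINT \<eta>|\<rho>. char_apply \<eta> t * cnj (?c \<eta>)))"
    using check_transform_bound[of \<phi>]
    by (intro check_transform_Fubini[OF \<rho> \<phi> ccm, of ?I]) simp
  also have "\<dots> = (LINT t|mG. \<phi> t * (LINT s|mG. cnj (\<phi> s) * (LINT \<eta>|\<rho>. char_apply \<eta> (t - s))))"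
  proof (intro Bochner_Integration.integral_cong refl arg_cong2[where f = "(*)"])
    fix t :: 'g
    have em: "(\<lambda>\<eta>. cnj (char_apply \<eta> t)) \<in> borel_measurable borel"
      by (intro borel_measurable_continuous_onI continuous_on_cnj evaluation_continuous2 continuous_intros)
    \<comment> \<open>The integral is conjugated so that the transform itself, not its conjugate,
      stands in front and the exchange lemma applies a second time.\<close>
    have "(LINT \<eta>|\<rho>. char_apply \<eta> t * cnj (?c \<eta>)) = (LINT \<eta>|\<rho>. cnj (?c \<eta> * cnj (char_apply \<eta> t)))"
      by (intro Bochner_Integration.integral_cong refl) (simp add: mult.commute)
    also have "\<dots> = cnj (LINT \<eta>|\<rho>. ?c \<eta> * cnj (char_apply \<eta> t))"
      by (rule Bochner_Integration.integral_cnj)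
    also have "(LINT \<eta>|\<rho>. ?c \<eta> * cnj (char_apply \<eta> t))
        = (LINT s|mG. \<phi> s * (LINT \<eta>|\<rho>. char_apply \<eta> s * cnj (char_apply \<eta> t)))"
      by (rule check_transform_Fubini[OF \<rho> \<phi> em, of 1]) simp
    also have "cnj \<dots> = (LINT s|mG. cnj (\<phi> s * (LINT \<eta>|\<rho>. char_apply \<eta> s * cnj (char_apply \<eta> t))))"
      by (rule Bochner_Integration.integral_cnj[symmetric])
    also have "\<dots> = (LINT s|mG. cnj (\<phi> s) * (LINT \<eta>|\<rho>. char_apply \<eta> (t - s)))"
    proof (intro Bochner_Integration.integral_cong refl)
      fix s
      have "cnj (LINT \<eta>|\<rho>. char_apply \<eta> s * cnj (char_apply \<eta> t)) = (LINT \<eta>|\<rho>. cnj (char_apply \<eta> s * cnj (char_apply \<eta> t)))"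
        by (rule Bochner_Integration.integral_cnj[symmetric])
      also have "\<dots> = (LINT \<eta>|\<rho>. char_apply \<eta> (t - s))"
        by (intro Bochner_Integration.integral_cong refl) (simp add: char_diff mult.commute)
      finally show "cnj (\<phi> s * (LINT \<eta>|\<rho>. char_apply \<eta> s * cnj (char_apply \<eta> t)))
          = cnj (\<phi> s) * (LINT \<eta>|\<rho>. char_apply \<eta> (t - s))" by (simp only: complex_cnj_mult)
    qed
    finally show "(LINT \<eta>|\<rho>. char_apply \<eta> t * cnj (?c \<eta>))
        = (LINT s|mG. cnj (\<phi> s) * (LINT \<eta>|\<rho>. char_apply \<eta> (t - s)))" .
  qed
  finally show "complex_of_real (LINT \<eta>|\<rho>. (cmod (?c \<eta>))\<^sup>2)
      = sesquilinear_form (\<lambda>t. LINT \<eta>|\<rho>. char_apply \<eta> t) \<phi> \<phi>"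
    unfolding sesquilinear_form_def .
qed

text \<open>A compact \<open>L\<close> carries all of \<open>\<rho>\<close> except mass
  \<open>e / 4\<close>. On \<open>L\<close> characters vary equicontinuously; off \<open>L\<close>
  the trivial bound 2 suffices.\<close>

lemma inverse_transform_continuous:
  fixes \<rho> :: "'g dual measure"
  assumes \<rho>: "radon_measure \<rho>" "finite_measure \<rho>"
  shows "continuous_on UNIV (\<lambda>t :: 'g. LINT \<eta>|\<rho>. char_apply \<eta> t)"
  unfolding continuous_on_def
proof (intro ballI tendstoI)
  interpret fin: finite_measure \<rho> by (rule \<rho>(2))
  fix t :: 'g and e :: real assume e: "e > 0"
  have sp: "space \<rho> = UNIV" by (rule radon_space[OF \<rho>(1)])
  have finU: "emeasure \<rho> UNIV < \<infinity>" by (simp add: less_top[symmetric])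
  have "e / 4 > 0" using e by simp
  from radon_compact_approx[OF \<rho>(1) open_UNIV finU this] obtain L where L: "compact L"
    "emeasure \<rho> (UNIV - L) < ennreal (e / 4)" by metis
  have Ls: "UNIV - L \<in> sets \<rho>" using L(1) sets.compl_sets[of L \<rho>] sp
    by (simp add: radon_sets[OF \<rho>(1)] compact_imp_closed)
  have Lm: "measure \<rho> (UNIV - L) < e / 4"
    using L(2) e by (simp add: fin.emeasure_eq_measure ennreal_less_iff)
  \<comment> \<open>Chosen so that \<open>L\<close> contributes at most \<open>e / 2\<close>; its
    complement contributes less than \<open>2 * (e / 4)\<close>.\<close>
  define d where "d = e / (2 * (measure \<rho> UNIV + 1))"
  have p: "measure \<rho> UNIV + 1 > 0" by (simp add: add_nonneg_pos)
  then have "d > 0" using e by (simp add: d_def)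
  from equicontinuous_on_compact[OF evaluation_continuous L(1) this, of t]
  obtain U where U: "open U" "t \<in> U" "\<And>s \<eta>. s \<in> U \<Longrightarrow> \<eta> \<in> L \<Longrightarrow> cmod (char_apply \<eta> s - char_apply \<eta> t) \<le> d"
    by (auto simp: dist_norm)
  have ei: "integrable \<rho> (\<lambda>\<eta>. char_apply \<eta> s)" for s :: 'g
  proof (rule fin.integrable_const_bound[where B = 1])
    have "(\<lambda>\<eta>. char_apply \<eta> s) \<in> borel_measurable borel"
      by (intro borel_measurable_continuous_onI evaluation_continuous2 continuous_intros)
    then show "(\<lambda>\<eta>. char_apply \<eta> s) \<in> borel_measurable \<rho>" by (simp only: radon_measurable[OF \<rho>(1)])
  qed simp
  have "dist (LINT \<eta>|\<rho>. char_apply \<eta> s) (LINT \<eta>|\<rho>. char_apply \<eta> t) < e" if s: "s \<in> U" for s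
  proof -
    have Li: "integrable \<rho> (\<lambda>\<eta>. d + 2 * indicator (UNIV - L) \<eta>)"
      using Ls fin.emeasure_finite[of "UNIV - L"]
      by (intro Bochner_Integration.integrable_add fin.integrable_const integrable_mult_right integrable_real_indicator)
        (auto simp: less_top[symmetric])
    have "dist (LINT \<eta>|\<rho>. char_apply \<eta> s) (LINT \<eta>|\<rho>. char_apply \<eta> t)
        = cmod (LINT \<eta>|\<rho>. char_apply \<eta> s - char_apply \<eta> t)"
      unfolding dist_norm by (simp only: Bochner_Integration.integral_diff[OF ei ei])
    also have "\<dots> \<le> (LINT \<eta>|\<rho>. cmod (char_apply \<eta> s - char_apply \<eta> t))" by (rule integral_norm_bound)
    also have "\<dots> \<le> (LINT \<eta>|\<rho>. d + 2 * indicator (UNIV - L) \<eta>)"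
    proof (rule integral_mono[OF _ Li])
      show "integrable \<rho> (\<lambda>\<eta>. cmod (char_apply \<eta> s - char_apply \<eta> t))"
        by (intro integrable_norm Bochner_Integration.integrable_diff ei)
      fix \<eta>
      show "cmod (char_apply \<eta> s - char_apply \<eta> t) \<le> d + 2 * indicator (UNIV - L) \<eta>"
      proof (cases "\<eta> \<in> L")
        case True
        then show ?thesis using U(3)[OF s] by simp
      next
        case False
        have "cmod (char_apply \<eta> s - char_apply \<eta> t) \<le> 2"
          using norm_triangle_ineq4[of "char_apply \<eta> s" "char_apply \<eta> t"] by simp
        then show ?thesis using False \<open>d > 0\<close> by simp
      qed
    qed
    also have "\<dots> = d * measure \<rho> UNIV + 2 * measure \<rho> (UNIV - L)"
      using Ls fin.emeasure_finite[of "UNIV - L"] sp by (subst Bochner_Integration.integral_add) (auto simp: less_top[symmetric])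
    also have "\<dots> < e"
    proof -
      have "d * measure \<rho> UNIV \<le> e / 2" using e p by (simp add: d_def field_simps)
      then show ?thesis using Lm by linarith
    qed
    finally show ?thesis .
  qed
  then show "\<forall>\<^sub>F s in at t within UNIV. dist (LINT \<eta>|\<rho>. char_apply \<eta> s) (LINT \<eta>|\<rho>. char_apply \<eta> t) < e"
    unfolding eventually_at_topological using U by (intro exI[of _ U]) simp
qed

text \<open>Over the product measure the form is a single integral of an integrable function, so
  differences and expansions become pointwise algebra.\<close>

lemma sesquilinear_form_pair:
  assumes c: "continuous_on UNIV c" and \<phi>: "\<phi> \<in> Cc" and \<psi>: "\<psi> \<in> Cc"
  shows "integrable (mG \<Otimes>\<^sub>M mG) (\<lambda>p. \<phi> (fst p) * (cnj (\<psi> (snd p)) * c (fst p - snd p)))"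
    and "sesquilinear_form c \<phi> \<psi>
      = integral\<^sup>L (mG \<Otimes>\<^sub>M mG) (\<lambda>p. \<phi> (fst p) * (cnj (\<psi> (snd p)) * c (fst p - snd p)))"
    and "integrable mG (\<lambda>t. \<phi> t * (LINT s|mG. cnj (\<psi> s) * c (t - s)))"
proof -
  interpret pair_sigma_finite mG mG by (rule pair_sigma_finite_mG)
  from \<phi> obtain K where K: "continuous_on UNIV \<phi>" "compact K" "\<And>t. t \<notin> K \<Longrightarrow> \<phi> t = 0"
    by (rule CcE) blast
  from \<psi> obtain L where L: "continuous_on UNIV \<psi>" "compact L" "\<And>t. t \<notin> L \<Longrightarrow> \<psi> t = 0"
    by (rule CcE) blast
  let ?F = "\<lambda>p. \<phi> (fst p) * (cnj (\<psi> (snd p)) * c (fst p - snd p))"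
  have cont: "continuous_on UNIV ?F"
    by (intro continuous_intros continuous_on_compose2[OF K(1)] continuous_on_compose2[OF L(1)]
      continuous_on_compose2[OF c]) auto
  show i: "integrable (mG \<Otimes>\<^sub>M mG) ?F"
    by (rule integrable_pair[OF cont K(2) L(2)]) (use K(3) L(3) in \<open>auto simp: mem_Times_iff\<close>)
  show "sesquilinear_form c \<phi> \<psi> = integral\<^sup>L (mG \<Otimes>\<^sub>M mG) ?F"
    unfolding sesquilinear_form_def using integral_fst'[OF i] by simp
  show "integrable mG (\<lambda>t. \<phi> t * (LINT s|mG. cnj (\<psi> s) * c (t - s)))"
    using integrable_fst'[OF i] by simp
qed

lemma sesquilinear_form_diff:
  assumes "continuous_on UNIV c" "continuous_on UNIV d" "\<phi> \<in> Cc" "\<psi> \<in> Cc"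
  shows "sesquilinear_form (\<lambda>t. c t - d t) \<phi> \<psi> = sesquilinear_form c \<phi> \<psi> - sesquilinear_form d \<phi> \<psi>"
proof -
  have cd: "continuous_on UNIV (\<lambda>t. c t - d t)" by (intro continuous_intros assms)
  show ?thesis
    unfolding sesquilinear_form_pair(2)[OF cd assms(3,4)] sesquilinear_form_pair(2)[OF assms(1,3,4)]
      sesquilinear_form_pair(2)[OF assms(2,3,4)]
      Bochner_Integration.integral_diff[OF sesquilinear_form_pair(1)[OF assms(1,3,4)]
        sesquilinear_form_pair(1)[OF assms(2,3,4)], symmetric]
    by (intro Bochner_Integration.integral_cong refl) (simp add: algebra_simps)
qed

lemma sesquilinear_form_expand:
  assumes c: "continuous_on UNIV c" and \<phi>: "\<phi> \<in> Cc" and \<psi>: "\<psi> \<in> Cc"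
  shows "sesquilinear_form c (\<lambda>t. \<phi> t + z * \<psi> t) (\<lambda>t. \<phi> t + z * \<psi> t)
    = sesquilinear_form c \<phi> \<phi> + cnj z * sesquilinear_form c \<phi> \<psi>
      + z * sesquilinear_form c \<psi> \<phi> + z * cnj z * sesquilinear_form c \<psi> \<psi>"
proof -
  have s: "(\<lambda>t. \<phi> t + z * \<psi> t) \<in> Cc" by (intro Cc_add Cc_cmult \<phi> \<psi>)
  let ?P = "\<lambda>\<phi> \<psi> p. \<phi> (fst p) * (cnj (\<psi> (snd p)) * c (fst p - snd p))"
  note I = sesquilinear_form_pair(1)[OF c] and E = sesquilinear_form_pair(2)[OF c]
  have "?P (\<lambda>t. \<phi> t + z * \<psi> t) (\<lambda>t. \<phi> t + z * \<psi> t)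
     = (\<lambda>p. ?P \<phi> \<phi> p + cnj z * ?P \<phi> \<psi> p + z * ?P \<psi> \<phi> p + z * cnj z * ?P \<psi> \<psi> p)"
    by (rule ext) (simp add: algebra_simps)
  then show ?thesis
    unfolding E[OF s s] E[OF \<phi> \<phi>] E[OF \<phi> \<psi>] E[OF \<psi> \<phi>] E[OF \<psi> \<psi>]
    by (simp only:) (simp add: I \<phi> \<psi>)
qed

lemma sesquilinear_form_polarization:
  assumes c: "continuous_on UNIV c" and zero: "\<And>\<phi>. \<phi> \<in> Cc \<Longrightarrow> sesquilinear_form c \<phi> \<phi> = 0"
    and \<phi>: "\<phi> \<in> Cc" and \<psi>: "\<psi> \<in> Cc"
  shows "sesquilinear_form c \<phi> \<psi> = 0"
proof -
  have *: "cnj z * sesquilinear_form c \<phi> \<psi> + z * sesquilinear_form c \<psi> \<phi> = 0" for z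
    using sesquilinear_form_expand[OF c \<phi> \<psi>, of z] zero[OF \<phi>] zero[OF \<psi>]
      zero[OF Cc_add[OF \<phi> Cc_cmult[OF \<psi>]], of z] by simp
  \<comment> \<open>The value \<open>z = 1\<close> shows that exchanging the arguments changes the
    sign; \<open>z = \<i>\<close> then says that \<open>- 2 * \<i>\<close> times the form is
    0.\<close>
  from *[of 1] have 1: "sesquilinear_form c \<psi> \<phi> = - sesquilinear_form c \<phi> \<psi>"
    by (simp add: eq_neg_iff_add_eq_0 add.commute)
  from *[of \<i>] have "- \<i> * sesquilinear_form c \<phi> \<psi> + \<i> * (- sesquilinear_form c \<phi> \<psi>) = 0"
    unfolding 1 by simp
  then show ?thesis by simp
qed

lemma difference_nhd:
  assumes "open W" "(0::'g) \<in> W"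
  obtains U where "open U" "0 \<in> U" "\<And>u v. u \<in> U \<Longrightarrow> v \<in> U \<Longrightarrow> u - v \<in> W"
proof -
  have "continuous_on UNIV (\<lambda>p::'g \<times> 'g. fst p - snd p)" by (intro continuous_intros)
  from open_vimage[OF assms(1) this] have "open ((\<lambda>p::'g \<times> 'g. fst p - snd p) -` W)" .
  moreover have "(0, 0) \<in> (\<lambda>p::'g \<times> 'g. fst p - snd p) -` W" using assms(2) by simp
  ultimately obtain A B where AB: "open A" "open B" "(0, 0) \<in> A \<times> B"
    "A \<times> B \<subseteq> (\<lambda>p::'g \<times> 'g. fst p - snd p) -` W" by (rule open_prod_elim)
  show thesis
  proof (rule that[of "A \<inter> B"])
    show "u - v \<in> W" if "u \<in> A \<inter> B" "v \<in> A \<inter> B" for u v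
    proof -
      have "(u, v) \<in> A \<times> B" using that by simp
      then have "(u, v) \<in> (\<lambda>p. fst p - snd p) -` W" using AB(4) by blast
      then show ?thesis by simp
    qed
  qed (use AB in auto)
qed

text \<open>With one bump near \<open>t0\<close> and another near 0, the form is a double weighted
  mean of values \<open>c (t - s)\<close> with \<open>t - s\<close> close to \<open>t0\<close>. It
  therefore differs from \<open>c t0\<close> by at most \<open>e\<close>, yet it is 0.\<close>

lemma sesquilinear_form_zero_imp:
  assumes c: "continuous_on UNIV c" and zero: "\<And>\<phi> \<psi>. \<phi> \<in> Cc \<Longrightarrow> \<psi> \<in> Cc \<Longrightarrow> sesquilinear_form c \<phi> \<psi> = 0"
  shows "c t0 = 0"
proof -
  have "cmod (c t0) \<le> e" if e: "e > 0" for e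
  proof -
    have "open (c -` ball (c t0) e)" by (rule open_vimage[OF open_ball c])
    from open_translation[OF this, of t0] have "open {w. t0 + w \<in> c -` ball (c t0) e}" .
    moreover have "0 \<in> {w. t0 + w \<in> c -` ball (c t0) e}" using e by simp
    ultimately obtain U where U: "open U" "0 \<in> U"
      "\<And>u v. u \<in> U \<Longrightarrow> v \<in> U \<Longrightarrow> u - v \<in> {w. t0 + w \<in> c -` ball (c t0) e}"
      by (rule difference_nhd) blast
    obtain r where r: "(\<lambda>t. complex_of_real (r t)) \<in> Cc" "\<And>t. r t \<ge> 0"
      "\<And>t. t \<notin> U \<Longrightarrow> r t = 0" "integrable mG r" "(LINT t|mG. r t) = 1"
      using bump_function[OF U(1,2)] by auto
    \<comment> \<open>The same bump in both slots, moved to \<open>t0\<close> in the first only;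
      \<open>U\<close> was chosen so that differences of its elements stay small.\<close>
    have \<phi>: "(\<lambda>t. complex_of_real (r (- t0 + t))) \<in> Cc" by (rule Cc_translate[OF r(1)])
    have "integrable mG (\<lambda>t. Re (complex_of_real (r (- t0 + t))))"
      by (intro integrable_Re Cc_integrable radon \<phi>)
    then have \<phi>i: "integrable mG (\<lambda>t. r (- t0 + t))" by simp
    have "(LINT t|mG. complex_of_real (r (- t0 + t))) = (LINT t|mG. complex_of_real (r t))"
      by (rule translation_invariant_integral[OF Cc_measurable[OF r(1)]])
    then have \<phi>1: "(LINT t|mG. r (- t0 + t)) = 1"
      using r(5) by (simp only: integral_complex_of_real of_real_eq_iff)
    have inner: "cmod ((LINT s|mG. complex_of_real (r s) * c (t - s)) - c t0) \<le> e" if t: "- t0 + t \<in> U" for t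
    proof (rule weighted_mean_bound[OF r(4,2,5)])
      show "integrable mG (\<lambda>s. complex_of_real (r s) * c (t - s))"
        by (intro Cc_integrable radon Cc_mult r(1) continuous_on_compose2[OF c] continuous_intros) auto
      fix s assume "r s \<noteq> 0"
      then have "s \<in> U" using r(3) by blast
      from U(3)[OF t this] have "c (t0 + (- t0 + t - s)) \<in> ball (c t0) e" by simp
      then show "cmod (c (t - s) - c t0) \<le> e" by (simp add: dist_norm norm_minus_commute)
    qed
    have "cmod ((LINT t|mG. complex_of_real (r (- t0 + t)) * (LINT s|mG. complex_of_real (r s) * c (t - s))) - c t0) \<le> e"
    proof (rule weighted_mean_bound[OF \<phi>i r(2) \<phi>1])
      show "integrable mG (\<lambda>t. complex_of_real (r (- t0 + t)) * (LINT s|mG. complex_of_real (r s) * c (t - s)))"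
        using sesquilinear_form_pair(3)[OF c \<phi> r(1)] by simp
      show "cmod ((LINT s|mG. complex_of_real (r s) * c (t - s)) - c t0) \<le> e" if "r (- t0 + t) \<noteq> 0" for t
        using inner r(3) that by blast
    qed
    moreover have "(LINT t|mG. complex_of_real (r (- t0 + t)) * (LINT s|mG. complex_of_real (r s) * c (t - s))) = 0"
      using zero[OF \<phi> r(1)] by (simp add: sesquilinear_form_def)
    ultimately show ?thesis by simp
  qed
  then have "cmod (c t0) \<le> 0" by (rule field_le_epsilon[of _ 0, simplified])
  then show ?thesis by simp
qed

section \<open>Finiteness and the two descriptions of the transform\<close>

text \<open>All characters in the compact set \<open>L\<close> are within 1/2 of 1 on a common
  neighbourhood of 0. For a bump supported there the transform, a mean of character values, is
  within 1/2 of 1 as well.\<close>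

lemma bump_check_transform:
  assumes L: "compact (L :: 'g dual set)"
  shows "\<exists>r :: 'g \<Rightarrow> real. (\<lambda>t. complex_of_real (r t)) \<in> Cc \<and> (\<forall>t. r t \<ge> 0) \<and> integrable mG r \<and>
    (LINT t|mG. r t) = 1 \<and> (\<forall>\<eta>\<in>L. cmod (check_transform mG (\<lambda>t. complex_of_real (r t)) \<eta>) \<ge> 1/2)"
proof -
  have "(1/2::real) > 0" by simp
  from equicontinuous_on_compact[OF evaluation_continuous L this, of 0]
  obtain U where U: "open U" "0 \<in> U" "\<And>s \<eta>. s \<in> U \<Longrightarrow> \<eta> \<in> L \<Longrightarrow> cmod (char_apply \<eta> s - 1) \<le> 1/2"
    by (auto simp: dist_norm)
  obtain r where r: "(\<lambda>t. complex_of_real (r t)) \<in> Cc" "\<And>t. r t \<ge> 0"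
    "\<And>t. t \<notin> U \<Longrightarrow> r t = 0" "integrable mG r" "(LINT t|mG. r t) = 1"
    using bump_function[OF U(1,2)] by auto
  have "cmod (check_transform mG (\<lambda>t. complex_of_real (r t)) \<eta>) \<ge> 1/2" if \<eta>: "\<eta> \<in> L" for \<eta>
  proof -
    have "cmod ((LINT t|mG. complex_of_real (r t) * char_apply \<eta> t) - 1) \<le> 1/2"
    proof (rule weighted_mean_bound[OF r(4,2,5)])
      show "integrable mG (\<lambda>t. complex_of_real (r t) * char_apply \<eta> t)"
        by (intro Cc_integrable radon Cc_mult r(1) char_continuous)
      show "cmod (char_apply \<eta> t - 1) \<le> 1/2" if "r t \<noteq> 0" for t
        using U(3)[OF _ \<eta>, of t] r(3)[of t] that by blast
    qed
    also have "(LINT t|mG. complex_of_real (r t) * char_apply \<eta> t) = check_transform mG (\<lambda>t. complex_of_real (r t)) \<eta>"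
      by (simp add: check_transform_def mult.commute)
    finally show ?thesis
      using norm_triangle_ineq3[of "check_transform mG (\<lambda>t. complex_of_real (r t)) \<eta>" 1] by simp
  qed
  with r show ?thesis by (intro exI[of _ r]) auto
qed

text \<open>Two weighted means in succession, with centre 0. The bound does not depend on the bump,
  which makes the estimate on compact sets of characters uniform.\<close>

lemma bounded_sesquilinear_form:
  assumes c: "continuous_on UNIV c" "\<And>t. cmod (c t) \<le> C"
    and r: "(\<lambda>t. complex_of_real (r t)) \<in> Cc" "\<And>t. r t \<ge> 0" "integrable mG r" "(LINT t|mG. r t) = 1"
  shows "cmod (sesquilinear_form c (\<lambda>t. complex_of_real (r t)) (\<lambda>t. complex_of_real (r t))) \<le> C"
proof -
  have inner: "cmod (LINT s|mG. complex_of_real (r s) * c (t - s)) \<le> C" for t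
  proof -
    have "cmod ((LINT s|mG. complex_of_real (r s) * c (t - s)) - 0) \<le> C"
    proof (rule weighted_mean_bound[OF r(3,2,4)])
      show "integrable mG (\<lambda>s. complex_of_real (r s) * c (t - s))"
        by (intro Cc_integrable radon Cc_mult r(1) continuous_on_compose2[OF c(1)] continuous_intros) auto
    qed (simp add: c(2))
    then show ?thesis by simp
  qed
  have "cmod ((LINT t|mG. complex_of_real (r t) * (LINT s|mG. complex_of_real (r s) * c (t - s))) - 0) \<le> C"
  proof (rule weighted_mean_bound[OF r(3,2,4)])
    show "integrable mG (\<lambda>t. complex_of_real (r t) * (LINT s|mG. complex_of_real (r s) * c (t - s)))"
      using sesquilinear_form_pair(3)[OF c(1) r(1,1)] by simp
  qed (simp add: inner)
  then show ?thesis by (simp add: sesquilinear_form_def)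
qed

lemma finite_of_square_integrals:
  fixes \<mu> :: "'g dual measure"
  assumes \<mu>: "radon_measure \<mu>" and c: "continuous_on UNIV c" "\<And>t. cmod (c t) \<le> C"
    and int: "\<And>\<phi>. \<phi> \<in> Cc \<Longrightarrow> integrable \<mu> (\<lambda>\<eta>. (cmod (check_transform mG \<phi> \<eta>))\<^sup>2)"
    and eq: "\<And>\<phi>. \<phi> \<in> Cc \<Longrightarrow> sesquilinear_form c \<phi> \<phi> =
      complex_of_real (LINT \<eta>|\<mu>. (cmod (check_transform mG \<phi> \<eta>))\<^sup>2)"
  shows "finite_measure \<mu>"
proof
  have sp: "space \<mu> = UNIV" by (rule radon_space[OF \<mu>])
  \<comment> \<open>The squared transform is at least \<open>(1/2)\<^sup>2\<close> on
    \<open>L\<close>, so a quarter of the mass of \<open>L\<close> is at most the form and hence at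
    most \<open>C\<close>.\<close>
  have bound: "emeasure \<mu> L \<le> ennreal (4 * C)" if L: "compact L" for L
  proof -
    have Ls: "L \<in> sets \<mu>" and Lf: "emeasure \<mu> L < \<infinity>"
      using L radon_finite[OF \<mu> L] by (auto simp: radon_sets[OF \<mu>] compact_imp_closed)
    obtain r where r: "(\<lambda>t. complex_of_real (r t)) \<in> Cc" "\<And>t. r t \<ge> 0" "integrable mG r"
      "(LINT t|mG. r t) = 1" "\<And>\<eta>. \<eta> \<in> L \<Longrightarrow> cmod (check_transform mG (\<lambda>t. complex_of_real (r t)) \<eta>) \<ge> 1/2"
      using bump_check_transform[OF L] by auto
    let ?c = "check_transform mG (\<lambda>t. complex_of_real (r t))"
    have "measure \<mu> L * (1/4) = (LINT \<eta>|\<mu>. indicator L \<eta> * (1/4::real))"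
      using Ls Lf by simp
    also have "\<dots> \<le> (LINT \<eta>|\<mu>. (cmod (?c \<eta>))\<^sup>2)"
    proof (rule integral_mono[OF _ int[OF r(1)]])
      show "integrable \<mu> (\<lambda>\<eta>. indicator L \<eta> * (1/4::real))" using Ls Lf by simp
      fix \<eta>
      show "indicator L \<eta> * (1/4::real) \<le> (cmod (?c \<eta>))\<^sup>2"
      proof (cases "\<eta> \<in> L")
        case True
        have "(1/2::real)\<^sup>2 \<le> (cmod (?c \<eta>))\<^sup>2" by (rule power_mono[OF r(5)[OF True]]) simp
        then show ?thesis using True by (simp add: power2_eq_square)
      qed simp
    qed
    also have "\<dots> = cmod (complex_of_real (LINT \<eta>|\<mu>. (cmod (?c \<eta>))\<^sup>2))"
      by (simp add: integral_nonneg_AE)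
    also have "\<dots> = cmod (sesquilinear_form c (\<lambda>t. complex_of_real (r t)) (\<lambda>t. complex_of_real (r t)))"
      by (simp only: eq[OF r(1)])
    also have "\<dots> \<le> C" by (rule bounded_sesquilinear_form[OF c r(1-4)])
    finally have "measure \<mu> L \<le> 4 * C" by simp
    then show ?thesis using Lf by (simp add: emeasure_eq_ennreal_measure ennreal_leI)
  qed
  \<comment> \<open>The whole dual is open, so inner regularity passes from the uniform bound on
    compact sets to the total mass.\<close>
  have "\<forall>U. open U \<longrightarrow> emeasure \<mu> U = (SUP K\<in>{K. compact K \<and> K \<subseteq> U}. emeasure \<mu> K)"
    using \<mu> unfolding radon_measure_def by (elim conjE)
  then have "emeasure \<mu> UNIV = (SUP K\<in>{K. compact K \<and> K \<subseteq> UNIV}. emeasure \<mu> K)"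
    by (rule allE[of _ UNIV]) simp
  also have "\<dots> \<le> ennreal (4 * C)" by (rule SUP_least) (use bound in auto)
  also have "\<dots> < \<infinity>" by simp
  finally show "emeasure \<mu> (space \<mu>) \<noteq> \<infinity>" by (simp add: sp)
qed

lemma transform_characterization:
  fixes \<mu> :: "'g dual measure"
  assumes c: "continuous_on UNIV c" "\<And>t. cmod (c t) \<le> C"
  shows "(radon_measure \<mu> \<and> (\<forall>\<phi>\<in>Cc. integrable \<mu> (\<lambda>\<eta>. (cmod (check_transform mG \<phi> \<eta>))\<^sup>2) \<and>
           sesquilinear_form c \<phi> \<phi> = complex_of_real (LINT \<eta>|\<mu>. (cmod (check_transform mG \<phi> \<eta>))\<^sup>2)))
    \<longleftrightarrow> radon_measure \<mu> \<and> finite_measure \<mu> \<and> (\<forall>t. c t = (LINT \<eta>|\<mu>. char_apply \<eta> t))"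
    (is "?L \<longleftrightarrow> ?R")
proof
  assume ?L
  then have \<mu>: "radon_measure \<mu>"
    and int: "\<And>\<phi>. \<phi> \<in> Cc \<Longrightarrow> integrable \<mu> (\<lambda>\<eta>. (cmod (check_transform mG \<phi> \<eta>))\<^sup>2)"
    and eq: "\<And>\<phi>. \<phi> \<in> Cc \<Longrightarrow> sesquilinear_form c \<phi> \<phi> =
      complex_of_real (LINT \<eta>|\<mu>. (cmod (check_transform mG \<phi> \<eta>))\<^sup>2)"
    by auto
  \<comment> \<open>Finiteness has to come first: without it the inverse transform of
    \<open>\<mu>\<close> would not be known to be a continuous function comparable with
    \<open>c\<close>.\<close>
  have fin: "finite_measure \<mu>" by (rule finite_of_square_integrals[OF \<mu> c int eq])
  let ?d = "\<lambda>t. LINT \<eta>|\<mu>. char_apply \<eta> t"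
  have d: "continuous_on UNIV ?d" by (rule inverse_transform_continuous[OF \<mu> fin])
  have cd: "continuous_on UNIV (\<lambda>t. c t - ?d t)" by (intro continuous_intros c d)
  have "sesquilinear_form (\<lambda>t. c t - ?d t) \<phi> \<phi> = 0" if "\<phi> \<in> Cc" for \<phi>
    unfolding sesquilinear_form_diff[OF c(1) d that that] eq[OF that]
      check_transform_square_integral(2)[OF \<mu> fin that] by simp
  from sesquilinear_form_polarization[OF cd this]
  have "c t - ?d t = 0" for t by (rule sesquilinear_form_zero_imp[OF cd])
  then show ?R using \<mu> fin by simp
next
  assume R: ?R
  then have "c = (\<lambda>t. LINT \<eta>|\<mu>. char_apply \<eta> t)" by (intro ext) blast
  with R show ?L using check_transform_square_integral[of \<mu>] by simp
qed

section \<open>The functional with a continuous density\<close>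

text \<open>Two substitutions: the reflection of \<open>s\<close> removes the sign introduced by
  \<open>tilde\<close>, and the shift \<open>u = t - s\<close> turns the density \<open>c u\<close>
  into \<open>c (t - s)\<close>. The order of integration is exchanged to make the shift for fixed
  \<open>s\<close> and exchanged back afterwards.\<close>

lemma sesquilinear_form_convolution:
  assumes c: "continuous_on UNIV c" and \<phi>: "\<phi> \<in> Cc" and \<psi>: "\<psi> \<in> Cc"
  shows "(LINT u|mG. group_convolution mG \<phi> (tilde \<psi>) u * c u) = sesquilinear_form c \<phi> \<psi>"
proof -
  from \<phi> obtain K where K: "continuous_on UNIV \<phi>" "compact K" "\<And>t. t \<notin> K \<Longrightarrow> \<phi> t = 0"
    by (rule CcE) blast
  from \<psi> obtain L where L: "continuous_on UNIV \<psi>" "compact L" "\<And>t. t \<notin> L \<Longrightarrow> \<psi> t = 0"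
    by (rule CcE) blast
  let ?KL = "(\<lambda>(x, y). x - y) ` (K \<times> L)"
  have inner1: "group_convolution mG \<phi> (tilde \<psi>) u = (LINT s|mG. \<phi> (u + s) * cnj (\<psi> s))" for u
  proof -
    have "(\<lambda>s. \<phi> (u + s) * cnj (\<psi> s)) \<in> Cc"
      by (rule CcI[OF _ L(2)])
        (use L(3) in \<open>auto intro!: continuous_intros continuous_on_compose2[OF K(1)] L(1)\<close>)
    from reflection_invariant_integral[OF this] show ?thesis
      by (simp add: group_convolution_def tilde_def)
  qed
  \<comment> \<open>For fixed \<open>s\<close>, invariance under translation by \<open>- s\<close>
    replaces \<open>u + s\<close> by \<open>t\<close>.\<close>
  have inner2: "(LINT u|mG. \<phi> (u + s) * cnj (\<psi> s) * c u) = (LINT t|mG. \<phi> t * (cnj (\<psi> s) * c (t - s)))" for s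
  proof -
    have "continuous_on UNIV (\<lambda>u. \<phi> (u + s) * cnj (\<psi> s) * c u)"
      by (intro continuous_intros continuous_on_compose2[OF K(1)] c) auto
    from translation_invariant_integral[OF borel_measurable_continuous_onI[OF this], of "- s"]
    show ?thesis by (simp add: mult.assoc)
  qed
  have c1: "continuous_on UNIV (\<lambda>p. \<phi> (fst p + snd p) * cnj (\<psi> (snd p)) * c (fst p))"
    by (intro continuous_intros continuous_on_compose2[OF K(1)] continuous_on_compose2[OF L(1)]
      continuous_on_compose2[OF c]) auto
  have z1: "\<phi> (fst p + snd p) * cnj (\<psi> (snd p)) * c (fst p) = 0" if "p \<notin> ?KL \<times> L" for p
  proof (rule ccontr)
    assume "\<phi> (fst p + snd p) * cnj (\<psi> (snd p)) * c (fst p) \<noteq> 0"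
    then have "fst p + snd p \<in> K" "snd p \<in> L" using K(3) L(3) by force+
    moreover have "fst p = (fst p + snd p) - snd p" by simp
    ultimately have "fst p \<in> ?KL" by (metis (mono_tags, lifting) SigmaI case_prod_conv rev_image_eqI)
    with \<open>snd p \<in> L\<close> that show False by (simp add: mem_Times_iff)
  qed
  have c2: "continuous_on UNIV (\<lambda>p. \<phi> (fst p) * (cnj (\<psi> (snd p)) * c (fst p - snd p)))"
    by (intro continuous_intros continuous_on_compose2[OF K(1)] continuous_on_compose2[OF L(1)]
      continuous_on_compose2[OF c]) auto
  have z2: "\<phi> (fst p) * (cnj (\<psi> (snd p)) * c (fst p - snd p)) = 0" if "p \<notin> K \<times> L" for p
    using that K(3) L(3) by (auto simp: mem_Times_iff)
  have "(LINT u|mG. group_convolution mG \<phi> (tilde \<psi>) u * c u)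
      = (LINT u|mG. LINT s|mG. \<phi> (u + s) * cnj (\<psi> s) * c u)"
    unfolding inner1 by (simp only: integral_mult_left_zero)
  also have "\<dots> = (LINT s|mG. LINT u|mG. \<phi> (u + s) * cnj (\<psi> s) * c u)"
    using Cc_Fubini[OF c1 compact_diffs[OF K(2) L(2)] L(2) z1] by simp
  also have "\<dots> = (LINT s|mG. LINT t|mG. \<phi> t * (cnj (\<psi> s) * c (t - s)))" unfolding inner2 ..
  also have "\<dots> = (LINT t|mG. LINT s|mG. \<phi> t * (cnj (\<psi> s) * c (t - s)))"
    using Cc_Fubini[OF c2 K(2) L(2) z2] by simp
  also have "\<dots> = sesquilinear_form c \<phi> \<psi>"
    unfolding sesquilinear_form_def by (simp only: integral_mult_right_zero)
  finally show ?thesis .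
qed

lemma density_complex_measure:
  assumes c: "continuous_on UNIV c" "\<And>t. cmod (c t) \<le> C"
  shows "complex_measure (restrict (\<lambda>\<phi>. LINT u|mG. \<phi> u * c u) Cc)"
  unfolding complex_measure_def
proof (intro conjI ballI allI impI)
  let ?\<gamma> = "restrict (\<lambda>\<phi>. LINT u|mG. \<phi> u * c u) Cc"
  have i: "integrable mG (\<lambda>u. \<phi> u * c u)" if "\<phi> \<in> Cc" for \<phi>
    by (intro Cc_integrable radon Cc_mult that c)
  show "?\<gamma> \<in> extensional Cc" by (rule restrict_extensional)
  show "?\<gamma> (\<lambda>t. \<phi> t + \<psi> t) = ?\<gamma> \<phi> + ?\<gamma> \<psi>" if "\<phi> \<in> Cc" "\<psi> \<in> Cc" for \<phi> \<psi>
    using i[OF that(1)] i[OF that(2)] that by (simp add: Cc_add distrib_right)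
  show "?\<gamma> (\<lambda>t. z * \<phi> t) = z * ?\<gamma> \<phi>" if "\<phi> \<in> Cc" for z \<phi>
    using that by (simp add: Cc_cmult mult.assoc)
  fix K :: "'g set" assume K: "compact K"
  have C: "C \<ge> 0" using c(2)[of 0] norm_ge_zero[of "c 0"] by linarith
  have Ks: "K \<in> sets mG" using K by (simp add: sets_mG compact_imp_closed)
  show "\<exists>B. \<forall>\<phi>\<in>Cc. {t. \<phi> t \<noteq> 0} \<subseteq> K \<longrightarrow> cmod (?\<gamma> \<phi>) \<le> B * (SUP t. cmod (\<phi> t))"
  proof (intro exI[of _ "C * measure mG K"] ballI impI)
    fix \<phi> :: "'g \<Rightarrow> complex" assume \<phi>: "\<phi> \<in> Cc" and sub: "{t. \<phi> t \<noteq> 0} \<subseteq> K"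
    obtain B where B: "\<And>t. cmod (\<phi> t) \<le> B" by (rule Cc_bounded[OF \<phi>]) blast
    let ?S = "SUP t. cmod (\<phi> t)"
    have S: "cmod (\<phi> t) \<le> ?S" for t
      by (rule cSUP_upper[OF UNIV_I bdd_aboveI2[of UNIV _ B]]) (rule B)
    have "cmod (?\<gamma> \<phi>) = cmod (LINT u|mG. \<phi> u * c u)" using \<phi> by simp
    also have "\<dots> \<le> (LINT u|mG. cmod (\<phi> u * c u))" by (rule integral_norm_bound)
    also have "\<dots> \<le> (LINT u|mG. indicator K u * (?S * C))"
    proof (rule integral_mono)
      show "integrable mG (\<lambda>u. cmod (\<phi> u * c u))" by (intro integrable_norm i \<phi>)
      show "integrable mG (\<lambda>u. indicator K u * (?S * C))"
        using Ks radon_finite[OF radon K] by (intro integrable_mult_left integrable_real_indicator) auto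
      fix u
      show "cmod (\<phi> u * c u) \<le> indicator K u * (?S * C)"
      proof (cases "u \<in> K")
        case True
        have "cmod (\<phi> u) * cmod (c u) \<le> ?S * C"
          by (rule mult_mono[OF S c(2) order_trans[OF norm_ge_zero S] norm_ge_zero])
        then show ?thesis using True by (simp add: norm_mult)
      next
        case False
        then have "\<phi> u = 0" using sub by blast
        then show ?thesis using False by simp
      qed
    qed
    also have "\<dots> = C * measure mG K * ?S"
      using Ks by (subst integral_mult_left_zero) simp
    finally show "cmod (?\<gamma> \<phi>) \<le> C * measure mG K * ?S" .
  qed
qed

end

section \<open>Dynamical systems\<close>

locale lca_dynamics = lca_group mG
  for mG :: "'g::{topological_ab_group_add, t2_space} measure" +
  fixes \<alpha> :: "'g \<Rightarrow> 'x::t2_space \<Rightarrow> 'x" and m :: "'x measure"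
  assumes dynamics: "dynamical_system \<alpha> m"
begin

lemma m_radon: "radon_measure m"
  and m_prob: "prob_space m"
  and compact_space: "compact (UNIV :: 'x set)"
  and continuous_action: "continuous_on UNIV (\<lambda>(t, x). \<alpha> t x)"
  and action_zero: "\<alpha> 0 x = x"
  and action_add: "\<alpha> (s + t) x = \<alpha> s (\<alpha> t x)"
  and invariant: "distr m borel (\<alpha> t) = m"
  using dynamics unfolding dynamical_system_def by simp_all

lemma m_finite: "finite_measure m"
  using m_prob by (rule prob_space.finite_measure)

lemma sets_m: "sets m = sets borel"
  by (rule radon_sets[OF m_radon])

lemma space_m [simp]: "space m = UNIV"
  by (rule radon_space[OF m_radon])

lemma measurable_m: "measurable m N = measurable borel N"
  by (rule measurable_cong_sets[OF sets_m refl])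

lemma continuous_action2:
  assumes "continuous_on A u" "continuous_on A v"
  shows "continuous_on A (\<lambda>p. \<alpha> (u p) (v p))"
proof -
  have "continuous_on A (\<lambda>p. case (u p, v p) of (t, x) \<Rightarrow> \<alpha> t x)"
    by (rule continuous_on_compose2[OF continuous_action continuous_on_Pair[OF assms]]) simp
  then show ?thesis by simp
qed

lemma action_measurable: "\<alpha> t \<in> measurable m borel"
  unfolding measurable_m
  by (intro borel_measurable_continuous_onI continuous_action2 continuous_intros)

lemma action_integral:
  fixes F :: "'x \<Rightarrow> 'b::{banach, second_countable_topology}"
  assumes "F \<in> borel_measurable m"
  shows "(LINT x|m. F (\<alpha> t x)) = (LINT x|m. F x)"
proof -
  have F: "F \<in> borel_measurable borel" using assms by (simp add: measurable_m)
  have "(LINT x|m. F x) = integral\<^sup>L (distr m borel (\<alpha> t)) F" by (simp only: invariant)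
  also have "\<dots> = (LINT x|m. F (\<alpha> t x))" by (rule integral_distr[OF action_measurable F])
  finally show ?thesis ..
qed

lemma action_integrable:
  fixes F :: "'x \<Rightarrow> 'b::{banach, second_countable_topology}"
  assumes "integrable m F"
  shows "integrable m (\<lambda>x. F (\<alpha> t x))"
proof -
  have "integrable (distr m borel (\<alpha> t)) F" using assms by (simp only: invariant)
  then show ?thesis by (rule integrable_distr[OF action_measurable])
qed

lemma translate_apply: "translate \<alpha> t f x = f (\<alpha> (- t) x)"
  by (simp add: translate_def)

lemma translate_L2:
  assumes "f \<in> L2 m"
  shows "translate \<alpha> t f \<in> L2 m"
proof -
  have "f \<in> borel_measurable borel" using L2_measurable[OF assms] by (simp add: measurable_m)
  from measurable_compose[OF action_measurable this]
  have "(\<lambda>x. f (\<alpha> (- t) x)) \<in> borel_measurable m" .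
  moreover have "integrable m (\<lambda>x. (cmod (f (\<alpha> (- t) x)))\<^sup>2)"
    by (rule action_integrable[OF L2_square_integrable[OF assms]])
  ultimately show ?thesis by (simp add: L2_def translate_apply[abs_def])
qed

lemma translate_translate: "translate \<alpha> s (translate \<alpha> t f) = translate \<alpha> (s + t) f"
proof
  fix x
  have "- (s + t) = - t + - s" by simp
  then show "translate \<alpha> s (translate \<alpha> t f) x = translate \<alpha> (s + t) f x"
    unfolding translate_apply by (simp only: action_add)
qed

lemma translate_inner:
  assumes "f \<in> L2 m" "g \<in> L2 m"
  shows "l2_inner m (translate \<alpha> t f) (translate \<alpha> t g) = l2_inner m f g"
  unfolding l2_inner_def translate_apply
  by (rule action_integral[of "\<lambda>x. f x * cnj (g x)"])
    (rule borel_measurable_integrable[OF l2_inner_integrable[OF assms]])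

lemma translate_norm:
  assumes "f \<in> L2 m"
  shows "l2_norm m (translate \<alpha> t f) = l2_norm m f"
  unfolding l2_norm_def translate_apply
  by (subst action_integral[of "\<lambda>x. (cmod (f x))\<^sup>2"])
    (auto intro: borel_measurable_integrable[OF L2_square_integrable[OF assms]])

section \<open>Strong continuity of the translations\<close>

text \<open>Strong continuity at 0 only, expressed through the seminorm on representatives; since
  translations are isometries, \<open>translate_inner_bound\<close> carries it to every other
  point.\<close>

definition continuous_orbit :: "('x \<Rightarrow> complex) \<Rightarrow> bool" where
  "continuous_orbit f \<longleftrightarrow> (\<forall>e>0. \<exists>W. open W \<and> 0 \<in> W \<and>
     (\<forall>t\<in>W. l2_norm m (\<lambda>x. translate \<alpha> t f x - f x) \<le> e))"

lemma continuous_orbitD: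
  assumes "continuous_orbit f" "e > 0"
  shows "\<exists>W. open W \<and> 0 \<in> W \<and> (\<forall>t\<in>W. l2_norm m (\<lambda>x. translate \<alpha> t f x - f x) \<le> e)"
  using assms by (simp add: continuous_orbit_def)

text \<open>Outer regularity is applied to \<open>B\<close> and to its complement. The complement of
  the second open set lies inside \<open>B\<close> and is compact because \<open>X\<close> is, which
  gives inner approximation of arbitrary Borel sets.\<close>

lemma regular_sandwich:
  assumes B: "B \<in> sets borel" and e: "e > (0::real)"
  shows "\<exists>K U. compact K \<and> open U \<and> K \<subseteq> B \<and> B \<subseteq> U \<and> measure m (U - K) \<le> e"
proof -
  interpret prob_space m by (rule m_prob)
  have outer: "\<exists>U. open U \<and> A \<subseteq> U \<and> measure m (U - A) \<le> e / 2" if A: "A \<in> sets borel" for A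
  proof -
    have reg: "\<forall>B \<in> sets borel. emeasure m B = (INF U\<in>{U. open U \<and> B \<subseteq> U}. emeasure m U)"
      using m_radon unfolding radon_measure_def by (elim conjE)
    have "emeasure m A = (INF U\<in>{U. open U \<and> A \<subseteq> U}. emeasure m U)" by (rule bspec[OF reg A])
    moreover have "emeasure m A < emeasure m A + ennreal (e / 2)"
      using e by (simp add: emeasure_eq_measure ennreal_less_iff flip: ennreal_plus)
    ultimately have "(INF U\<in>{U. open U \<and> A \<subseteq> U}. emeasure m U) < emeasure m A + ennreal (e / 2)" by simp
    then obtain U where U: "open U" "A \<subseteq> U" "emeasure m U < emeasure m A + ennreal (e / 2)"
      unfolding INF_less_iff by auto
    have "measure m U < measure m A + e / 2"
      using U(3) e by (simp add: emeasure_eq_measure ennreal_less_iff flip: ennreal_plus)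
    moreover have "measure m (U - A) = measure m U - measure m A"
      using U A by (intro finite_measure_Diff) (auto simp: sets_m)
    ultimately show ?thesis using U by auto
  qed
  obtain U where U: "open U" "B \<subseteq> U" "measure m (U - B) \<le> e / 2" using outer[OF B] by blast
  have "- B \<in> sets borel" using B by auto
  then obtain V where V: "open V" "- B \<subseteq> V" "measure m (V - - B) \<le> e / 2" using outer by blast
  show ?thesis
  proof (rule exI[of _ "- V"], rule exI[of _ U], intro conjI)
    have "compact (UNIV \<inter> - V)" using V(1) by (intro compact_Int_closed compact_space) auto
    then show "compact (- V)" by simp
    show "- V \<subseteq> B" using V(2) by blast
    have "U - - V \<subseteq> (U - B) \<union> (V - - B)" by blast
    then have "measure m (U - - V) \<le> measure m ((U - B) \<union> (V - - B))"
      using U V B by (intro finite_measure_mono) (auto simp: sets_m)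
    also have "\<dots> \<le> measure m (U - B) + measure m (V - - B)"
      using U V B by (intro measure_Un_le) (auto simp: sets_m)
    also have "\<dots> \<le> e" using U V by simp
    finally show "measure m (U - - V) \<le> e" .
  qed (use U in auto)
qed

lemma indicator_L2:
  assumes "B \<in> sets borel"
  shows "indicator B \<in> L2 m"
proof -
  interpret prob_space m by (rule m_prob)
  have B: "B \<in> sets m" using assms by (simp add: sets_m)
  have "(\<lambda>x. (cmod (indicator B x))\<^sup>2) = (indicator B :: 'x \<Rightarrow> real)"
    by (auto simp: indicator_def)
  then show ?thesis using B by (simp add: L2_def less_top[symmetric])
qed

text \<open>Sandwich \<open>B\<close> between a compact \<open>K\<close> and an open
  \<open>U\<close>. For small \<open>t\<close> the tube lemma keeps the moved \<open>K\<close>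
  inside \<open>U\<close>. If \<open>x\<close> and \<open>\<alpha> (- t) x\<close> disagree about
  \<open>B\<close>, one of them then lies in \<open>U - K\<close>, a set of small measure.\<close>

lemma continuous_orbit_indicator:
  assumes B: "B \<in> sets borel"
  shows "continuous_orbit (indicator B)"
  unfolding continuous_orbit_def
proof (intro allI impI)
  interpret prob_space m by (rule m_prob)
  fix e :: real assume e: "e > 0"
  \<comment> \<open>The set \<open>U - K\<close> is charged twice, at \<open>x\<close> and at the
    moved point, and the squared norm must not exceed \<open>e\<^sup>2\<close>.\<close>
  then have "e\<^sup>2 / 2 > 0" by simp
  from regular_sandwich[OF B this] obtain K U where
    KU: "compact K" "open U" "K \<subseteq> B" "B \<subseteq> U" "measure m (U - K) \<le> e\<^sup>2 / 2" by blast
  have "continuous_on UNIV (\<lambda>p. \<alpha> (- fst p) (snd p))"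
    by (intro continuous_action2 continuous_intros)
  from open_vimage[OF KU(2) this]
  have op: "open ((\<lambda>p. \<alpha> (- fst p) (snd p)) -` U)" .
  have "{0} \<times> K \<subseteq> (\<lambda>p. \<alpha> (- fst p) (snd p)) -` U"
    using KU(3,4) by (auto simp: action_zero)
  from Elementary_Topology.tube_lemma[OF KU(1) op this]
  obtain V where V: "0 \<in> V" "open V" "V \<times> K \<subseteq> (\<lambda>p. \<alpha> (- fst p) (snd p)) -` U"
    by (elim exE conjE)
  have VK: "\<alpha> (- t) x \<in> U" if "t \<in> V" "x \<in> K" for t x using V(3) that by auto
  \<comment> \<open>Symmetric, because the inclusion is used for \<open>t\<close> and, when the
    moved point lies in \<open>K\<close>, for \<open>- t\<close>.\<close>
  let ?W = "V \<inter> {s. - s \<in> V}"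
  have UK: "U - K \<in> sets m" using KU by (auto simp: sets_m compact_imp_closed)
  have BL2: "indicator B \<in> L2 m" by (rule indicator_L2[OF B])
  have "l2_norm m (\<lambda>x. translate \<alpha> t (indicator B) x - indicator B x) \<le> e" if t: "t \<in> ?W" for t
  proof -
    have ind: "integrable m (\<lambda>x. indicator (U - K) x :: real)" using UK by (simp add: less_top[symmetric])
    have "(l2_norm m (\<lambda>x. translate \<alpha> t (indicator B) x - indicator B x))\<^sup>2
        \<le> (LINT x|m. indicator (U - K) x + indicator (U - K) (\<alpha> (- t) x))"
      unfolding l2_norm_square
    proof (rule integral_mono)
      show "integrable m (\<lambda>x. (cmod (translate \<alpha> t (indicator B) x - indicator B x))\<^sup>2)"
        by (intro L2_square_integrable L2_diff translate_L2 BL2)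
      show "integrable m (\<lambda>x. indicator (U - K) x + indicator (U - K) (\<alpha> (- t) x) :: real)"
        by (intro Bochner_Integration.integrable_add ind action_integrable[OF ind])
      fix x
      have inv: "\<alpha> t (\<alpha> (- t) x) = x" using action_add[of t "- t" x] by (simp add: action_zero)
      have 1: "x \<in> U" if "\<alpha> (- t) x \<in> K" using VK[of "- t" "\<alpha> (- t) x"] t that inv by auto
      have 2: "\<alpha> (- t) x \<in> U" if "x \<in> K" using VK[of t x] t that by auto
      show "(cmod (translate \<alpha> t (indicator B) x - indicator B x))\<^sup>2
          \<le> indicator (U - K) x + indicator (U - K) (\<alpha> (- t) x)"
      proof (cases "\<alpha> (- t) x \<in> B \<longleftrightarrow> x \<in> B")
        case True
        then show ?thesis by (simp add: translate_apply indicator_def)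
      next
        case False
        then have "x \<in> U - K \<or> \<alpha> (- t) x \<in> U - K" using 1 2 KU(3,4) by blast
        then have "(1::real) \<le> indicator (U - K) x + indicator (U - K) (\<alpha> (- t) x)"
          by (auto simp: indicator_def)
        moreover have "(cmod (translate \<alpha> t (indicator B) x - indicator B x))\<^sup>2 = 1"
          using False by (auto simp: translate_apply indicator_def)
        ultimately show ?thesis by simp
      qed
    qed
    also have "\<dots> = measure m (U - K) + measure m (U - K)"
      unfolding Bochner_Integration.integral_add[OF ind action_integrable[OF ind]]
        action_integral[OF borel_measurable_integrable[OF ind]]
      using UK by simp
    also have "\<dots> \<le> e\<^sup>2" using KU(5) by simp
    finally show ?thesis by (rule power2_le_imp_le) (use e in simp)
  qed
  moreover have "open ?W" using V open_reflection by (intro open_Int) auto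
  ultimately show "\<exists>W. open W \<and> 0 \<in> W \<and>
      (\<forall>t\<in>W. l2_norm m (\<lambda>x. translate \<alpha> t (indicator B) x - indicator B x) \<le> e)"
    using V(1) by (intro exI[of _ ?W]) auto
qed

lemma continuous_orbit_add:
  assumes f: "f \<in> L2 m" "continuous_orbit f" and g: "g \<in> L2 m" "continuous_orbit g"
  shows "continuous_orbit (\<lambda>x. f x + g x)"
  unfolding continuous_orbit_def
proof (intro allI impI)
  fix e :: real assume "e > 0"
  then have e2: "e / 2 > 0" by simp
  from continuous_orbitD[OF f(2) e2] obtain V where V: "open V" "0 \<in> V"
    "\<And>t. t \<in> V \<Longrightarrow> l2_norm m (\<lambda>x. translate \<alpha> t f x - f x) \<le> e / 2" by blast
  from continuous_orbitD[OF g(2) e2] obtain W where W: "open W" "0 \<in> W"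
    "\<And>t. t \<in> W \<Longrightarrow> l2_norm m (\<lambda>x. translate \<alpha> t g x - g x) \<le> e / 2" by blast
  have "l2_norm m (\<lambda>x. translate \<alpha> t (\<lambda>x. f x + g x) x - (f x + g x)) \<le> e" if t: "t \<in> V \<inter> W" for t
  proof -
    have "l2_norm m (\<lambda>x. translate \<alpha> t (\<lambda>x. f x + g x) x - (f x + g x))
      = l2_norm m (\<lambda>x. (translate \<alpha> t f x - f x) + (translate \<alpha> t g x - g x))"
      by (simp add: translate_apply algebra_simps)
    also have "\<dots> \<le> l2_norm m (\<lambda>x. translate \<alpha> t f x - f x) + l2_norm m (\<lambda>x. translate \<alpha> t g x - g x)"
      by (intro l2_norm_triangle L2_diff translate_L2 f g)
    also have "\<dots> \<le> e" using V(3)[of t] W(3)[of t] t by auto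
    finally show ?thesis .
  qed
  then show "\<exists>W. open W \<and> 0 \<in> W \<and>
      (\<forall>t\<in>W. l2_norm m (\<lambda>x. translate \<alpha> t (\<lambda>x. f x + g x) x - (f x + g x)) \<le> e)"
    using V W by (intro exI[of _ "V \<inter> W"]) auto
qed

lemma continuous_orbit_cmult:
  assumes "continuous_orbit f"
  shows "continuous_orbit (\<lambda>x. c * f x)"
  unfolding continuous_orbit_def
proof (intro allI impI)
  fix e :: real assume e: "e > 0"
  have c: "cmod c + 1 > 0" by (simp add: add_nonneg_pos)
  then have "e / (cmod c + 1) > 0" using e by simp
  from continuous_orbitD[OF assms this] obtain V where V: "open V" "0 \<in> V"
    "\<And>t. t \<in> V \<Longrightarrow> l2_norm m (\<lambda>x. translate \<alpha> t f x - f x) \<le> e / (cmod c + 1)" by blast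
  have "l2_norm m (\<lambda>x. translate \<alpha> t (\<lambda>x. c * f x) x - c * f x) \<le> e" if t: "t \<in> V" for t
  proof -
    have "l2_norm m (\<lambda>x. translate \<alpha> t (\<lambda>x. c * f x) x - c * f x)
      = cmod c * l2_norm m (\<lambda>x. translate \<alpha> t f x - f x)"
      by (simp add: translate_apply l2_norm_cmult flip: right_diff_distrib)
    also have "\<dots> \<le> cmod c * (e / (cmod c + 1))" by (intro mult_left_mono V t) simp
    also have "\<dots> \<le> e" using e c by (simp add: field_simps)
    finally show ?thesis .
  qed
  then show "\<exists>W. open W \<and> 0 \<in> W \<and> (\<forall>t\<in>W. l2_norm m (\<lambda>x. translate \<alpha> t (\<lambda>x. c * f x) x - c * f x) \<le> e)"
    using V by (intro exI[of _ V]) auto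
qed

lemma continuous_orbit_simple:
  assumes "simple_function m s"
  shows "continuous_orbit s"
proof -
  have sets: "s -` {y} \<in> sets borel" for y
    using simple_functionD(2)[OF assms, of "{y}"] by (simp add: sets_m)
  \<comment> \<open>Square integrability travels along the induction because
    \<open>continuous_orbit_add\<close> asks for it.\<close>
  have "continuous_orbit (\<lambda>x. \<Sum>y\<in>A. y * indicator (s -` {y}) x) \<and>
      (\<lambda>x. \<Sum>y\<in>A. y * indicator (s -` {y}) x) \<in> L2 m" if "finite A" for A
    using that
  proof induction
    case empty
    have "continuous_orbit (\<lambda>x. 0 * indicator {} x)"
      by (intro continuous_orbit_cmult continuous_orbit_indicator) simp
    then show ?case by (simp add: L2_zero)
  next
    case (insert y A)
    have "continuous_orbit (\<lambda>x. y * indicator (s -` {y}) x)" "(\<lambda>x. y * indicator (s -` {y}) x) \<in> L2 m"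
      by (intro continuous_orbit_cmult continuous_orbit_indicator L2_cmult indicator_L2 sets)+
    note y = this
    show ?case
      unfolding sum.insert[OF insert.hyps]
      using continuous_orbit_add[OF y(2,1) insert.IH[THEN conjunct2] insert.IH[THEN conjunct1]]
        L2_add[OF y(2) insert.IH[THEN conjunct2]] by (rule conjI)
  qed
  moreover have fin: "finite (s ` UNIV)" using simple_functionD(1)[OF assms] by simp
  moreover have "(\<Sum>y\<in>s ` UNIV. y * indicator (s -` {y}) x) = s x" for x
  proof -
    have "(\<Sum>y\<in>s ` UNIV. y * indicator (s -` {y}) x) = (\<Sum>y\<in>s ` UNIV. if s x = y then y else 0)"
      by (intro sum.cong) (auto simp: indicator_def)
    also have "\<dots> = s x" using fin by simp
    finally show ?thesis .
  qed
  ultimately show ?thesis by force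
qed

text \<open>Approximate by a simple function: moving the error costs nothing, since translation is
  isometric, so the same \<open>e / 3\<close> pays for it before and after the move.\<close>

lemma continuous_orbit_L2:
  assumes f: "f \<in> L2 m"
  shows "continuous_orbit f"
  unfolding continuous_orbit_def
proof (intro allI impI)
  fix e :: real assume "e > 0"
  then have e3: "e / 3 > 0" by simp
  from L2_simple_approx[OF f e3] obtain s where s: "simple_function m s" "s \<in> L2 m"
    "l2_norm m (\<lambda>x. f x - s x) \<le> e / 3" by metis
  from continuous_orbitD[OF continuous_orbit_simple[OF s(1)] e3] obtain W where W: "open W" "0 \<in> W"
    "\<And>t. t \<in> W \<Longrightarrow> l2_norm m (\<lambda>x. translate \<alpha> t s x - s x) \<le> e / 3" by blast
  have d: "(\<lambda>x. f x - s x) \<in> L2 m" by (intro L2_diff f s)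
  have "l2_norm m (\<lambda>x. translate \<alpha> t f x - f x) \<le> e" if t: "t \<in> W" for t
  proof -
    have "l2_norm m (\<lambda>x. translate \<alpha> t f x - f x)
      = l2_norm m (\<lambda>x. translate \<alpha> t (\<lambda>x. f x - s x) x + ((translate \<alpha> t s x - s x) + (s x - f x)))"
      by (simp add: translate_apply)
    also have "\<dots> \<le> l2_norm m (translate \<alpha> t (\<lambda>x. f x - s x)) +
        l2_norm m (\<lambda>x. (translate \<alpha> t s x - s x) + (s x - f x))"
      by (intro l2_norm_triangle L2_add L2_diff translate_L2 f s)
    also have "l2_norm m (\<lambda>x. (translate \<alpha> t s x - s x) + (s x - f x))
        \<le> l2_norm m (\<lambda>x. translate \<alpha> t s x - s x) + l2_norm m (\<lambda>x. s x - f x)"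
      by (intro l2_norm_triangle L2_add L2_diff translate_L2 f s)
    also have "l2_norm m (\<lambda>x. s x - f x) = l2_norm m (\<lambda>x. f x - s x)" by (rule l2_norm_commute)
    finally show ?thesis using s(3) W(3)[OF t] translate_norm[OF d, of t] by simp
  qed
  then show "\<exists>W. open W \<and> 0 \<in> W \<and> (\<forall>t\<in>W. l2_norm m (\<lambda>x. translate \<alpha> t f x - f x) \<le> e)"
    using W by (intro exI[of _ W]) auto
qed

text \<open>The difference of the translates by \<open>t\<close> and \<open>s\<close> is the
  translate by \<open>s\<close> of the displacement belonging to \<open>- s + t\<close>. Isometry
  removes the outer translate, so only closeness of \<open>t\<close> to \<open>s\<close>
  matters.\<close>

lemma translate_inner_bound:
  assumes f: "f \<in> L2 m" and g: "g \<in> L2 m"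
  shows "cmod (l2_inner m (translate \<alpha> t f) g - l2_inner m (translate \<alpha> s f) g)
    \<le> l2_norm m (\<lambda>x. translate \<alpha> (- s + t) f x - f x) * l2_norm m g"
proof -
  let ?d = "\<lambda>x. translate \<alpha> (- s + t) f x - f x"
  have d: "?d \<in> L2 m" by (intro L2_diff translate_L2 f)
  have eq: "translate \<alpha> s ?d = (\<lambda>x. translate \<alpha> t f x - translate \<alpha> s f x)"
  proof
    fix x
    have "translate \<alpha> s ?d x = translate \<alpha> s (translate \<alpha> (- s + t) f) x - translate \<alpha> s f x"
      by (simp add: translate_apply)
    then show "translate \<alpha> s ?d x = translate \<alpha> t f x - translate \<alpha> s f x"
      by (simp add: translate_translate)
  qed
  have "l2_inner m (translate \<alpha> t f) g - l2_inner m (translate \<alpha> s f) g = l2_inner m (translate \<alpha> s ?d) g"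
    unfolding eq by (rule l2_inner_diff_left[OF translate_L2[OF f] translate_L2[OF f] g, symmetric])
  also have "cmod \<dots> \<le> l2_norm m (translate \<alpha> s ?d) * l2_norm m g"
    by (intro l2_Cauchy_Schwarz translate_L2 d g)
  finally show ?thesis by (simp only: translate_norm[OF d])
qed

lemma continuous_translate_inner:
  assumes f: "f \<in> L2 m" and g: "g \<in> L2 m"
  shows "continuous_on UNIV (\<lambda>t. l2_inner m (translate \<alpha> t f) g)"
  unfolding continuous_on_def
proof (intro ballI tendstoI)
  fix s :: 'g and e :: real assume e: "e > 0"
  have p: "l2_norm m g + 1 > 0" by (simp add: add_nonneg_pos)
  then have "e / (l2_norm m g + 1) > 0" using e by simp
  from continuous_orbitD[OF continuous_orbit_L2[OF f] this] obtain W where W: "open W" "0 \<in> W"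
    "\<And>t. t \<in> W \<Longrightarrow> l2_norm m (\<lambda>x. translate \<alpha> t f x - f x) \<le> e / (l2_norm m g + 1)" by blast
  have "dist (l2_inner m (translate \<alpha> t f) g) (l2_inner m (translate \<alpha> s f) g) < e" if "- s + t \<in> W" for t
  proof -
    have "dist (l2_inner m (translate \<alpha> t f) g) (l2_inner m (translate \<alpha> s f) g)
      \<le> l2_norm m (\<lambda>x. translate \<alpha> (- s + t) f x - f x) * l2_norm m g"
      unfolding dist_norm by (rule translate_inner_bound[OF f g])
    also have "\<dots> \<le> e / (l2_norm m g + 1) * l2_norm m g" by (intro mult_right_mono W that) simp
    also have "\<dots> < e" using e p by (simp add: field_simps)
    finally show ?thesis .
  qed
  moreover have "open {t. - s + t \<in> W}" by (rule open_translation[OF W(1)])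
  moreover have "s \<in> {t. - s + t \<in> W}" using W(2) by simp
  ultimately show "\<forall>\<^sub>F t in at s within UNIV.
      dist (l2_inner m (translate \<alpha> t f) g) (l2_inner m (translate \<alpha> s f) g) < e"
    unfolding eventually_at_topological by (intro exI[of _ "{t. - s + t \<in> W}"]) simp
qed

section \<open>Existence of the orbit integral\<close>

text \<open>A Riemann sum: on the part of \<open>E\<close> near \<open>t\<close> the translate by
  \<open>s\<close> is replaced by the translate by \<open>t\<close>. The error is proportional to
  the integral of \<open>cmod (\<phi> s)\<close> over \<open>E\<close>, which is additive over
  disjoint pieces; hence the induction varies \<open>E\<close>, and the total does not grow with the
  number of pieces.\<close>

lemma orbit_step_approx:
  assumes f: "f \<in> L2 m" and \<phi>: "\<phi> \<in> Cc" and T: "finite T" and W: "open W"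
    and small: "\<And>t. t \<in> W \<Longrightarrow> l2_norm m (\<lambda>x. translate \<alpha> t f x - f x) \<le> e"
    and E: "E \<in> sets borel" "E \<subseteq> (\<Union>t\<in>T. {s. - t + s \<in> W})"
  shows "\<exists>h\<in>L2 m. \<forall>g\<in>L2 m.
    cmod (l2_inner m h g - (LINT s|mG. indicator E s *\<^sub>R (\<phi> s * l2_inner m (translate \<alpha> s f) g)))
      \<le> e * (LINT s|mG. indicator E s *\<^sub>R cmod (\<phi> s)) * l2_norm m g"
  using T E
proof (induction T arbitrary: E)
  case empty
  then have "E = {}" by simp
  then show ?case by (intro bexI[of _ "\<lambda>x. 0"] ballI) (auto simp: L2_zero l2_inner_def)
next
  case (insert t T)
  let ?V = "{s. - t + s \<in> W}"
  have V: "?V \<in> sets borel" by (rule borel_open[OF open_translation[OF W]])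
  let ?E1 = "E \<inter> ?V" and ?E2 = "E - ?V"
  have E12: "?E1 \<in> sets mG" "?E2 \<in> sets mG" "?E2 \<in> sets borel"
    using insert.prems(1) V by (auto simp: sets_mG)
  have "?E2 \<subseteq> (\<Union>t\<in>T. {s. - t + s \<in> W})" using insert.prems(2) by blast
  from insert.IH[OF E12(3) this] obtain h where h: "h \<in> L2 m"
    and hb: "\<And>g. g \<in> L2 m \<Longrightarrow> cmod (l2_inner m h g - (LINT s|mG. indicator ?E2 s *\<^sub>R (\<phi> s * l2_inner m (translate \<alpha> s f) g)))
      \<le> e * (LINT s|mG. indicator ?E2 s *\<^sub>R cmod (\<phi> s)) * l2_norm m g"
    by blast
  \<comment> \<open>The coefficient of the translate by \<open>t\<close> is the mass that
    \<open>\<phi>\<close> gives to the piece split off from \<open>E\<close>; the rest of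
    \<open>E\<close> is handled by \<open>h\<close>.\<close>
  define c where "c = (LINT s|mG. indicator ?E1 s *\<^sub>R \<phi> s)"
  define u where "u = (\<lambda>x. c * translate \<alpha> t f x + h x)"
  have uL2: "u \<in> L2 m" unfolding u_def by (intro L2_add L2_cmult translate_L2 f h)
  have \<phi>i: "integrable mG \<phi>" by (rule Cc_integrable[OF radon \<phi>])
  have i0: "integrable mG (\<lambda>s. indicator ?E1 s *\<^sub>R \<phi> s)" by (rule integrable_mult_indicator[OF E12(1) \<phi>i])
  have ab: "integrable mG (\<lambda>s. indicator A s *\<^sub>R cmod (\<phi> s))" if "A \<in> sets mG" for A
    by (rule integrable_mult_indicator[OF that integrable_norm[OF \<phi>i]])
  have split: "indicator E s = indicator ?E1 s + (indicator ?E2 s :: real)" for s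
    by (auto simp: indicator_def)
  have "cmod (l2_inner m u g - (LINT s|mG. indicator E s *\<^sub>R (\<phi> s * l2_inner m (translate \<alpha> s f) g)))
      \<le> e * (LINT s|mG. indicator E s *\<^sub>R cmod (\<phi> s)) * l2_norm m g" if g: "g \<in> L2 m" for g
  proof -
    let ?k = "\<lambda>s. l2_inner m (translate \<alpha> s f) g"
    have Fi: "integrable mG (\<lambda>s. \<phi> s * ?k s)"
      by (intro Cc_integrable radon Cc_mult \<phi> continuous_translate_inner f g)
    have i1: "integrable mG (\<lambda>s. indicator ?E1 s *\<^sub>R (\<phi> s * ?k s))"
      and i2: "integrable mG (\<lambda>s. indicator ?E2 s *\<^sub>R (\<phi> s * ?k s))"
      by (rule integrable_mult_indicator[OF E12(1) Fi], rule integrable_mult_indicator[OF E12(2) Fi])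
    have i3: "integrable mG (\<lambda>s. indicator ?E1 s *\<^sub>R \<phi> s * ?k t)"
      by (intro integrable_mult_left i0)
    have e1: "l2_inner m u g = c * ?k t + l2_inner m h g"
      unfolding u_def using l2_inner_add_left[OF L2_cmult[OF translate_L2[OF f]] h g, of c t]
      by (simp add: l2_inner_cmult_left)
    have e2: "c * ?k t = (LINT s|mG. indicator ?E1 s *\<^sub>R \<phi> s * ?k t)"
      unfolding c_def by (rule integral_mult_left_zero[symmetric])
    have e3: "(LINT s|mG. indicator E s *\<^sub>R (\<phi> s * ?k s))
      = (LINT s|mG. indicator ?E1 s *\<^sub>R (\<phi> s * ?k s)) + (LINT s|mG. indicator ?E2 s *\<^sub>R (\<phi> s * ?k s))"
      unfolding split scaleR_add_left by (rule Bochner_Integration.integral_add[OF i1 i2])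
    have eq: "l2_inner m u g - (LINT s|mG. indicator E s *\<^sub>R (\<phi> s * ?k s))
      = (LINT s|mG. indicator ?E1 s *\<^sub>R \<phi> s * ?k t - indicator ?E1 s *\<^sub>R (\<phi> s * ?k s))
        + (l2_inner m h g - (LINT s|mG. indicator ?E2 s *\<^sub>R (\<phi> s * ?k s)))"
      unfolding e1 e2 e3 Bochner_Integration.integral_diff[OF i3 i1] by (rule add_diff_add)
    have "cmod (LINT s|mG. indicator ?E1 s *\<^sub>R \<phi> s * ?k t - indicator ?E1 s *\<^sub>R (\<phi> s * ?k s))
      \<le> (LINT s|mG. cmod (indicator ?E1 s *\<^sub>R \<phi> s * ?k t - indicator ?E1 s *\<^sub>R (\<phi> s * ?k s)))"
      by (rule integral_norm_bound)
    also have "\<dots> \<le> (LINT s|mG. (indicator ?E1 s *\<^sub>R cmod (\<phi> s)) * (e * l2_norm m g))"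
    proof (rule integral_mono)
      show "integrable mG (\<lambda>s. cmod (indicator ?E1 s *\<^sub>R \<phi> s * ?k t - indicator ?E1 s *\<^sub>R (\<phi> s * ?k s)))"
        by (intro integrable_norm Bochner_Integration.integrable_diff i1 i3)
      show "integrable mG (\<lambda>s. (indicator ?E1 s *\<^sub>R cmod (\<phi> s)) * (e * l2_norm m g))"
        using ab[OF E12(1)] by simp
      fix s
      show "cmod (indicator ?E1 s *\<^sub>R \<phi> s * ?k t - indicator ?E1 s *\<^sub>R (\<phi> s * ?k s))
        \<le> (indicator ?E1 s *\<^sub>R cmod (\<phi> s)) * (e * l2_norm m g)"
      proof (cases "s \<in> ?E1")
        case True
        have "cmod (?k s - ?k t) \<le> l2_norm m (\<lambda>x. translate \<alpha> (- t + s) f x - f x) * l2_norm m g"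
          by (rule translate_inner_bound[OF f g])
        also have "\<dots> \<le> e * l2_norm m g" using True by (intro mult_right_mono small) auto
        finally have "cmod (\<phi> s) * cmod (?k t - ?k s) \<le> cmod (\<phi> s) * (e * l2_norm m g)"
          by (intro mult_left_mono) (simp_all add: norm_minus_commute)
        then show ?thesis using True by (simp add: right_diff_distrib[symmetric] norm_mult)
      next
        case False
        then have 0: "indicator ?E1 s = (0::real)" by (rule indicator_eq_0_iff[THEN iffD2])
        show ?thesis unfolding 0 by simp
      qed
    qed
    also have "\<dots> = (LINT s|mG. indicator ?E1 s *\<^sub>R cmod (\<phi> s)) * (e * l2_norm m g)"
      by (rule integral_mult_left_zero)
    also have "\<dots> = e * (LINT s|mG. indicator ?E1 s *\<^sub>R cmod (\<phi> s)) * l2_norm m g"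
      by (simp only: mult_ac)
    finally have b1: "cmod (LINT s|mG. indicator ?E1 s *\<^sub>R \<phi> s * ?k t - indicator ?E1 s *\<^sub>R (\<phi> s * ?k s))
      \<le> e * (LINT s|mG. indicator ?E1 s *\<^sub>R cmod (\<phi> s)) * l2_norm m g" .
    have "(LINT s|mG. indicator E s *\<^sub>R cmod (\<phi> s))
      = (LINT s|mG. indicator ?E1 s *\<^sub>R cmod (\<phi> s)) + (LINT s|mG. indicator ?E2 s *\<^sub>R cmod (\<phi> s))"
      unfolding split scaleR_add_left by (rule Bochner_Integration.integral_add[OF ab[OF E12(1)] ab[OF E12(2)]])
    then have "e * (LINT s|mG. indicator E s *\<^sub>R cmod (\<phi> s)) * l2_norm m g
      = e * (LINT s|mG. indicator ?E1 s *\<^sub>R cmod (\<phi> s)) * l2_norm m g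
        + e * (LINT s|mG. indicator ?E2 s *\<^sub>R cmod (\<phi> s)) * l2_norm m g"
      by (simp only: distrib_left distrib_right)
    then show ?thesis
      unfolding eq using norm_triangle_le[OF add_mono[OF b1 hb[OF g]]] by simp
  qed
  then show ?case using uL2 by blast
qed

text \<open>Finitely many translates of \<open>W\<close> cover the support of \<open>\<phi>\<close>,
  so the Riemann sums approximate the functional in norm, as \<open>l2_representation\<close>
  demands.\<close>

lemma orbit_integral_exists:
  assumes f: "f \<in> L2 m" and \<phi>: "\<phi> \<in> Cc"
  obtains h where "h \<in> L2 m"
    "\<And>g. g \<in> L2 m \<Longrightarrow> l2_inner m h g = (LINT t|mG. \<phi> t * l2_inner m (translate \<alpha> t f) g)"
proof (rule l2_representation[OF m_finite])
  fix e :: real assume e: "e > 0"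
  from \<phi> obtain K where K: "continuous_on UNIV \<phi>" "compact K" "\<And>t. t \<notin> K \<Longrightarrow> \<phi> t = 0"
    by (rule CcE) blast
  let ?I = "LINT s|mG. cmod (\<phi> s)"
  have I: "?I \<ge> 0" by (intro integral_nonneg_AE) simp
  \<comment> \<open>The step error is multiplied by the integral \<open>?I\<close>; dividing by
    \<open>?I + 1\<close> brings the product below \<open>e\<close> even when \<open>?I\<close> is
    0.\<close>
  then have "e / (?I + 1) > 0" using e by (intro divide_pos_pos) linarith+
  from continuous_orbitD[OF continuous_orbit_L2[OF f] this] obtain W where W: "open W" "0 \<in> W"
    "\<And>t. t \<in> W \<Longrightarrow> l2_norm m (\<lambda>x. translate \<alpha> t f x - f x) \<le> e / (?I + 1)" by blast
  have "K \<subseteq> (\<Union>t\<in>K. {s. - t + s \<in> W})" using W(2) by auto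
  from compactE_image[OF K(2) open_translation[OF W(1)] this]
  obtain T where T: "finite T" "K \<subseteq> (\<Union>t\<in>T. {s. - t + s \<in> W})" by metis
  have Ks: "K \<in> sets borel" using K(2) by (simp add: compact_imp_closed)
  from orbit_step_approx[OF f \<phi> T(1) W(1) W(3) Ks T(2)] obtain h where h: "h \<in> L2 m" and
    hb: "\<And>g. g \<in> L2 m \<Longrightarrow> cmod (l2_inner m h g - (LINT s|mG. indicator K s *\<^sub>R (\<phi> s * l2_inner m (translate \<alpha> s f) g)))
      \<le> e / (?I + 1) * (LINT s|mG. indicator K s *\<^sub>R cmod (\<phi> s)) * l2_norm m g" by blast
  have k1: "indicator K s *\<^sub>R (\<phi> s * z) = \<phi> s * z" for s z
    using K(3)[of s] by (cases "s \<in> K") auto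
  have k2: "indicator K s *\<^sub>R cmod (\<phi> s) = cmod (\<phi> s)" for s
    using K(3)[of s] by (cases "s \<in> K") auto
  have "cmod (l2_inner m h g - (LINT s|mG. \<phi> s * l2_inner m (translate \<alpha> s f) g)) \<le> e * l2_norm m g"
    if g: "g \<in> L2 m" for g
  proof -
    have "cmod (l2_inner m h g - (LINT s|mG. \<phi> s * l2_inner m (translate \<alpha> s f) g))
      \<le> e / (?I + 1) * ?I * l2_norm m g"
      using hb[OF g] unfolding k1 k2 .
    also have "\<dots> \<le> e * l2_norm m g"
    proof (rule mult_right_mono)
      have "e / (x + 1) * x \<le> e" if "x \<ge> 0" for x using that e by (simp add: field_simps)
      from this[OF I] show "e / (?I + 1) * ?I \<le> e" .
    qed simp
    finally show ?thesis .
  qed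
  with h show "\<exists>h\<in>L2 m. \<forall>g\<in>L2 m. cmod (l2_inner m h g - (LINT s|mG. \<phi> s * l2_inner m (translate \<alpha> s f) g))
      \<le> e * l2_norm m g" by blast
next
  fix h assume "h \<in> L2 m" "\<And>g. g \<in> L2 m \<Longrightarrow> l2_inner m h g = (LINT s|mG. \<phi> s * l2_inner m (translate \<alpha> s f) g)"
  then show thesis by (rule that)
qed

text \<open>The chosen function is one representative of a class; everything afterwards reads off
  only its inner products.\<close>

lemma orbit_integral:
  assumes f: "f \<in> L2 m" and \<phi>: "\<phi> \<in> Cc"
  shows orbit_integral_L2: "orbit_integral mG \<alpha> m f \<phi> \<in> L2 m"
    and orbit_integral_inner: "g \<in> L2 m \<Longrightarrow>
      l2_inner m (orbit_integral mG \<alpha> m f \<phi>) g = (LINT t|mG. \<phi> t * l2_inner m (translate \<alpha> t f) g)"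
proof -
  from orbit_integral_exists[OF f \<phi>] obtain h where "h \<in> L2 m"
    "\<And>g. g \<in> L2 m \<Longrightarrow> l2_inner m h g = (LINT t|mG. \<phi> t * l2_inner m (translate \<alpha> t f) g)" by metis
  then have "\<exists>h. h \<in> L2 m \<and>
      (\<forall>g\<in>L2 m. l2_inner m h g = (LINT t|mG. \<phi> t * l2_inner m (translate \<alpha> t f) g))" by blast
  from someI_ex[OF this, folded orbit_integral_def]
  show "orbit_integral mG \<alpha> m f \<phi> \<in> L2 m"
    "g \<in> L2 m \<Longrightarrow>
      l2_inner m (orbit_integral mG \<alpha> m f \<phi>) g = (LINT t|mG. \<phi> t * l2_inner m (translate \<alpha> t f) g)"
    by simp_all
qed

section \<open>The autocorrelation and its transform\<close>

lemma translate_inner_diff: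
  assumes "f \<in> L2 m"
  shows "l2_inner m (translate \<alpha> t f) (translate \<alpha> s f) = l2_inner m (translate \<alpha> (t - s) f) f"
  using translate_inner[OF translate_L2[OF assms, of "t - s"] assms, of s]
  by (simp add: translate_translate)

lemma orbit_integral_sesquilinear:
  assumes f: "f \<in> L2 m" and \<phi>: "\<phi> \<in> Cc" and \<psi>: "\<psi> \<in> Cc"
  shows "l2_inner m (orbit_integral mG \<alpha> m f \<phi>) (orbit_integral mG \<alpha> m f \<psi>)
    = sesquilinear_form (\<lambda>t. l2_inner m (translate \<alpha> t f) f) \<phi> \<psi>"
proof -
  let ?N = "orbit_integral mG \<alpha> m f"
  have "l2_inner m (?N \<phi>) (?N \<psi>) = (LINT t|mG. \<phi> t * l2_inner m (translate \<alpha> t f) (?N \<psi>))"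
    by (rule orbit_integral_inner[OF f \<phi> orbit_integral_L2[OF f \<psi>]])
  also have "\<dots> = (LINT t|mG. \<phi> t * (LINT s|mG. cnj (\<psi> s) * l2_inner m (translate \<alpha> (t - s) f) f))"
  proof (intro Bochner_Integration.integral_cong refl arg_cong2[where f = "(*)"])
    fix t
    \<comment> \<open>The property defining the orbit integral concerns the first slot of the inner
      product, so the one in the second slot is reached by conjugate symmetry.\<close>
    have "l2_inner m (translate \<alpha> t f) (?N \<psi>) = cnj (l2_inner m (?N \<psi>) (translate \<alpha> t f))"
      by (rule l2_inner_commute)
    also have "\<dots> = cnj (LINT s|mG. \<psi> s * l2_inner m (translate \<alpha> s f) (translate \<alpha> t f))"
      by (simp only: orbit_integral_inner[OF f \<psi> translate_L2[OF f]])
    also have "\<dots> = (LINT s|mG. cnj (\<psi> s * l2_inner m (translate \<alpha> s f) (translate \<alpha> t f)))"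
      by (rule Bochner_Integration.integral_cnj[symmetric])
    also have "\<dots> = (LINT s|mG. cnj (\<psi> s) * l2_inner m (translate \<alpha> (t - s) f) f)"
    proof (intro Bochner_Integration.integral_cong refl)
      fix s
      have "cnj (l2_inner m (translate \<alpha> s f) (translate \<alpha> t f)) = l2_inner m (translate \<alpha> (t - s) f) f"
        unfolding l2_inner_commute[symmetric] by (rule translate_inner_diff[OF f])
      then show "cnj (\<psi> s * l2_inner m (translate \<alpha> s f) (translate \<alpha> t f))
          = cnj (\<psi> s) * l2_inner m (translate \<alpha> (t - s) f) f" by (simp only: complex_cnj_mult)
    qed
    finally show "l2_inner m (translate \<alpha> t f) (?N \<psi>)
        = (LINT s|mG. cnj (\<psi> s) * l2_inner m (translate \<alpha> (t - s) f) f)" .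
  qed
  finally show ?thesis unfolding sesquilinear_form_def .
qed

lemma translate_inner_self_bound:
  assumes f: "f \<in> L2 m"
  shows "cmod (l2_inner m (translate \<alpha> t f) f) \<le> (l2_norm m f)\<^sup>2"
  using l2_Cauchy_Schwarz[OF translate_L2[OF f] f, of t]
  by (simp add: translate_norm[OF f] power2_eq_square)

text \<open>Evaluates the \<open>THE\<close> in the definition: \<open>conv\<close> makes the
  functional with this density a solution, and \<open>complex_measure_eqI\<close> makes it the only
  one. Restriction to \<open>Cc\<close> is forced by the extensionality clause of
  \<open>complex_measure\<close>.\<close>

lemma autocorrelation_eq:
  assumes f: "f \<in> L2 m"
  shows "autocorrelation mG \<alpha> m f = restrict (\<lambda>\<phi>. LINT u|mG. \<phi> u * l2_inner m (translate \<alpha> u f) f) Cc"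
    (is "_ = ?\<gamma>")
proof -
  let ?c = "\<lambda>t. l2_inner m (translate \<alpha> t f) f"
  have cm: "complex_measure ?\<gamma>"
    by (rule density_complex_measure[OF continuous_translate_inner[OF f f] translate_inner_self_bound[OF f]])
  have conv: "?\<gamma> (group_convolution mG \<phi> (tilde \<psi>))
      = l2_inner m (orbit_integral mG \<alpha> m f \<phi>) (orbit_integral mG \<alpha> m f \<psi>)" if "\<phi> \<in> Cc" "\<psi> \<in> Cc" for \<phi> \<psi>
    using sesquilinear_form_convolution[OF continuous_translate_inner[OF f f] that]
      group_convolution_Cc[OF that(1) tilde_Cc[OF that(2)]] orbit_integral_sesquilinear[OF f that]
    by simp
  show ?thesis
    unfolding autocorrelation_def
  proof (rule the_equality)
    show "complex_measure ?\<gamma> \<and> (\<forall>\<phi>\<in>Cc. \<forall>\<psi>\<in>Cc. ?\<gamma> (group_convolution mG \<phi> (tilde \<psi>)) =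
        l2_inner m (orbit_integral mG \<alpha> m f \<phi>) (orbit_integral mG \<alpha> m f \<psi>))"
      by (intro conjI ballI cm conv)
  next
    fix \<gamma>
    assume \<gamma>: "complex_measure \<gamma> \<and> (\<forall>\<phi>\<in>Cc. \<forall>\<psi>\<in>Cc. \<gamma> (group_convolution mG \<phi> (tilde \<psi>)) =
        l2_inner m (orbit_integral mG \<alpha> m f \<phi>) (orbit_integral mG \<alpha> m f \<psi>))"
    show "\<gamma> = ?\<gamma>"
    proof (rule complex_measure_eqI[OF conjunct1[OF \<gamma>] cm])
      fix \<phi> \<psi> :: "'g \<Rightarrow> complex" assume "\<phi> \<in> Cc" "\<psi> \<in> Cc"
      note \<phi>\<psi> = this
      show "\<gamma> (group_convolution mG \<phi> (tilde \<psi>)) = ?\<gamma> (group_convolution mG \<phi> (tilde \<psi>))"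
        unfolding conv[OF \<phi>\<psi>] by (rule \<gamma>[THEN conjunct2, THEN bspec, THEN bspec, OF \<phi>\<psi>])
    qed
  qed
qed

lemma autocorrelation_convolution:
  assumes f: "f \<in> L2 m" and \<phi>: "\<phi> \<in> Cc" and \<psi>: "\<psi> \<in> Cc"
  shows "autocorrelation mG \<alpha> m f (group_convolution mG \<phi> (tilde \<psi>))
    = sesquilinear_form (\<lambda>t. l2_inner m (translate \<alpha> t f) f) \<phi> \<psi>"
  using group_convolution_Cc[OF \<phi> tilde_Cc[OF \<psi>]]
  by (simp add: autocorrelation_eq[OF f] sesquilinear_form_convolution[OF continuous_translate_inner[OF f f] \<phi> \<psi>])

lemma fourier_transform_autocorrelation:
  assumes f: "f \<in> L2 m"
  shows "fourier_transform mG (autocorrelation mG \<alpha> m f) = spectral_measure \<alpha> m f"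
  unfolding fourier_transform_def spectral_measure_def
proof (rule arg_cong[where f = The], rule ext)
  fix \<mu> :: "'g dual measure"
  show "(radon_measure \<mu> \<and> (\<forall>\<phi>\<in>Cc. integrable \<mu> (\<lambda>\<eta>. (cmod (check_transform mG \<phi> \<eta>))\<^sup>2) \<and>
      autocorrelation mG \<alpha> m f (group_convolution mG \<phi> (tilde \<phi>)) =
        complex_of_real (LINT \<eta>|\<mu>. (cmod (check_transform mG \<phi> \<eta>))\<^sup>2)))
    \<longleftrightarrow> radon_measure \<mu> \<and> finite_measure \<mu> \<and>
      (\<forall>t. l2_inner m (translate \<alpha> t f) f = (LINT \<eta>|\<mu>. char_apply \<eta> t))"
    using transform_characterization[OF continuous_translate_inner[OF f f] translate_inner_self_bound[OF f], of \<mu>]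
      autocorrelation_convolution[OF f]
    by (simp cong: ball_cong conj_cong)
qed

end

theorem theorem2p1:
  fixes mG :: "'g::{topological_ab_group_add, t2_space} measure"
    and \<alpha> :: "'g \<Rightarrow> 'x::t2_space \<Rightarrow> 'x"
    and m :: "'x measure"
    and f :: "'x \<Rightarrow> complex"
  assumes "locally_compact_space (euclidean :: 'g topology)"
    and "sigma_compact (UNIV :: 'g set)"
    and "haar_measure mG"
    and "dynamical_system \<alpha> m"
    and "f \<in> L2 m"
  shows "fourier_transform mG (autocorrelation mG \<alpha> m f) = spectral_measure \<alpha> m f"
proof -
  interpret lca_dynamics mG \<alpha> m
    by unfold_locales (rule assms)+
  show ?thesis by (rule fourier_transform_autocorrelation[OF assms(5)])
qed

end
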